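(* Let $\mathcal{C}$ be a model category with normal functorial factorizations (see context) and class of weak equivalences $\mathcal{W}$. Let $r:\mathcal{C}\to\mathcal{C}_{fc}$ be the corestriction of the fibrant-cofibrant replacement functor $RQ$, let $i':\mathcal{C}_{fc}\to\mathcal{H}o(\mathcal{C}_{fc})$ be the inclusion into the homotopy 2-category of $(\mathcal{C}_{fc},\mathcal{W}\cap\mathcal{C}_{fc})$, let $q=i'r$, and let $\pi_0:\mathcal{H}o(\mathcal{C}_{fc})\to\pi_0\mathcal{H}o(\mathcal{C}_{fc})$ be the canonical 2-functor. Then the composite functor $\pi_0 q:\mathcal{C}\to\pi_0\mathcal{H}o(\mathcal{C}_{fc})$ is the localization of $\mathcal{C}$ with respect to $\mathcal{W}$ in the sense that it sends weak equivalences to isomorphisms, and the precomposition $$(\pi_0 q)^*=q^*\pi_0^*: Hom(\pi_0\mathcal{H}o(\mathcal{C}_{fc}),\mathcal{X})\longrightarrow Hom(\mathcal{C},\mathcal{X})_+$$ is an equivalence of categories for every category $\mathcal{X}$.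
   Context: Model category means Quillen's closed model category (finite limits and colimits; three classes closed under retracts and composition; lifting; factorization; 3-for-2). $\mathcal{C}_{fc}$ is the full subcategory of fibrant-cofibrant objects. Standing assumption (normal functorial factorizations). Both factorizations, (cofibration, trivial fibration) and (trivial cofibration, fibration), are functorial: each $f$ has a chosen factorization $f=\rho_f\lambda_f$, and each commutative square $(u,v):f\to g$ induces a map $F(u,v)$ between the middle objects commuting with the $\lambda$'s and $\rho$'s, with $F(id,id)=id$ and $F(uu',vv')=F(u,v)F(u',v')$. Factoring $0\to X$ as a cofibration $0\to QX$ followed by a trivial fibration $p_X:QX\to X$ gives a functor $Q$ and a natural transformation $p:Q\Rightarrow Id$; factoring $X\to 1$ as a trivial cofibration $v_X:X\to RX$ followed by a fibration gives a functor $R$ and a natural transformation $v:Id\Rightarrow R$. Normality: if $X$ is cofibrant then $QX=X$, $p_X=id_X$; if $X$ is fibrant then $RX=X$, $v_X=id_X$. $RQ$ takes values in $\mathcal{C}_{fc}$. $Hom(\mathcal{B},\mathcal{X})$ is the category of functors and natural transformations; $Hom(\mathcal{C},\mathcal{X})_+$ is the full subcategory of functors sending $\mathcal{W}$ to isomorphisms. For a 2-category $\mathcal{B}$, $\pi_0\mathcal{B}$ is the category with the same objects and with $(\pi_0\mathcal{B})(X,Y)$ the set of connected components of the category $\mathcal{B}(X,Y)$; $\pi_0:\mathcal{B}\to\pi_0\mathcal{B}$ is the obvious 2-functor (categories being regarded as 2-categories with only identity 2-cells). The homotopy 2-category $\mathcal{H}o(\mathcal{A})$ of a category $\mathcal{A}$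 with a class $\Sigma$ of arrows containing identities (here $\mathcal{A}=\mathcal{C}_{fc}$, $\Sigma=\mathcal{W}\cap\mathcal{C}_{fc}$). An arrow $f:X\to Y$ of a 2-category is an equivalence if there are $g:Y\to X$ and invertible 2-cells $id_X\Rightarrow gf$, $fg\Rightarrow id_Y$; arrows are identified with their identity 2-cells. A cylinder $C=(W,Z,d_0,d_1,s,x)$ for an object $X$ consists of arrows $d_0,d_1:X\to W$, $s:W\to Z$, $x:X\to Z$ of $\mathcal{A}$ with $s\in\Sigma$ and $sd_0=sd_1=x$. A homotopy $H=(C,h)$ from $f$ to $g$ ($f,g:X\to Y$) is a cylinder $C$ for $X$ with an arrow $h:W\to Y$ such that $hd_0=f$, $hd_1=g$. If $F:\mathcal{A}\to\mathcal{D}$ is a 2-functor into a 2-category sending $\Sigma$ to equivalences, there is a unique 2-cell $\widehat{FC}:Fd_0\Rightarrow Fd_1$ with $Fs\,\widehat{FC}=Fx$ (the identity 2-cell); put $\widehat{FH}=Fh\,\widehat{FC}:Ff\Rightarrow Fg$. $\mathcal{H}o(\mathcal{A})$ has the objects and arrows of $\mathcal{A}$. A 2-cell $f\Rightarrow g$ is a class $[H_n,\dots,H_1]$ of a finite sequence of composable homotopies from $f$ to $g$, where two sequences $(H_n,\dots,H_1)$, $(K_m,\dots,K_1)$ are equivalent iff $\widehat{FH_n}\circ\cdots\circ\widehat{FH_1}=\widehat{FK_m}\circ\cdots\circ\widehat{FK_1}$ for every 2-category $\mathcal{D}$ and every 2-functor $F:\mathcal{A}\to\mathcal{D}$ sending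 $\Sigma$ to equivalences. Vertical composition is juxtaposition of sequences; whiskering is $r[H]=[(C,rh)]$ and $[H]l=[(Cl,h)]$ with $Cl=(W,Z,d_0l,d_1l,s,xl)$, extended termwise. The inclusion $\mathcal{A}\to\mathcal{H}o(\mathcal{A})$ is the identity on objects and arrows. *)

theory Defs
  imports "HOL-Library.FuncSet"
begin

section \<open>Categories and functors\<close>

record ('o, 'm) cat =
  Obj :: "'o set"
  Arr :: "'m set"
  Dom :: "'m \<Rightarrow> 'o"
  Cod :: "'m \<Rightarrow> 'o"
  Ide :: "'o \<Rightarrow> 'm"
  Cmp :: "'m \<Rightarrow> 'm \<Rightarrow> 'm"  (infixl "\<cdot>\<index>" 70)

definition Hom :: "('o, 'm, 'z) cat_scheme \<Rightarrow> 'o \<Rightarrow> 'o \<Rightarrow> 'm set" where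
  "Hom C X Y = {f \<in> Arr C. Dom C f = X \<and> Cod C f = Y}"

locale category =
  fixes C :: "('o, 'm, 'z) cat_scheme" (structure)
  assumes dom_obj: "f \<in> Arr C \<Longrightarrow> Dom C f \<in> Obj C"
    and cod_obj: "f \<in> Arr C \<Longrightarrow> Cod C f \<in> Obj C"
    and ide_hom: "X \<in> Obj C \<Longrightarrow> Ide C X \<in> Hom C X X"
    and cmp_hom: "f \<in> Hom C X Y \<Longrightarrow> g \<in> Hom C Y Z \<Longrightarrow> g \<cdot> f \<in> Hom C X Z"
    and ide_left: "f \<in> Hom C X Y \<Longrightarrow> Ide C Y \<cdot> f = f"
    and ide_right: "f \<in> Hom C X Y \<Longrightarrow> f \<cdot> Ide C X = f"
    and cmp_assoc: "f \<in> Hom C X Y \<Longrightarrow> g \<in> Hom C Y Z \<Longrightarrow> h \<in> Hom C Z V \<Longrightarrow>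
      h \<cdot> (g \<cdot> f) = (h \<cdot> g) \<cdot> f"

definition is_iso :: "('o, 'm, 'z) cat_scheme \<Rightarrow> 'm \<Rightarrow> bool" where
  "is_iso C f \<longleftrightarrow> f \<in> Arr C \<and>
     (\<exists>g \<in> Hom C (Cod C f) (Dom C f).
        g \<cdot>\<^bsub>C\<^esub> f = Ide C (Dom C f) \<and> f \<cdot>\<^bsub>C\<^esub> g = Ide C (Cod C f))"

definition isomorphic :: "('o, 'm, 'z) cat_scheme \<Rightarrow> 'o \<Rightarrow> 'o \<Rightarrow> bool" where
  "isomorphic C X Y \<longleftrightarrow> (\<exists>f \<in> Hom C X Y. is_iso C f)"

definition op_cat :: "('o, 'm, 'z) cat_scheme \<Rightarrow> ('o, 'm) cat" where
  "op_cat C = \<lparr>Obj = Obj C, Arr = Arr C, Dom = Cod C, Cod = Dom C, Ide = Ide C,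
     Cmp = (\<lambda>g f. f \<cdot>\<^bsub>C\<^esub> g)\<rparr>"

definition full_subcat :: "('o, 'm, 'z) cat_scheme \<Rightarrow> 'o set \<Rightarrow> ('o, 'm) cat" where
  "full_subcat C S = \<lparr>Obj = Obj C \<inter> S, Arr = {f \<in> Arr C. Dom C f \<in> S \<and> Cod C f \<in> S},
     Dom = Dom C, Cod = Cod C, Ide = Ide C, Cmp = Cmp C\<rparr>"

definition is_initial :: "('o, 'm, 'z) cat_scheme \<Rightarrow> 'o \<Rightarrow> bool" where
  "is_initial C I \<longleftrightarrow> I \<in> Obj C \<and> (\<forall>X \<in> Obj C. \<exists>!f. f \<in> Hom C I X)"

definition is_terminal :: "('o, 'm, 'z) cat_scheme \<Rightarrow> 'o \<Rightarrow> bool" where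
  "is_terminal C T \<longleftrightarrow> T \<in> Obj C \<and> (\<forall>X \<in> Obj C. \<exists>!f. f \<in> Hom C X T)"

text \<open>The components of functors, and of natural transformations below, are required to be
  extensional (undefined outside the source), so that HOL equality of their representations is
  equality of functors and of natural transformations.\<close>

record ('o, 'm, 'p, 'n) func =
  FOb :: "'o \<Rightarrow> 'p"
  FAr :: "'m \<Rightarrow> 'n"

locale is_functor =
  fixes A :: "('o, 'm, 'y) cat_scheme" and B :: "('p, 'n, 'z) cat_scheme"
    and F :: "('o, 'm, 'p, 'n, 'w) func_scheme"
  assumes dom_category: "category A"
    and cod_category: "category B"
    and ob_ext: "FOb F \<in> extensional (Obj A)"
    and ar_ext: "FAr F \<in> extensional (Arr A)"
    and ob_obj: "X \<in> Obj A \<Longrightarrow> FOb F X \<in> Obj B"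
    and ar_hom: "f \<in> Hom A X Y \<Longrightarrow> FAr F f \<in> Hom B (FOb F X) (FOb F Y)"
    and ar_ide: "X \<in> Obj A \<Longrightarrow> FAr F (Ide A X) = Ide B (FOb F X)"
    and ar_cmp: "f \<in> Hom A X Y \<Longrightarrow> g \<in> Hom A Y Z \<Longrightarrow>
      FAr F (g \<cdot>\<^bsub>A\<^esub> f) = FAr F g \<cdot>\<^bsub>B\<^esub> FAr F f"

definition id_func :: "('o, 'm, 'z) cat_scheme \<Rightarrow> ('o, 'm, 'o, 'm) func" where
  "id_func A = \<lparr>FOb = (\<lambda>X\<in>Obj A. X), FAr = (\<lambda>f\<in>Arr A. f)\<rparr>"

definition comp_func :: "('o, 'm, 'z) cat_scheme \<Rightarrow> ('p, 'n, 'q, 'k, 'v) func_scheme \<Rightarrow>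
    ('o, 'm, 'p, 'n, 'w) func_scheme \<Rightarrow> ('o, 'm, 'q, 'k) func" where
  "comp_func A G F = \<lparr>FOb = (\<lambda>X\<in>Obj A. FOb G (FOb F X)), FAr = (\<lambda>f\<in>Arr A. FAr G (FAr F f))\<rparr>"

record ('f, 'o, 'n) ntrans =
  NDom :: 'f
  NCod :: 'f
  NCmp :: "'o \<Rightarrow> 'n"

definition is_nat_trans :: "('o, 'm, 'y) cat_scheme \<Rightarrow> ('p, 'n, 'z) cat_scheme \<Rightarrow>
    (('o, 'm, 'p, 'n, 'w) func_scheme, 'o, 'n) ntrans \<Rightarrow> bool" where
  "is_nat_trans A B \<theta> \<longleftrightarrow>
     is_functor A B (NDom \<theta>) \<and> is_functor A B (NCod \<theta>) \<and> NCmp \<theta> \<in> extensional (Obj A) \<and>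
     (\<forall>X \<in> Obj A. NCmp \<theta> X \<in> Hom B (FOb (NDom \<theta>) X) (FOb (NCod \<theta>) X)) \<and>
     (\<forall>X Y. \<forall>f \<in> Hom A X Y.
        NCmp \<theta> Y \<cdot>\<^bsub>B\<^esub> FAr (NDom \<theta>) f = FAr (NCod \<theta>) f \<cdot>\<^bsub>B\<^esub> NCmp \<theta> X)"

definition functor_cat :: "('o, 'm, 'y) cat_scheme \<Rightarrow> ('p, 'n, 'z) cat_scheme \<Rightarrow>
    (('o, 'm, 'p, 'n) func, (('o, 'm, 'p, 'n) func, 'o, 'n) ntrans) cat" where
  "functor_cat A B = \<lparr>
     Obj = {F. is_functor A B F},
     Arr = {\<theta>. is_nat_trans A B \<theta>},
     Dom = NDom,
     Cod = NCod,
     Ide = (\<lambda>F. \<lparr>NDom = F, NCod = F, NCmp = (\<lambda>X\<in>Obj A. Ide B (FOb F X))\<rparr>),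
     Cmp = (\<lambda>\<eta> \<theta>. \<lparr>NDom = NDom \<theta>, NCod = NCod \<eta>,
              NCmp = (\<lambda>X\<in>Obj A. NCmp \<eta> X \<cdot>\<^bsub>B\<^esub> NCmp \<theta> X)\<rparr>)\<rparr>"

text \<open>The category \<open>Hom(C, X)\<^sub>+\<close> for the class \<open>W\<close>.\<close>

definition functor_cat_inv :: "('o, 'm, 'y) cat_scheme \<Rightarrow> 'm set \<Rightarrow> ('p, 'n, 'z) cat_scheme \<Rightarrow>
    (('o, 'm, 'p, 'n) func, (('o, 'm, 'p, 'n) func, 'o, 'n) ntrans) cat" where
  "functor_cat_inv C W X = full_subcat (functor_cat C X) {F. \<forall>w \<in> W. is_iso X (FAr F w)}"

definition precomp :: "('o, 'm, 'x) cat_scheme \<Rightarrow> ('p, 'n, 'y) cat_scheme \<Rightarrow>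
    ('o, 'm, 'p, 'n) func \<Rightarrow> ('q, 'k, 'z) cat_scheme \<Rightarrow>
    (('p, 'n, 'q, 'k) func, (('p, 'n, 'q, 'k) func, 'p, 'k) ntrans,
     ('o, 'm, 'q, 'k) func, (('o, 'm, 'q, 'k) func, 'o, 'k) ntrans) func" where
  "precomp A B P X = \<lparr>
     FOb = (\<lambda>G\<in>Obj (functor_cat B X). comp_func A G P),
     FAr = (\<lambda>\<theta>\<in>Arr (functor_cat B X).
              \<lparr>NDom = comp_func A (NDom \<theta>) P, NCod = comp_func A (NCod \<theta>) P,
               NCmp = (\<lambda>a\<in>Obj A. NCmp \<theta> (FOb P a))\<rparr>)\<rparr>"

definition is_equivalence_of_categories :: "('o, 'm, 'y) cat_scheme \<Rightarrow> ('p, 'n, 'z) cat_scheme \<Rightarrow>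
    ('o, 'm, 'p, 'n) func \<Rightarrow> bool" where
  "is_equivalence_of_categories A B F \<longleftrightarrow> is_functor A B F \<and>
     (\<exists>G :: ('p, 'n, 'o, 'm) func. is_functor B A G \<and>
        isomorphic (functor_cat A A) (id_func A) (comp_func A G F) \<and>
        isomorphic (functor_cat B B) (comp_func B F G) (id_func B))"

definition is_cone :: "('j, 'u, 'y) cat_scheme \<Rightarrow> ('o, 'm, 'z) cat_scheme \<Rightarrow>
    ('j, 'u, 'o, 'm) func \<Rightarrow> 'o \<Rightarrow> ('j \<Rightarrow> 'm) \<Rightarrow> bool" where
  "is_cone J C D L \<pi> \<longleftrightarrow> L \<in> Obj C \<and> (\<forall>j \<in> Obj J. \<pi> j \<in> Hom C L (FOb D j)) \<and>
     (\<forall>u \<in> Arr J. FAr D u \<cdot>\<^bsub>C\<^esub> \<pi> (Dom J u) = \<pi> (Cod J u))"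

definition is_limit_cone :: "('j, 'u, 'y) cat_scheme \<Rightarrow> ('o, 'm, 'z) cat_scheme \<Rightarrow>
    ('j, 'u, 'o, 'm) func \<Rightarrow> 'o \<Rightarrow> ('j \<Rightarrow> 'm) \<Rightarrow> bool" where
  "is_limit_cone J C D L \<pi> \<longleftrightarrow> is_cone J C D L \<pi> \<and>
     (\<forall>L' \<pi>'. is_cone J C D L' \<pi>' \<longrightarrow>
        (\<exists>!m. m \<in> Hom C L' L \<and> (\<forall>j \<in> Obj J. \<pi> j \<cdot>\<^bsub>C\<^esub> m = \<pi>' j)))"

text \<open>Every finite category is isomorphic to one whose objects and arrows are natural numbers, so
  it suffices to let the index category range over these.\<close>

definition has_finite_limits :: "('o, 'm, 'z) cat_scheme \<Rightarrow> bool" where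
  "has_finite_limits C \<longleftrightarrow>
     (\<forall>(J :: (nat, nat) cat) D. finite (Obj J) \<and> finite (Arr J) \<and> is_functor J C D \<longrightarrow>
        (\<exists>L \<pi>. is_limit_cone J C D L \<pi>))"

definition has_finite_colimits :: "('o, 'm, 'z) cat_scheme \<Rightarrow> bool" where
  "has_finite_colimits C \<longleftrightarrow> has_finite_limits (op_cat C)"


section \<open>2-categories\<close>

text \<open>Strict 2-categories. \<open>HCmp\<close> is horizontal composition; whiskering with an arrow is
  horizontal composition with its identity 2-cell.\<close>

record ('o, 'm, 'c) cat2 = "('o, 'm) cat" +
  Cell :: "'c set"
  Src :: "'c \<Rightarrow> 'm"
  Tgt :: "'c \<Rightarrow> 'm"
  VIde :: "'m \<Rightarrow> 'c"
  VCmp :: "'c \<Rightarrow> 'c \<Rightarrow> 'c"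
  HCmp :: "'c \<Rightarrow> 'c \<Rightarrow> 'c"

definition Cells :: "('o, 'm, 'c, 'z) cat2_scheme \<Rightarrow> 'm \<Rightarrow> 'm \<Rightarrow> 'c set" where
  "Cells B f g = {\<alpha> \<in> Cell B. Src B \<alpha> = f \<and> Tgt B \<alpha> = g}"

definition hom_cat :: "('o, 'm, 'c, 'z) cat2_scheme \<Rightarrow> 'o \<Rightarrow> 'o \<Rightarrow> ('m, 'c) cat" where
  "hom_cat B X Y = \<lparr>Obj = Hom B X Y, Arr = {\<alpha> \<in> Cell B. Src B \<alpha> \<in> Hom B X Y},
     Dom = Src B, Cod = Tgt B, Ide = VIde B, Cmp = VCmp B\<rparr>"

locale category2 = category B
  for B :: "('o, 'm, 'c, 'z) cat2_scheme" +
  assumes src_arr: "\<alpha> \<in> Cell B \<Longrightarrow> Src B \<alpha> \<in> Arr B"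
    and hom_category: "X \<in> Obj B \<Longrightarrow> Y \<in> Obj B \<Longrightarrow> category (hom_cat B X Y)"
    and hcmp_cells: "f \<in> Hom B X Y \<Longrightarrow> h \<in> Hom B Y Z \<Longrightarrow> \<alpha> \<in> Cells B f g \<Longrightarrow> \<beta> \<in> Cells B h k \<Longrightarrow>
      HCmp B \<beta> \<alpha> \<in> Cells B (h \<cdot>\<^bsub>B\<^esub> f) (k \<cdot>\<^bsub>B\<^esub> g)"
    and hcmp_vide: "f \<in> Hom B X Y \<Longrightarrow> h \<in> Hom B Y Z \<Longrightarrow>
      HCmp B (VIde B h) (VIde B f) = VIde B (h \<cdot>\<^bsub>B\<^esub> f)"
    and interchange: "f \<in> Hom B X Y \<Longrightarrow> h \<in> Hom B Y Z \<Longrightarrow>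
      \<alpha> \<in> Cells B f f' \<Longrightarrow> \<alpha>' \<in> Cells B f' f'' \<Longrightarrow> \<beta> \<in> Cells B h h' \<Longrightarrow> \<beta>' \<in> Cells B h' h'' \<Longrightarrow>
      HCmp B (VCmp B \<beta>' \<beta>) (VCmp B \<alpha>' \<alpha>) = VCmp B (HCmp B \<beta>' \<alpha>') (HCmp B \<beta> \<alpha>)"
    and hcmp_assoc: "f \<in> Hom B X Y \<Longrightarrow> h \<in> Hom B Y Z \<Longrightarrow> k \<in> Hom B Z V \<Longrightarrow>
      \<alpha> \<in> Cells B f f' \<Longrightarrow> \<beta> \<in> Cells B h h' \<Longrightarrow> \<gamma> \<in> Cells B k k' \<Longrightarrow>
      HCmp B \<gamma> (HCmp B \<beta> \<alpha>) = HCmp B (HCmp B \<gamma> \<beta>) \<alpha>"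
    and hcmp_ide_left: "f \<in> Hom B X Y \<Longrightarrow> \<alpha> \<in> Cells B f g \<Longrightarrow> HCmp B (VIde B (Ide B Y)) \<alpha> = \<alpha>"
    and hcmp_ide_right: "f \<in> Hom B X Y \<Longrightarrow> \<alpha> \<in> Cells B f g \<Longrightarrow> HCmp B \<alpha> (VIde B (Ide B X)) = \<alpha>"

definition is_inv_cell :: "('o, 'm, 'c, 'z) cat2_scheme \<Rightarrow> 'c \<Rightarrow> bool" where
  "is_inv_cell B \<alpha> \<longleftrightarrow> is_iso (hom_cat B (Dom B (Src B \<alpha>)) (Cod B (Src B \<alpha>))) \<alpha>"

definition is_equivalence :: "('o, 'm, 'c, 'z) cat2_scheme \<Rightarrow> 'm \<Rightarrow> bool" where
  "is_equivalence B f \<longleftrightarrow> f \<in> Arr B \<and>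
     (\<exists>g \<in> Hom B (Cod B f) (Dom B f).
        (\<exists>\<alpha> \<in> Cells B (Ide B (Dom B f)) (g \<cdot>\<^bsub>B\<^esub> f). is_inv_cell B \<alpha>) \<and>
        (\<exists>\<beta> \<in> Cells B (f \<cdot>\<^bsub>B\<^esub> g) (Ide B (Cod B f)). is_inv_cell B \<beta>))"

text \<open>A category as a 2-category with only identity 2-cells; the identity 2-cell of an arrow is
  represented by the arrow itself.\<close>

definition disc :: "('o, 'm, 'z) cat_scheme \<Rightarrow> ('o, 'm, 'm) cat2" where
  "disc C = \<lparr>Obj = Obj C, Arr = Arr C, Dom = Dom C, Cod = Cod C, Ide = Ide C, Cmp = Cmp C,
     Cell = Arr C, Src = (\<lambda>f. f), Tgt = (\<lambda>f. f), VIde = (\<lambda>f. f), VCmp = (\<lambda>g f. f), HCmp = Cmp C\<rparr>"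

record ('o, 'm, 'c, 'p, 'n, 'e) func2 = "('o, 'm, 'p, 'n) func" +
  FCell :: "'c \<Rightarrow> 'e"

locale is_functor2 = is_functor A B F
  for A :: "('o, 'm, 'c, 'y) cat2_scheme" and B :: "('p, 'n, 'e, 'z) cat2_scheme"
    and F :: "('o, 'm, 'c, 'p, 'n, 'e) func2" +
  assumes dom_category2: "category2 A"
    and cod_category2: "category2 B"
    and cell_ext: "FCell F \<in> extensional (Cell A)"
    and cell_cells: "\<alpha> \<in> Cells A f g \<Longrightarrow> FCell F \<alpha> \<in> Cells B (FAr F f) (FAr F g)"
    and cell_vide: "f \<in> Arr A \<Longrightarrow> FCell F (VIde A f) = VIde B (FAr F f)"
    and cell_vcmp: "\<alpha> \<in> Cells A f g \<Longrightarrow> \<beta> \<in> Cells A g h \<Longrightarrow>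
      FCell F (VCmp A \<beta> \<alpha>) = VCmp B (FCell F \<beta>) (FCell F \<alpha>)"
    and cell_hcmp: "f \<in> Hom A X Y \<Longrightarrow> h \<in> Hom A Y Z \<Longrightarrow> \<alpha> \<in> Cells A f g \<Longrightarrow> \<beta> \<in> Cells A h k \<Longrightarrow>
      FCell F (HCmp A \<beta> \<alpha>) = HCmp B (FCell F \<beta>) (FCell F \<alpha>)"

definition comp_func2 :: "('o, 'm, 'c, 'z) cat2_scheme \<Rightarrow> ('p, 'n, 'e, 'q, 'k, 'l) func2 \<Rightarrow>
    ('o, 'm, 'c, 'p, 'n, 'e) func2 \<Rightarrow> ('o, 'm, 'c, 'q, 'k, 'l) func2" where
  "comp_func2 A G F = \<lparr>FOb = (\<lambda>X\<in>Obj A. FOb G (FOb F X)), FAr = (\<lambda>f\<in>Arr A. FAr G (FAr F f)),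
     FCell = (\<lambda>\<alpha>\<in>Cell A. FCell G (FCell F \<alpha>))\<rparr>"

text \<open>Functors between categories correspond to 2-functors between the associated 2-categories.\<close>

definition disc_func :: "('o, 'm, 'p, 'n) func \<Rightarrow> ('o, 'm, 'm, 'p, 'n, 'n) func2" where
  "disc_func F = \<lparr>FOb = FOb F, FAr = FAr F, FCell = FAr F\<rparr>"

definition underlying_func :: "('o, 'm, 'c, 'p, 'n, 'e) func2 \<Rightarrow> ('o, 'm, 'p, 'n) func" where
  "underlying_func F = \<lparr>FOb = FOb F, FAr = FAr F\<rparr>"

definition is_nat_trans2 :: "('o, 'm, 'c, 'y) cat2_scheme \<Rightarrow> ('p, 'n, 'e, 'z) cat2_scheme \<Rightarrow>
    (('o, 'm, 'c, 'p, 'n, 'e) func2, 'o, 'n) ntrans \<Rightarrow> bool" where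
  "is_nat_trans2 A B \<theta> \<longleftrightarrow> is_nat_trans A B \<theta> \<and>
     is_functor2 A B (NDom \<theta>) \<and> is_functor2 A B (NCod \<theta>) \<and>
     (\<forall>X Y. \<forall>f \<in> Hom A X Y. \<forall>g. \<forall>\<alpha> \<in> Cells A f g.
        HCmp B (VIde B (NCmp \<theta> Y)) (FCell (NDom \<theta>) \<alpha>) =
        HCmp B (FCell (NCod \<theta>) \<alpha>) (VIde B (NCmp \<theta> X)))"

definition functor_cat2 :: "('o, 'm, 'c, 'y) cat2_scheme \<Rightarrow> ('p, 'n, 'e, 'z) cat2_scheme \<Rightarrow>
    (('o, 'm, 'c, 'p, 'n, 'e) func2, (('o, 'm, 'c, 'p, 'n, 'e) func2, 'o, 'n) ntrans) cat" where
  "functor_cat2 A B = \<lparr>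
     Obj = {F. is_functor2 A B F},
     Arr = {\<theta>. is_nat_trans2 A B \<theta>},
     Dom = NDom,
     Cod = NCod,
     Ide = (\<lambda>F. \<lparr>NDom = F, NCod = F, NCmp = (\<lambda>X\<in>Obj A. Ide B (FOb F X))\<rparr>),
     Cmp = (\<lambda>\<eta> \<theta>. \<lparr>NDom = NDom \<theta>, NCod = NCod \<eta>,
              NCmp = (\<lambda>X\<in>Obj A. NCmp \<eta> X \<cdot>\<^bsub>B\<^esub> NCmp \<theta> X)\<rparr>)\<rparr>"

definition precomp2 :: "('o, 'm, 'c, 'x) cat2_scheme \<Rightarrow> ('p, 'n, 'e, 'y) cat2_scheme \<Rightarrow>
    ('o, 'm, 'c, 'p, 'n, 'e) func2 \<Rightarrow> ('q, 'k, 'l, 'z) cat2_scheme \<Rightarrow>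
    (('p, 'n, 'e, 'q, 'k, 'l) func2, (('p, 'n, 'e, 'q, 'k, 'l) func2, 'p, 'k) ntrans,
     ('o, 'm, 'c, 'q, 'k, 'l) func2, (('o, 'm, 'c, 'q, 'k, 'l) func2, 'o, 'k) ntrans) func" where
  "precomp2 A B P D = \<lparr>
     FOb = (\<lambda>G\<in>Obj (functor_cat2 B D). comp_func2 A G P),
     FAr = (\<lambda>\<theta>\<in>Arr (functor_cat2 B D).
              \<lparr>NDom = comp_func2 A (NDom \<theta>) P, NCod = comp_func2 A (NCod \<theta>) P,
               NCmp = (\<lambda>a\<in>Obj A. NCmp \<theta> (FOb P a))\<rparr>)\<rparr>"

text \<open>The canonical isomorphism from the category of functors between two categories to the
  category of 2-functors between the associated 2-categories.\<close>

definition disc_hom :: "('o, 'm, 'y) cat_scheme \<Rightarrow> ('q, 'k, 'z) cat_scheme \<Rightarrow>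
    (('o, 'm, 'q, 'k) func, (('o, 'm, 'q, 'k) func, 'o, 'k) ntrans,
     ('o, 'm, 'm, 'q, 'k, 'k) func2, (('o, 'm, 'm, 'q, 'k, 'k) func2, 'o, 'k) ntrans) func" where
  "disc_hom A X = \<lparr>
     FOb = (\<lambda>F\<in>Obj (functor_cat A X). disc_func F),
     FAr = (\<lambda>\<theta>\<in>Arr (functor_cat A X).
              \<lparr>NDom = disc_func (NDom \<theta>), NCod = disc_func (NCod \<theta>), NCmp = NCmp \<theta>\<rparr>)\<rparr>"

definition component :: "('o, 'm, 'z) cat_scheme \<Rightarrow> 'o \<Rightarrow> 'o set" where
  "component C X = {Y. (X, Y) \<in> (\<Union>f\<in>Arr C. {(Dom C f, Cod C f), (Cod C f, Dom C f)})\<^sup>*}"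

definition arr_component :: "('o, 'm, 'c, 'z) cat2_scheme \<Rightarrow> 'm \<Rightarrow> 'm set" where
  "arr_component B f = component (hom_cat B (Dom B f) (Cod B f)) f"

definition pi0 :: "('o, 'm, 'c, 'z) cat2_scheme \<Rightarrow> ('o, 'm set) cat" where
  "pi0 B = \<lparr>
     Obj = Obj B,
     Arr = arr_component B ` Arr B,
     Dom = (\<lambda>K. the_elem (Dom B ` K)),
     Cod = (\<lambda>K. the_elem (Cod B ` K)),
     Ide = (\<lambda>X. arr_component B (Ide B X)),
     Cmp = (\<lambda>L K. \<Union>g\<in>L. \<Union>f\<in>K. arr_component B (g \<cdot>\<^bsub>B\<^esub> f))\<rparr>"

definition pi0_func :: "('o, 'm, 'c, 'z) cat2_scheme \<Rightarrow> ('o, 'm, 'c, 'o, 'm set, 'm set) func2" where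
  "pi0_func B = \<lparr>
     FOb = (\<lambda>X\<in>Obj B. X),
     FAr = (\<lambda>f\<in>Arr B. arr_component B f),
     FCell = (\<lambda>\<alpha>\<in>Cell B. arr_component B (Src B \<alpha>))\<rparr>"


section \<open>The homotopy 2-category of a category with a class of arrows\<close>

text \<open>The cylinder \<open>(W, Z, d\<^sub>0, d\<^sub>1, s, x)\<close>.\<close>

record ('o, 'm) cyl =
  cylW :: 'o
  cylZ :: 'o
  cyl_d0 :: 'm
  cyl_d1 :: 'm
  cyl_s :: 'm
  cyl_x :: 'm

type_synonym ('o, 'm) homotopy = "('o, 'm) cyl \<times> 'm"

definition is_cylinder :: "('o, 'm, 'z) cat_scheme \<Rightarrow> 'm set \<Rightarrow> 'o \<Rightarrow> ('o, 'm) cyl \<Rightarrow> bool" where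
  "is_cylinder A \<Sigma> X K \<longleftrightarrow>
     cyl_d0 K \<in> Hom A X (cylW K) \<and> cyl_d1 K \<in> Hom A X (cylW K) \<and>
     cyl_s K \<in> Hom A (cylW K) (cylZ K) \<and> cyl_x K \<in> Hom A X (cylZ K) \<and>
     cyl_s K \<in> \<Sigma> \<and>
     cyl_s K \<cdot>\<^bsub>A\<^esub> cyl_d0 K = cyl_x K \<and> cyl_s K \<cdot>\<^bsub>A\<^esub> cyl_d1 K = cyl_x K"

definition is_homotopy :: "('o, 'm, 'z) cat_scheme \<Rightarrow> 'm set \<Rightarrow> 'm \<Rightarrow> 'm \<Rightarrow> ('o, 'm) homotopy \<Rightarrow> bool" where
  "is_homotopy A \<Sigma> f g H \<longleftrightarrow> (\<exists>X Y. f \<in> Hom A X Y \<and> g \<in> Hom A X Y \<and>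
     is_cylinder A \<Sigma> X (fst H) \<and> snd H \<in> Hom A (cylW (fst H)) Y \<and>
     snd H \<cdot>\<^bsub>A\<^esub> cyl_d0 (fst H) = f \<and> snd H \<cdot>\<^bsub>A\<^esub> cyl_d1 (fst H) = g)"

text \<open>A sequence \<open>(H\<^sub>n, \<dots>, H\<^sub>1)\<close> is the list with head \<open>H\<^sub>n\<close>. The empty sequence is admitted; it is
  equivalent to the constant homotopy on the trivial cylinder of an identity.\<close>

primrec is_homotopy_seq ::
  "('o, 'm, 'z) cat_scheme \<Rightarrow> 'm set \<Rightarrow> 'm \<Rightarrow> 'm \<Rightarrow> ('o, 'm) homotopy list \<Rightarrow> bool" where
  "is_homotopy_seq A \<Sigma> f g [] \<longleftrightarrow> f \<in> Arr A \<and> f = g"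
| "is_homotopy_seq A \<Sigma> f g (H # Hs) \<longleftrightarrow>
     (\<exists>k. is_homotopy_seq A \<Sigma> f k Hs \<and> is_homotopy A \<Sigma> k g H)"

definition hat_cyl :: "('d0, 'd1, 'd2) cat2 \<Rightarrow> ('o, 'm, 'm, 'd0, 'd1, 'd2) func2 \<Rightarrow>
    ('o, 'm) cyl \<Rightarrow> 'd2" where
  "hat_cyl D F K = (THE \<alpha>. \<alpha> \<in> Cells D (FAr F (cyl_d0 K)) (FAr F (cyl_d1 K)) \<and>
     HCmp D (VIde D (FAr F (cyl_s K))) \<alpha> = VIde D (FAr F (cyl_x K)))"

definition hat_homotopy :: "('d0, 'd1, 'd2) cat2 \<Rightarrow> ('o, 'm, 'm, 'd0, 'd1, 'd2) func2 \<Rightarrow>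
    ('o, 'm) homotopy \<Rightarrow> 'd2" where
  "hat_homotopy D F H = HCmp D (VIde D (FAr F (snd H))) (hat_cyl D F (fst H))"

primrec hat_seq :: "('d0, 'd1, 'd2) cat2 \<Rightarrow> ('o, 'm, 'm, 'd0, 'd1, 'd2) func2 \<Rightarrow>
    'm \<Rightarrow> ('o, 'm) homotopy list \<Rightarrow> 'd2" where
  "hat_seq D F f [] = VIde D (FAr F f)"
| "hat_seq D F f (H # Hs) = VCmp D (hat_homotopy D F H) (hat_seq D F f Hs)"

text \<open>A definition in HOL cannot quantify over all types, so the universe in which the test
  2-categories \<open>D\<close> live (types of objects, arrows and 2-cells) is an explicit type parameter \<open>U\<close>.
  For a given \<open>A\<close> all choices of sufficiently large types give the same relation: restricting
  \<open>D\<close> to the part generated by the image of \<open>F\<close> together with chosen quasi-inverses (and the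
  2-cells belonging to them) of the images of the arrows in \<open>\<Sigma>\<close> changes no composite of the
  2-cells \<open>hat_homotopy D F H\<close>, and bounds the cardinality of \<open>D\<close> in terms of that of \<open>A\<close>.
  Leaving \<open>U\<close> universally quantified in a theorem covers every universe.\<close>

definition homotopy_seq_equiv :: "('d0 \<times> 'd1 \<times> 'd2) itself \<Rightarrow> ('o, 'm, 'z) cat_scheme \<Rightarrow>
    'm set \<Rightarrow> 'm \<Rightarrow> 'm \<Rightarrow> ('o, 'm) homotopy list \<Rightarrow> ('o, 'm) homotopy list \<Rightarrow> bool" where
  "homotopy_seq_equiv U A \<Sigma> f g Hs Ks \<longleftrightarrow>
     is_homotopy_seq A \<Sigma> f g Hs \<and> is_homotopy_seq A \<Sigma> f g Ks \<and>
     (\<forall>(D :: ('d0, 'd1, 'd2) cat2) F.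
        is_functor2 (disc A) D F \<and> (\<forall>s \<in> \<Sigma>. is_equivalence D (FAr F s)) \<longrightarrow>
        hat_seq D F f Hs = hat_seq D F f Ks)"

definition homotopy_class :: "('d0 \<times> 'd1 \<times> 'd2) itself \<Rightarrow> ('o, 'm, 'z) cat_scheme \<Rightarrow>
    'm set \<Rightarrow> 'm \<Rightarrow> 'm \<Rightarrow> ('o, 'm) homotopy list \<Rightarrow> ('o, 'm) homotopy list set" where
  "homotopy_class U A \<Sigma> f g Hs = {Ks. homotopy_seq_equiv U A \<Sigma> f g Hs Ks}"

text \<open>Whiskering: \<open>r(C, h) = (C, rh)\<close> and \<open>(C, h)l = (Cl, h)\<close>.\<close>

definition whisker_left :: "('o, 'm, 'z) cat_scheme \<Rightarrow> 'm \<Rightarrow> ('o, 'm) homotopy \<Rightarrow> ('o, 'm) homotopy" where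
  "whisker_left A r H = (fst H, r \<cdot>\<^bsub>A\<^esub> snd H)"

definition whisker_right :: "('o, 'm, 'z) cat_scheme \<Rightarrow> ('o, 'm) homotopy \<Rightarrow> 'm \<Rightarrow> ('o, 'm) homotopy" where
  "whisker_right A H l =
     (\<lparr>cylW = cylW (fst H), cylZ = cylZ (fst H),
       cyl_d0 = cyl_d0 (fst H) \<cdot>\<^bsub>A\<^esub> l, cyl_d1 = cyl_d1 (fst H) \<cdot>\<^bsub>A\<^esub> l,
       cyl_s = cyl_s (fst H), cyl_x = cyl_x (fst H) \<cdot>\<^bsub>A\<^esub> l\<rparr>, snd H)"

text \<open>A 2-cell carries its source and target arrow along with the equivalence class. The
  horizontal composite of \<open>\<alpha> : f \<Rightarrow> g\<close> and \<open>\<beta> : h \<Rightarrow> k\<close> is \<open>\<beta>g \<circ> h\<alpha>\<close>. The unions below are over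
  all representatives of the two classes.\<close>

type_synonym ('o, 'm) homotopy_cell = "'m \<times> 'm \<times> ('o, 'm) homotopy list set"

definition Ho :: "('d0 \<times> 'd1 \<times> 'd2) itself \<Rightarrow> ('o, 'm, 'z) cat_scheme \<Rightarrow> 'm set \<Rightarrow>
    ('o, 'm, ('o, 'm) homotopy_cell) cat2" where
  "Ho U A \<Sigma> = \<lparr>
     Obj = Obj A, Arr = Arr A, Dom = Dom A, Cod = Cod A, Ide = Ide A, Cmp = Cmp A,
     Cell = {(f, g, homotopy_class U A \<Sigma> f g Hs) | f g Hs. is_homotopy_seq A \<Sigma> f g Hs},
     Src = (\<lambda>(f, g, S). f),
     Tgt = (\<lambda>(f, g, S). g),
     VIde = (\<lambda>f. (f, f, homotopy_class U A \<Sigma> f f [])),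
     VCmp = (\<lambda>(g', k, T) (f, g, S).
       (f, k, \<Union>Ks\<in>T. \<Union>Hs\<in>S. homotopy_class U A \<Sigma> f k (Ks @ Hs))),
     HCmp = (\<lambda>(h, k, T) (f, g, S).
       (h \<cdot>\<^bsub>A\<^esub> f, k \<cdot>\<^bsub>A\<^esub> g,
        \<Union>Ks\<in>T. \<Union>Hs\<in>S. homotopy_class U A \<Sigma> (h \<cdot>\<^bsub>A\<^esub> f) (k \<cdot>\<^bsub>A\<^esub> g)
          (map (\<lambda>K. whisker_right A K g) Ks @ map (whisker_left A h) Hs)))\<rparr>"

definition Ho_incl :: "('d0 \<times> 'd1 \<times> 'd2) itself \<Rightarrow> ('o, 'm, 'z) cat_scheme \<Rightarrow> 'm set \<Rightarrow>
    ('o, 'm, 'm, 'o, 'm, ('o, 'm) homotopy_cell) func2" where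
  "Ho_incl U A \<Sigma> = \<lparr>FOb = (\<lambda>X\<in>Obj A. X), FAr = (\<lambda>f\<in>Arr A. f),
     FCell = (\<lambda>f\<in>Arr A. VIde (Ho U A \<Sigma>) f)\<rparr>"


section \<open>Model categories with normal functorial factorizations\<close>

definition is_retract :: "('o, 'm, 'z) cat_scheme \<Rightarrow> 'm \<Rightarrow> 'm \<Rightarrow> bool" where
  "is_retract C f g \<longleftrightarrow> f \<in> Arr C \<and> g \<in> Arr C \<and>
     (\<exists>i \<in> Hom C (Dom C f) (Dom C g). \<exists>r \<in> Hom C (Dom C g) (Dom C f).
      \<exists>j \<in> Hom C (Cod C f) (Cod C g). \<exists>s \<in> Hom C (Cod C g) (Cod C f).
        r \<cdot>\<^bsub>C\<^esub> i = Ide C (Dom C f) \<and> s \<cdot>\<^bsub>C\<^esub> j = Ide C (Cod C f) \<and>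
        g \<cdot>\<^bsub>C\<^esub> i = j \<cdot>\<^bsub>C\<^esub> f \<and> f \<cdot>\<^bsub>C\<^esub> r = s \<cdot>\<^bsub>C\<^esub> g)"

definition is_square :: "('o, 'm, 'z) cat_scheme \<Rightarrow> 'm \<Rightarrow> 'm \<Rightarrow> 'm \<Rightarrow> 'm \<Rightarrow> bool" where
  "is_square C f g u v \<longleftrightarrow> f \<in> Arr C \<and> g \<in> Arr C \<and>
     u \<in> Hom C (Dom C f) (Dom C g) \<and> v \<in> Hom C (Cod C f) (Cod C g) \<and>
     v \<cdot>\<^bsub>C\<^esub> f = g \<cdot>\<^bsub>C\<^esub> u"

definition has_lift :: "('o, 'm, 'z) cat_scheme \<Rightarrow> 'm \<Rightarrow> 'm \<Rightarrow> 'm \<Rightarrow> 'm \<Rightarrow> bool" where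
  "has_lift C i p u v \<longleftrightarrow>
     (\<exists>l \<in> Hom C (Cod C i) (Dom C p). l \<cdot>\<^bsub>C\<^esub> i = u \<and> p \<cdot>\<^bsub>C\<^esub> l = v)"

definition closed_under_comp :: "('o, 'm, 'z) cat_scheme \<Rightarrow> 'm set \<Rightarrow> bool" where
  "closed_under_comp C S \<longleftrightarrow>
     (\<forall>f \<in> S. \<forall>g \<in> S. Cod C f = Dom C g \<longrightarrow> g \<cdot>\<^bsub>C\<^esub> f \<in> S)"

definition closed_under_retracts :: "('o, 'm, 'z) cat_scheme \<Rightarrow> 'm set \<Rightarrow> bool" where
  "closed_under_retracts C S \<longleftrightarrow> (\<forall>f g. g \<in> S \<and> is_retract C f g \<longrightarrow> f \<in> S)"

locale model_category = category C
  for C :: "('o, 'm, 'z) cat_scheme" (structure)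
    and W Cof Fib :: "'m set" +
  assumes finite_limits: "has_finite_limits C"
    and finite_colimits: "has_finite_colimits C"
    and W_arr: "W \<subseteq> Arr C"
    and Cof_arr: "Cof \<subseteq> Arr C"
    and Fib_arr: "Fib \<subseteq> Arr C"
    and W_retracts: "closed_under_retracts C W"
    and Cof_retracts: "closed_under_retracts C Cof"
    and Fib_retracts: "closed_under_retracts C Fib"
    and W_comp: "closed_under_comp C W"
    and Cof_comp: "closed_under_comp C Cof"
    and Fib_comp: "closed_under_comp C Fib"
    and three_for_two_left:
      "f \<in> Hom C X Y \<Longrightarrow> g \<in> Hom C Y Z \<Longrightarrow> f \<in> W \<Longrightarrow> g \<cdot> f \<in> W \<Longrightarrow> g \<in> W"
    and three_for_two_right:
      "f \<in> Hom C X Y \<Longrightarrow> g \<in> Hom C Y Z \<Longrightarrow> g \<in> W \<Longrightarrow> g \<cdot> f \<in> W \<Longrightarrow> f \<in> W"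
    and lifting:
      "i \<in> Cof \<Longrightarrow> p \<in> Fib \<Longrightarrow> i \<in> W \<or> p \<in> W \<Longrightarrow> is_square C i p u v \<Longrightarrow> has_lift C i p u v"
    and factor_cof_tfib: "f \<in> Hom C X Y \<Longrightarrow>
      \<exists>E. \<exists>i \<in> Hom C X E. \<exists>p \<in> Hom C E Y. i \<in> Cof \<and> p \<in> Fib \<inter> W \<and> f = p \<cdot> i"
    and factor_tcof_fib: "f \<in> Hom C X Y \<Longrightarrow>
      \<exists>E. \<exists>i \<in> Hom C X E. \<exists>p \<in> Hom C E Y. i \<in> Cof \<inter> W \<and> p \<in> Fib \<and> f = p \<cdot> i"

text \<open>A functorial factorization \<open>f = \<rho>\<^sub>f \<lambda>\<^sub>f\<close>. The middle object is the codomain of \<open>\<lambda>\<^sub>f\<close>, and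
  \<open>fac_map \<phi> f g u v\<close> is the map \<open>F(u, v)\<close> induced by the square \<open>(u, v) : f \<rightarrow> g\<close>.\<close>

record 'm factn =
  fac_lam :: "'m \<Rightarrow> 'm"
  fac_rho :: "'m \<Rightarrow> 'm"
  fac_map :: "'m \<Rightarrow> 'm \<Rightarrow> 'm \<Rightarrow> 'm \<Rightarrow> 'm"

definition fac_mid :: "('o, 'm, 'z) cat_scheme \<Rightarrow> 'm factn \<Rightarrow> 'm \<Rightarrow> 'o" where
  "fac_mid C \<phi> f = Cod C (fac_lam \<phi> f)"

locale functorial_factorization = category C
  for C :: "('o, 'm, 'z) cat_scheme" (structure)
    and L R :: "'m set" and \<phi> :: "'m factn" +
  assumes lam_hom: "f \<in> Arr C \<Longrightarrow> fac_lam \<phi> f \<in> Hom C (Dom C f) (fac_mid C \<phi> f)"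
    and rho_hom: "f \<in> Arr C \<Longrightarrow> fac_rho \<phi> f \<in> Hom C (fac_mid C \<phi> f) (Cod C f)"
    and lam_class: "f \<in> Arr C \<Longrightarrow> fac_lam \<phi> f \<in> L"
    and rho_class: "f \<in> Arr C \<Longrightarrow> fac_rho \<phi> f \<in> R"
    and factorizes: "f \<in> Arr C \<Longrightarrow> f = fac_rho \<phi> f \<cdot> fac_lam \<phi> f"
    and map_hom: "is_square C f g u v \<Longrightarrow>
      fac_map \<phi> f g u v \<in> Hom C (fac_mid C \<phi> f) (fac_mid C \<phi> g)"
    and map_lam: "is_square C f g u v \<Longrightarrow>
      fac_map \<phi> f g u v \<cdot> fac_lam \<phi> f = fac_lam \<phi> g \<cdot> u"
    and map_rho: "is_square C f g u v \<Longrightarrow>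
      fac_rho \<phi> g \<cdot> fac_map \<phi> f g u v = v \<cdot> fac_rho \<phi> f"
    and map_ide: "f \<in> Arr C \<Longrightarrow>
      fac_map \<phi> f f (Ide C (Dom C f)) (Ide C (Cod C f)) = Ide C (fac_mid C \<phi> f)"
    and map_cmp: "is_square C f g u v \<Longrightarrow> is_square C g h u' v' \<Longrightarrow>
      fac_map \<phi> f h (u' \<cdot> u) (v' \<cdot> v) = fac_map \<phi> g h u' v' \<cdot> fac_map \<phi> f g u v"

record ('o, 'm) model = "('o, 'm) cat" +
  Weq :: "'m set"
  Cofb :: "'m set"
  Fibr :: "'m set"
  ini :: 'o
  ter :: 'o
  fac_ct :: "'m factn"  \<comment> \<open>cofibration, trivial fibration\<close>
  fac_tf :: "'m factn"  \<comment> \<open>trivial cofibration, fibration\<close>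

definition from_ini :: "('o, 'm) model \<Rightarrow> 'o \<Rightarrow> 'm" where
  "from_ini M X = (THE f. f \<in> Hom M (ini M) X)"

definition to_ter :: "('o, 'm) model \<Rightarrow> 'o \<Rightarrow> 'm" where
  "to_ter M X = (THE f. f \<in> Hom M X (ter M))"

definition cofibrant :: "('o, 'm) model \<Rightarrow> 'o \<Rightarrow> bool" where
  "cofibrant M X \<longleftrightarrow> X \<in> Obj M \<and> from_ini M X \<in> Cofb M"

definition fibrant :: "('o, 'm) model \<Rightarrow> 'o \<Rightarrow> bool" where
  "fibrant M X \<longleftrightarrow> X \<in> Obj M \<and> to_ter M X \<in> Fibr M"

definition Q_ob :: "('o, 'm) model \<Rightarrow> 'o \<Rightarrow> 'o" where
  "Q_ob M X = fac_mid M (fac_ct M) (from_ini M X)"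

definition Q_ar :: "('o, 'm) model \<Rightarrow> 'm \<Rightarrow> 'm" where
  "Q_ar M f = fac_map (fac_ct M) (from_ini M (Dom M f)) (from_ini M (Cod M f)) (Ide M (ini M)) f"

definition p_ar :: "('o, 'm) model \<Rightarrow> 'o \<Rightarrow> 'm" where
  "p_ar M X = fac_rho (fac_ct M) (from_ini M X)"

definition R_ob :: "('o, 'm) model \<Rightarrow> 'o \<Rightarrow> 'o" where
  "R_ob M X = fac_mid M (fac_tf M) (to_ter M X)"

definition R_ar :: "('o, 'm) model \<Rightarrow> 'm \<Rightarrow> 'm" where
  "R_ar M f = fac_map (fac_tf M) (to_ter M (Dom M f)) (to_ter M (Cod M f)) f (Ide M (ter M))"

definition v_ar :: "('o, 'm) model \<Rightarrow> 'o \<Rightarrow> 'm" where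
  "v_ar M X = fac_lam (fac_tf M) (to_ter M X)"

locale normal_model_category =
  fixes M :: "('o, 'm) model"
  assumes model: "model_category M (Weq M) (Cofb M) (Fibr M)"
    and initial: "is_initial M (ini M)"
    and terminal: "is_terminal M (ter M)"
    and fact_ct: "functorial_factorization M (Cofb M) (Fibr M \<inter> Weq M) (fac_ct M)"
    and fact_tf: "functorial_factorization M (Cofb M \<inter> Weq M) (Fibr M) (fac_tf M)"
    and normal_Q: "cofibrant M X \<Longrightarrow> Q_ob M X = X \<and> p_ar M X = Ide M X"
    and normal_R: "fibrant M X \<Longrightarrow> R_ob M X = X \<and> v_ar M X = Ide M X"

definition fc_cat :: "('o, 'm) model \<Rightarrow> ('o, 'm) cat" where
  "fc_cat M = full_subcat M {X. fibrant M X \<and> cofibrant M X}"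

text \<open>The corestriction of \<open>RQ\<close>; as data it coincides with \<open>RQ\<close> itself.\<close>

definition r_func :: "('o, 'm) model \<Rightarrow> ('o, 'm, 'o, 'm) func" where
  "r_func M = \<lparr>FOb = (\<lambda>X\<in>Obj M. R_ob M (Q_ob M X)), FAr = (\<lambda>f\<in>Arr M. R_ar M (Q_ar M f))\<rparr>"

definition Ho_fc :: "('d0 \<times> 'd1 \<times> 'd2) itself \<Rightarrow> ('o, 'm) model \<Rightarrow>
    ('o, 'm, ('o, 'm) homotopy_cell) cat2" where
  "Ho_fc U M = Ho U (fc_cat M) (Weq M \<inter> Arr (fc_cat M))"

definition q_func :: "('d0 \<times> 'd1 \<times> 'd2) itself \<Rightarrow> ('o, 'm) model \<Rightarrow>
    ('o, 'm, 'm, 'o, 'm, ('o, 'm) homotopy_cell) func2" where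
  "q_func U M = comp_func2 (disc M) (Ho_incl U (fc_cat M) (Weq M \<inter> Arr (fc_cat M)))
     (disc_func (r_func M))"

definition pi0_q :: "('d0 \<times> 'd1 \<times> 'd2) itself \<Rightarrow> ('o, 'm) model \<Rightarrow> ('o, 'm, 'o, 'm set) func" where
  "pi0_q U M = underlying_func (comp_func2 (disc M) (pi0_func (Ho_fc U M)) (q_func U M))"

end

theory Submission
  imports Defs
begin

text \<open>A homotopy between arrows of \<open>C\<^sub>f\<^sub>c\<close> only asks for \<open>s d\<^sub>0 = s d\<^sub>1\<close> with \<open>s\<close> a weak equivalence.
  Hence a functor inverting weak equivalences identifies the ends of every homotopy, and conversely
  arrows equalized by a weak equivalence \<open>s\<close> are homotopic through the cylinder with \<open>W = Y\<close> and
  \<open>h = id\<close>.  The lifting axiom gives a section of a trivial fibration, respectively a retraction of a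
  trivial cofibration, in \<open>C\<^sub>f\<^sub>c\<close>, and the other composite is homotopic to the identity by this
  remark; so all weak equivalences of \<open>C\<^sub>f\<^sub>c\<close> become invertible up to homotopy.  Restricting a
  functor \<open>H\<close> that inverts \<open>W\<close> to \<open>C\<^sub>f\<^sub>c\<close> and passing to components inverts the precomposition:
  one composite is the identity because \<open>RQ\<close> is the identity on \<open>C\<^sub>f\<^sub>c\<close>, and the other is
  \<open>H \<mapsto> H R Q\<close>, which is isomorphic to the identity through \<open>H R Q \<Leftarrow> H Q \<Rightarrow> H\<close>.

  The 2-category laws of the homotopy 2-category hold because its 2-cells are determined by their
  images in the test 2-categories, where the same laws hold.\<close>

section \<open>Categories and functor categories\<close>

text \<open>Components of \<open>Ho\<close> record only whether a 2-cell exists, and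
  \<open>Cells_Ho\<close> reduces this to the existence of a sequence of homotopies. The
  localization is therefore proved without deciding when two sequences are equivalent. That relation
  enters in making \<open>Ho\<close> a 2-category, whose whiskering makes composition of components
  well defined. No cylinder or path objects of the model category are constructed: the legs of a
  cylinder may be any two parallel arrows, so the criterion \<open>s f = s g\<close> with
  \<open>s\<close> a weak equivalence does the work of left and right homotopies. The criterion is
  one-sided, since \<open>s\<close> has to follow \<open>f\<close> and \<open>g\<close>; sections
  and retractions therefore need different arguments. Normality makes the composite on functors out
  of \<open>pi0\<close> the identity on the nose. On functors out of the model category
  \<open>RQ\<close> remains, connected to the identity by a span out of \<open>Q\<close> whose legs
  become isomorphisms only after applying an \<open>H\<close> that inverts weak
  equivalences.\<close>

lemma Hom_iff: "f \<in> Hom C X Y \<longleftrightarrow> f \<in> Arr C \<and> Dom C f = X \<and> Cod C f = Y"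
  by (auto simp: Hom_def)

lemma (in category) hom_obj: "f \<in> Hom C X Y \<Longrightarrow> X \<in> Obj C" "f \<in> Hom C X Y \<Longrightarrow> Y \<in> Obj C"
  using dom_obj cod_obj by (auto simp: Hom_iff)

lemma (in category) arr_hom: "f \<in> Arr C \<Longrightarrow> f \<in> Hom C (Dom C f) (Cod C f)"
  by (simp add: Hom_iff)

lemma is_isoI:
  assumes "f \<in> Hom C X Y" "g \<in> Hom C Y X" "g \<cdot>\<^bsub>C\<^esub> f = Ide C X" "f \<cdot>\<^bsub>C\<^esub> g = Ide C Y"
  shows "is_iso C f"
  using assms by (auto simp: is_iso_def Hom_iff)

lemma is_isoE:
  assumes "is_iso C f" "f \<in> Hom C X Y"
  obtains g where "g \<in> Hom C Y X" "g \<cdot>\<^bsub>C\<^esub> f = Ide C X" "f \<cdot>\<^bsub>C\<^esub> g = Ide C Y"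
  using assms by (auto simp: is_iso_def Hom_iff)

lemma (in category) iso_ide: "X \<in> Obj C \<Longrightarrow> is_iso C (Ide C X)"
  using ide_hom ide_left by (blast intro: is_isoI)

lemma (in category) iso_comp:
  assumes f: "f \<in> Hom C X Y" and g: "g \<in> Hom C Y Z" and "is_iso C f" "is_iso C g"
  shows "is_iso C (g \<cdot> f)"
proof -
  obtain f' where f': "f' \<in> Hom C Y X" "f' \<cdot> f = Ide C X" "f \<cdot> f' = Ide C Y"
    using assms by (blast elim: is_isoE)
  obtain g' where g': "g' \<in> Hom C Z Y" "g' \<cdot> g = Ide C Y" "g \<cdot> g' = Ide C Z"
    using assms by (blast elim: is_isoE)
  note gf = cmp_hom[OF f g] and f'g' = cmp_hom[OF g'(1) f'(1)]
  have "(f' \<cdot> g') \<cdot> (g \<cdot> f) = f' \<cdot> ((g' \<cdot> g) \<cdot> f)"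
    by (simp only: cmp_assoc[OF gf g'(1) f'(1), symmetric] cmp_assoc[OF f g g'(1)])
  also have "\<dots> = Ide C X"
    using f' g' f ide_left by simp
  finally have 1: "(f' \<cdot> g') \<cdot> (g \<cdot> f) = Ide C X" .
  have "(g \<cdot> f) \<cdot> (f' \<cdot> g') = g \<cdot> ((f \<cdot> f') \<cdot> g')"
    by (simp only: cmp_assoc[OF f'g' f g, symmetric] cmp_assoc[OF g'(1) f'(1) f])
  also have "\<dots> = Ide C Z"
    using f' g' ide_left[OF g'(1)] by simp
  finally show ?thesis
    by (rule is_isoI[OF gf f'g' 1])
qed

text \<open>Isomorphisms are monic. In \<open>functor_homotopy_eq\<close> this turns
  \<open>H s . H d0 = H s . H d1\<close> into \<open>H d0 = H d1\<close>.\<close>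

lemma (in category) iso_cancel:
  assumes "is_iso C s" "s \<in> Hom C Y Z" "f \<in> Hom C X Y" "g \<in> Hom C X Y" "s \<cdot> f = s \<cdot> g"
  shows "f = g"
proof -
  obtain t where t: "t \<in> Hom C Z Y" "t \<cdot> s = Ide C Y"
    using assms by (blast elim: is_isoE)
  have "h = t \<cdot> (s \<cdot> h)" if "h \<in> Hom C X Y" for h
    using cmp_assoc[OF that assms(2) t(1)] t(2) ide_left[OF that] by simp
  then show ?thesis
    using assms by metis
qed

lemma (in category) isomorphic_refl: "X \<in> Obj C \<Longrightarrow> isomorphic C X X"
  unfolding isomorphic_def using iso_ide ide_hom by blast

lemma isomorphic_sym: "isomorphic C X Y \<Longrightarrow> isomorphic C Y X"
  unfolding isomorphic_def by (blast elim: is_isoE intro: is_isoI)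

lemma (in category) isomorphic_trans:
  "isomorphic C X Y \<Longrightarrow> isomorphic C Y Z \<Longrightarrow> isomorphic C X Z"
  unfolding isomorphic_def using iso_comp cmp_hom by blast

section \<open>Full subcategories and functors between categories\<close>

lemma Hom_full_subcat:
  "f \<in> Hom (full_subcat C S) X Y \<longleftrightarrow> f \<in> Hom C X Y \<and> X \<in> S \<and> Y \<in> S"
  by (auto simp: Hom_iff full_subcat_def)

lemma full_subcat_simps [simp]:
  "Obj (full_subcat C S) = Obj C \<inter> S" "Dom (full_subcat C S) = Dom C"
  "Cod (full_subcat C S) = Cod C" "Ide (full_subcat C S) = Ide C" "Cmp (full_subcat C S) = Cmp C"
  by (auto simp: full_subcat_def)

lemma Arr_full_subcat: "f \<in> Arr (full_subcat C S) \<longleftrightarrow> f \<in> Arr C \<and> Dom C f \<in> S \<and> Cod C f \<in> S"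
  by (auto simp: full_subcat_def)

lemma category_full_subcat:
  assumes "category C"
  shows "category (full_subcat C S)"
proof -
  interpret category C by fact
  show ?thesis
    by (rule category.intro)
      (auto simp: Hom_full_subcat Arr_full_subcat
        intro: dom_obj cod_obj ide_hom cmp_hom ide_left ide_right cmp_assoc)
qed

lemma is_iso_full_subcat:
  assumes "is_iso C f" "f \<in> Hom (full_subcat C S) X Y"
  shows "is_iso (full_subcat C S) f"
proof -
  have f: "f \<in> Hom C X Y" "X \<in> S" "Y \<in> S"
    using assms by (auto simp: Hom_full_subcat)
  obtain g where "g \<in> Hom C Y X" "g \<cdot>\<^bsub>C\<^esub> f = Ide C X" "f \<cdot>\<^bsub>C\<^esub> g = Ide C Y"
    using assms f by (blast elim: is_isoE)
  then show ?thesis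
    using f by (intro is_isoI[where g = g and X = X and Y = Y]) (auto simp: Hom_full_subcat)
qed

lemma (in is_functor) ar_arr: "f \<in> Arr A \<Longrightarrow> FAr F f \<in> Hom B (FOb F (Dom A f)) (FOb F (Cod A f))"
  by (rule ar_hom) (simp add: Hom_iff)

lemma (in is_functor) preserves_iso:
  assumes "is_iso A f"
  shows "is_iso B (FAr F f)"
proof -
  interpret A: category A by (fact dom_category)
  have f: "f \<in> Hom A (Dom A f) (Cod A f)"
    using assms by (simp add: Hom_iff is_iso_def)
  then obtain g where g: "g \<in> Hom A (Cod A f) (Dom A f)" "g \<cdot>\<^bsub>A\<^esub> f = Ide A (Dom A f)"
      "f \<cdot>\<^bsub>A\<^esub> g = Ide A (Cod A f)"
    using assms by (blast elim: is_isoE)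
  show ?thesis
    using ar_hom[OF f] ar_hom[OF g(1)] ar_cmp[OF f g(1)] ar_cmp[OF g(1) f] g A.hom_obj[OF f]
    by (intro is_isoI[of _ _ _ _ "FAr F g"]) (auto simp: ar_ide)
qed

text \<open>A functor record does not store its codomain, so composing with the inclusion of a full
  subcategory leaves the record as it is. Applied to \<open>id_func\<close> of the subcategory this
  yields the inclusion functor.\<close>

lemma functor_full_subcat_cod:
  assumes "is_functor A (full_subcat C S) F" "category C"
  shows "is_functor A C F"
proof -
  interpret is_functor A "full_subcat C S" F by fact
  show ?thesis
  proof (rule is_functor.intro)
    show "FAr F f \<in> Hom C (FOb F X) (FOb F Y)" if "f \<in> Hom A X Y" for f X Y
      using ar_hom[OF that] by (simp add: Hom_full_subcat)
    show "FAr F (g \<cdot>\<^bsub>A\<^esub> f) = FAr F g \<cdot>\<^bsub>C\<^esub> FAr F f" if "f \<in> Hom A X Y" "g \<in> Hom A Y Z" for f g X Y Z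
      using ar_cmp[OF that] by simp
  qed (use dom_category assms(2) ob_ext ar_ext ob_obj ar_ide in auto)
qed

lemma comp_func_simps [simp]:
  "X \<in> Obj A \<Longrightarrow> FOb (comp_func A G F) X = FOb G (FOb F X)"
  "f \<in> Arr A \<Longrightarrow> FAr (comp_func A G F) f = FAr G (FAr F f)"
  by (auto simp: comp_func_def)

lemma id_func_simps [simp]:
  "X \<in> Obj A \<Longrightarrow> FOb (id_func A) X = X"
  "f \<in> Arr A \<Longrightarrow> FAr (id_func A) f = f"
  by (auto simp: id_func_def)

lemma comp_func_cong:
  assumes "\<And>X. X \<in> Obj A \<Longrightarrow> FOb G (FOb F X) = FOb G' (FOb F' X)"
    "\<And>f. f \<in> Arr A \<Longrightarrow> FAr G (FAr F f) = FAr G' (FAr F' f)"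
  shows "comp_func A G F = comp_func A G' F'"
  using assms by (simp add: comp_func_def cong: restrict_cong)

lemma is_functor_id:
  assumes "category A"
  shows "is_functor A A (id_func A)"
proof -
  interpret category A by fact
  show ?thesis
  proof (rule is_functor.intro)
    fix f X Y assume f: "f \<in> Hom A X Y"
    then show "FAr (id_func A) f \<in> Hom A (FOb (id_func A) X) (FOb (id_func A) Y)"
      using hom_obj[OF f] by (simp add: Hom_iff)
    fix g Z assume g: "g \<in> Hom A Y Z"
    show "FAr (id_func A) (g \<cdot>\<^bsub>A\<^esub> f) = FAr (id_func A) g \<cdot>\<^bsub>A\<^esub> FAr (id_func A) f"
      using f g cmp_hom[OF f g] by (simp add: Hom_iff)
  next
    fix X assume X: "X \<in> Obj A"
    then show "FAr (id_func A) (Ide A X) = Ide A (FOb (id_func A) X)"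
      using ide_hom[OF X] by (simp add: Hom_iff)
  qed (simp_all add: id_func_def \<open>category A\<close>)
qed

lemma is_functor_comp:
  assumes "is_functor A B F" "is_functor B C G"
  shows "is_functor A C (comp_func A G F)"
proof -
  interpret F: is_functor A B F by fact
  interpret G: is_functor B C G by fact
  interpret A: category A by (fact F.dom_category)
  show ?thesis
  proof (rule is_functor.intro)
    fix f X Y assume f: "f \<in> Hom A X Y"
    then show "FAr (comp_func A G F) f \<in> Hom C (FOb (comp_func A G F) X) (FOb (comp_func A G F) Y)"
      using A.hom_obj[OF f] G.ar_hom F.ar_hom by (simp add: Hom_iff)
    fix g Z assume g: "g \<in> Hom A Y Z"
    show "FAr (comp_func A G F) (g \<cdot>\<^bsub>A\<^esub> f) = FAr (comp_func A G F) g \<cdot>\<^bsub>C\<^esub> FAr (comp_func A G F) f"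
      using f g A.cmp_hom[OF f g] F.ar_cmp[OF f g] G.ar_cmp[OF F.ar_hom[OF f] F.ar_hom[OF g]]
      by (simp add: Hom_iff)
  next
    fix X assume X: "X \<in> Obj A"
    then show "FAr (comp_func A G F) (Ide A X) = Ide C (FOb (comp_func A G F) X)"
      using A.ide_hom[OF X] by (simp add: F.ar_ide G.ar_ide F.ob_obj Hom_iff)
  qed (auto simp: F.dom_category G.cod_category F.ob_obj G.ob_obj comp_func_def)
qed

text \<open>The restriction is a composite with the inclusion instead of \<open>F\<close> itself,
  because components must be \<open>undefined\<close> outside the source while those of
  \<open>F\<close> are specified on all of \<open>A\<close>.\<close>

lemma functor_full_subcat_dom:
  assumes "is_functor A B F"
  shows "is_functor (full_subcat A S) B (comp_func (full_subcat A S) F (id_func (full_subcat A S)))"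
proof -
  have A: "category A"
    using assms by (rule is_functor.dom_category)
  show ?thesis
    by (rule is_functor_comp[OF _ assms],
        rule functor_full_subcat_cod[OF is_functor_id[OF category_full_subcat[OF A]] A])
qed

lemma func_eqI:
  fixes F G :: "('o, 'm, 'p, 'n) func"
  assumes "is_functor A B F" "is_functor A B G"
    and "\<And>X. X \<in> Obj A \<Longrightarrow> FOb F X = FOb G X" "\<And>f. f \<in> Arr A \<Longrightarrow> FAr F f = FAr G f"
  shows "F = G"
proof -
  have "FOb F = FOb G" "FAr F = FAr G"
    using assms is_functor.ob_ext is_functor.ar_ext by (metis extensionalityI)+
  then show ?thesis
    by simp
qed

section \<open>Natural transformations and functor categories\<close>

lemma is_nat_transI:
  assumes "is_functor A B (NDom \<theta>)" "is_functor A B (NCod \<theta>)" "NCmp \<theta> \<in> extensional (Obj A)"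
    and "\<And>X. X \<in> Obj A \<Longrightarrow> NCmp \<theta> X \<in> Hom B (FOb (NDom \<theta>) X) (FOb (NCod \<theta>) X)"
    and "\<And>f X Y. f \<in> Hom A X Y \<Longrightarrow>
      NCmp \<theta> Y \<cdot>\<^bsub>B\<^esub> FAr (NDom \<theta>) f = FAr (NCod \<theta>) f \<cdot>\<^bsub>B\<^esub> NCmp \<theta> X"
  shows "is_nat_trans A B \<theta>"
  using assms by (auto simp: is_nat_trans_def)

lemma is_nat_transD:
  assumes "is_nat_trans A B \<theta>"
  shows "is_functor A B (NDom \<theta>)" "is_functor A B (NCod \<theta>)" "NCmp \<theta> \<in> extensional (Obj A)"
    and "X \<in> Obj A \<Longrightarrow> NCmp \<theta> X \<in> Hom B (FOb (NDom \<theta>) X) (FOb (NCod \<theta>) X)"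
    and "f \<in> Hom A X Y \<Longrightarrow>
      NCmp \<theta> Y \<cdot>\<^bsub>B\<^esub> FAr (NDom \<theta>) f = FAr (NCod \<theta>) f \<cdot>\<^bsub>B\<^esub> NCmp \<theta> X"
  using assms by (auto simp: is_nat_trans_def)

lemma ntrans_eqI:
  fixes \<theta> \<eta> :: "('f, 'o, 'n) ntrans"
  assumes "NDom \<theta> = NDom \<eta>" "NCod \<theta> = NCod \<eta>" "NCmp \<theta> \<in> extensional S" "NCmp \<eta> \<in> extensional S"
    and "\<And>X. X \<in> S \<Longrightarrow> NCmp \<theta> X = NCmp \<eta> X"
  shows "\<theta> = \<eta>"
  using assms extensionalityI[of "NCmp \<theta>" S "NCmp \<eta>"] by simp

lemma functor_cat_simps [simp]:
  "Obj (functor_cat A B) = {F. is_functor A B F}" "Arr (functor_cat A B) = {\<theta>. is_nat_trans A B \<theta>}"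
  "Dom (functor_cat A B) = NDom" "Cod (functor_cat A B) = NCod"
  by (auto simp: functor_cat_def)

lemma Hom_functor_cat:
  "\<theta> \<in> Hom (functor_cat A B) F G \<longleftrightarrow> is_nat_trans A B \<theta> \<and> NDom \<theta> = F \<and> NCod \<theta> = G"
  by (simp add: Hom_iff)

lemma functor_cat_ide_simps [simp]:
  "NDom (Ide (functor_cat A B) F) = F" "NCod (Ide (functor_cat A B) F) = F"
  "X \<in> Obj A \<Longrightarrow> NCmp (Ide (functor_cat A B) F) X = Ide B (FOb F X)"
  "NCmp (Ide (functor_cat A B) F) \<in> extensional (Obj A)"
  by (auto simp: functor_cat_def)

lemma functor_cat_cmp_simps [simp]:
  "NDom (\<eta> \<cdot>\<^bsub>functor_cat A B\<^esub> \<theta>) = NDom \<theta>" "NCod (\<eta> \<cdot>\<^bsub>functor_cat A B\<^esub> \<theta>) = NCod \<eta>"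
  "X \<in> Obj A \<Longrightarrow> NCmp (\<eta> \<cdot>\<^bsub>functor_cat A B\<^esub> \<theta>) X = NCmp \<eta> X \<cdot>\<^bsub>B\<^esub> NCmp \<theta> X"
  "NCmp (\<eta> \<cdot>\<^bsub>functor_cat A B\<^esub> \<theta>) \<in> extensional (Obj A)"
  by (auto simp: functor_cat_def)

lemma nat_trans_cmp:
  assumes "is_nat_trans A B \<theta>" "is_nat_trans A B \<eta>" "NCod \<theta> = NDom \<eta>"
  shows "is_nat_trans A B (\<eta> \<cdot>\<^bsub>functor_cat A B\<^esub> \<theta>)"
proof -
  note \<theta> = is_nat_transD[OF assms(1)] and \<eta> = is_nat_transD[OF assms(2)]
  interpret F: is_functor A B "NDom \<theta>" by fact
  interpret G: is_functor A B "NDom \<eta>" by fact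
  interpret H: is_functor A B "NCod \<eta>" by fact
  interpret A: category A by (fact F.dom_category)
  interpret B: category B by (fact F.cod_category)
  show ?thesis
  proof (rule is_nat_transI)
    show "NCmp (\<eta> \<cdot>\<^bsub>functor_cat A B\<^esub> \<theta>) X \<in> Hom B (FOb (NDom (\<eta> \<cdot>\<^bsub>functor_cat A B\<^esub> \<theta>)) X)
      (FOb (NCod (\<eta> \<cdot>\<^bsub>functor_cat A B\<^esub> \<theta>)) X)" if "X \<in> Obj A" for X
      using B.cmp_hom \<theta>(4)[OF that] \<eta>(4)[OF that] assms(3) that by simp
    fix f X Y assume f: "f \<in> Hom A X Y"
    note o = A.hom_obj[OF f]
    note t = \<theta>(4)[OF o(1), unfolded assms(3)] \<theta>(4)[OF o(2), unfolded assms(3)]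
    show "NCmp (\<eta> \<cdot>\<^bsub>functor_cat A B\<^esub> \<theta>) Y \<cdot>\<^bsub>B\<^esub> FAr (NDom (\<eta> \<cdot>\<^bsub>functor_cat A B\<^esub> \<theta>)) f =
        FAr (NCod (\<eta> \<cdot>\<^bsub>functor_cat A B\<^esub> \<theta>)) f \<cdot>\<^bsub>B\<^esub> NCmp (\<eta> \<cdot>\<^bsub>functor_cat A B\<^esub> \<theta>) X"
      using B.cmp_assoc[OF F.ar_hom[OF f] t(2) \<eta>(4)[OF o(2)]] \<theta>(5)[OF f] \<eta>(5)[OF f]
        B.cmp_assoc[OF t(1) G.ar_hom[OF f] \<eta>(4)[OF o(2)]]
        B.cmp_assoc[OF t(1) \<eta>(4)[OF o(1)] H.ar_hom[OF f]] assms(3) o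
      by simp
  qed (use \<theta> \<eta> in auto)
qed

lemma nat_trans_ide:
  assumes "is_functor A B F"
  shows "is_nat_trans A B (Ide (functor_cat A B) F)"
proof -
  interpret is_functor A B F by fact
  interpret A: category A by (fact dom_category)
  interpret B: category B by (fact cod_category)
  show ?thesis
  proof (rule is_nat_transI)
    fix f X Y assume f: "f \<in> Hom A X Y"
    show "NCmp (Ide (functor_cat A B) F) Y \<cdot>\<^bsub>B\<^esub> FAr (NDom (Ide (functor_cat A B) F)) f =
       FAr (NCod (Ide (functor_cat A B) F)) f \<cdot>\<^bsub>B\<^esub> NCmp (Ide (functor_cat A B) F) X"
      using A.hom_obj[OF f] B.ide_left[OF ar_hom[OF f]] B.ide_right[OF ar_hom[OF f]] by simp
  qed (use assms B.ide_hom ob_obj in auto)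
qed

lemma category_functor_cat: "category (functor_cat A B)"
proof (rule category.intro)
  fix \<theta> F G assume \<theta>: "\<theta> \<in> Hom (functor_cat A B) F G"
  then have t: "is_nat_trans A B \<theta>"
    by (simp add: Hom_functor_cat)
  then interpret F: is_functor A B "NDom \<theta>" by (rule is_nat_transD)
  interpret B: category B by (fact F.cod_category)
  show "Ide (functor_cat A B) G \<cdot>\<^bsub>functor_cat A B\<^esub> \<theta> = \<theta>"
    using \<theta> is_nat_transD(3)[OF t] B.ide_left[OF is_nat_transD(4)[OF t]]
    by (intro ntrans_eqI[of _ _ "Obj A"]) (auto simp: Hom_functor_cat)
  show "\<theta> \<cdot>\<^bsub>functor_cat A B\<^esub> Ide (functor_cat A B) F = \<theta>"
    using \<theta> is_nat_transD(3)[OF t] B.ide_right[OF is_nat_transD(4)[OF t]]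
    by (intro ntrans_eqI[of _ _ "Obj A"]) (auto simp: Hom_functor_cat)
  fix \<eta> H assume \<eta>: "\<eta> \<in> Hom (functor_cat A B) G H"
  show "\<eta> \<cdot>\<^bsub>functor_cat A B\<^esub> \<theta> \<in> Hom (functor_cat A B) F H"
    using \<theta> \<eta> by (auto simp: Hom_functor_cat intro: nat_trans_cmp)
  fix \<zeta> K assume \<zeta>: "\<zeta> \<in> Hom (functor_cat A B) H K"
  show "\<zeta> \<cdot>\<^bsub>functor_cat A B\<^esub> (\<eta> \<cdot>\<^bsub>functor_cat A B\<^esub> \<theta>) =
      (\<zeta> \<cdot>\<^bsub>functor_cat A B\<^esub> \<eta>) \<cdot>\<^bsub>functor_cat A B\<^esub> \<theta>"
  proof (rule ntrans_eqI[of _ _ "Obj A"])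
    fix X assume X: "X \<in> Obj A"
    have "NCmp \<theta> X \<in> Hom B (FOb F X) (FOb G X)" "NCmp \<eta> X \<in> Hom B (FOb G X) (FOb H X)"
      "NCmp \<zeta> X \<in> Hom B (FOb H X) (FOb K X)"
      using \<theta> \<eta> \<zeta> X is_nat_transD(4) by (force simp: Hom_functor_cat)+
    then show "NCmp (\<zeta> \<cdot>\<^bsub>functor_cat A B\<^esub> (\<eta> \<cdot>\<^bsub>functor_cat A B\<^esub> \<theta>)) X =
        NCmp ((\<zeta> \<cdot>\<^bsub>functor_cat A B\<^esub> \<eta>) \<cdot>\<^bsub>functor_cat A B\<^esub> \<theta>) X"
      using X B.cmp_assoc by simp
  qed simp_all
qed (auto simp: Hom_functor_cat nat_trans_ide dest: is_nat_transD)

lemma nat_iso: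
  assumes \<theta>: "is_nat_trans A B \<theta>" and iso: "\<And>X. X \<in> Obj A \<Longrightarrow> is_iso B (NCmp \<theta> X)"
  shows "is_iso (functor_cat A B) \<theta>"
proof -
  note t = is_nat_transD[OF \<theta>]
  interpret F: is_functor A B "NDom \<theta>" by fact
  interpret G: is_functor A B "NCod \<theta>" by fact
  interpret A: category A by (fact F.dom_category)
  interpret B: category B by (fact F.cod_category)
  have "\<exists>g. g \<in> Hom B (FOb (NCod \<theta>) X) (FOb (NDom \<theta>) X) \<and>
      g \<cdot>\<^bsub>B\<^esub> NCmp \<theta> X = Ide B (FOb (NDom \<theta>) X) \<and> NCmp \<theta> X \<cdot>\<^bsub>B\<^esub> g = Ide B (FOb (NCod \<theta>) X)"
    if "X \<in> Obj A" for X
    using is_isoE[OF iso[OF that] t(4)[OF that]] by metis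
  then obtain g where g: "g X \<in> Hom B (FOb (NCod \<theta>) X) (FOb (NDom \<theta>) X)"
      "g X \<cdot>\<^bsub>B\<^esub> NCmp \<theta> X = Ide B (FOb (NDom \<theta>) X)"
      "NCmp \<theta> X \<cdot>\<^bsub>B\<^esub> g X = Ide B (FOb (NCod \<theta>) X)" if "X \<in> Obj A" for X
    by metis
  define \<eta> where "\<eta> = \<lparr>NDom = NCod \<theta>, NCod = NDom \<theta>, NCmp = (\<lambda>X\<in>Obj A. g X)\<rparr>"
  have "is_nat_trans A B \<eta>"
  proof (rule is_nat_transI)
    fix f X Y assume f: "f \<in> Hom A X Y"
    note o = A.hom_obj[OF f]
    note gX = g[OF o(1)] and gY = g[OF o(2)] and Ff = F.ar_hom[OF f] and Gf = G.ar_hom[OF f]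
    \<comment> \<open>Naturality of the chosen inverses: \<theta>_X g_X = id is inserted on the
      right, naturality of \<theta> moves \<open>f\<close> across, and g_Y \<theta>_Y
      cancels.\<close>
    have "g Y \<cdot>\<^bsub>B\<^esub> FAr (NCod \<theta>) f = g Y \<cdot>\<^bsub>B\<^esub> (FAr (NCod \<theta>) f \<cdot>\<^bsub>B\<^esub> (NCmp \<theta> X \<cdot>\<^bsub>B\<^esub> g X))"
      using gX B.ide_right[OF Gf] by simp
    also have "\<dots> = g Y \<cdot>\<^bsub>B\<^esub> ((FAr (NCod \<theta>) f \<cdot>\<^bsub>B\<^esub> NCmp \<theta> X) \<cdot>\<^bsub>B\<^esub> g X)"
      using B.cmp_assoc[OF gX(1) t(4)[OF o(1)] Gf] by simp
    also have "\<dots> = g Y \<cdot>\<^bsub>B\<^esub> ((NCmp \<theta> Y \<cdot>\<^bsub>B\<^esub> FAr (NDom \<theta>) f) \<cdot>\<^bsub>B\<^esub> g X)"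
      using t(5)[OF f] by simp
    also have "\<dots> = (g Y \<cdot>\<^bsub>B\<^esub> NCmp \<theta> Y) \<cdot>\<^bsub>B\<^esub> (FAr (NDom \<theta>) f \<cdot>\<^bsub>B\<^esub> g X)"
      using B.cmp_assoc[OF gX(1) Ff t(4)[OF o(2)]]
        B.cmp_assoc[OF B.cmp_hom[OF gX(1) Ff] t(4)[OF o(2)] gY(1)] by simp
    also have "\<dots> = FAr (NDom \<theta>) f \<cdot>\<^bsub>B\<^esub> g X"
      using gY B.ide_left[OF B.cmp_hom[OF gX(1) Ff]] by simp
    finally show "NCmp \<eta> Y \<cdot>\<^bsub>B\<^esub> FAr (NDom \<eta>) f = FAr (NCod \<eta>) f \<cdot>\<^bsub>B\<^esub> NCmp \<eta> X"
      using o by (simp add: \<eta>_def)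
  qed (use t g in \<open>auto simp: \<eta>_def\<close>)
  then show ?thesis
    using \<theta> g t(3)
    by (intro is_isoI[of _ _ "NDom \<theta>" "NCod \<theta>" \<eta>] ntrans_eqI[of _ _ "Obj A"])
      (auto simp: Hom_functor_cat, auto simp: \<eta>_def)
qed

section \<open>Functors inverting a class of arrows, and precomposition\<close>

lemma Hom_functor_cat_inv:
  "\<theta> \<in> Hom (functor_cat_inv A W B) F G \<longleftrightarrow> is_nat_trans A B \<theta> \<and> NDom \<theta> = F \<and> NCod \<theta> = G \<and>
    (\<forall>w\<in>W. is_iso B (FAr F w)) \<and> (\<forall>w\<in>W. is_iso B (FAr G w))"
  by (auto simp: functor_cat_inv_def Hom_full_subcat Hom_functor_cat)

lemma Obj_functor_cat_inv:
  "F \<in> Obj (functor_cat_inv A W B) \<longleftrightarrow> is_functor A B F \<and> (\<forall>w\<in>W. is_iso B (FAr F w))"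
  by (auto simp: functor_cat_inv_def)

lemma category_functor_cat_inv: "category (functor_cat_inv A W B)"
  unfolding functor_cat_inv_def by (intro category_full_subcat category_functor_cat)

lemma functor_cat_inv_simps [simp]:
  "Dom (functor_cat_inv A W B) = NDom" "Cod (functor_cat_inv A W B) = NCod"
  "Ide (functor_cat_inv A W B) = Ide (functor_cat A B)"
  "Cmp (functor_cat_inv A W B) = Cmp (functor_cat A B)"
  by (auto simp: functor_cat_inv_def)

lemma Arr_functor_cat_inv:
  "\<theta> \<in> Arr (functor_cat_inv A W B) \<longleftrightarrow> is_nat_trans A B \<theta> \<and>
    (\<forall>w\<in>W. is_iso B (FAr (NDom \<theta>) w)) \<and> (\<forall>w\<in>W. is_iso B (FAr (NCod \<theta>) w))"
  by (auto simp: functor_cat_inv_def Arr_full_subcat)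

text \<open>What \<open>precomp\<close> does to a transformation, namely whiskering with
  \<open>P\<close>. It has a name of its own because the endofunctors \<open>precomp_endo\<close>
  act on arrows in the same way.\<close>

definition precomp_nat :: "('o, 'm, 'y) cat_scheme \<Rightarrow> ('o, 'm, 'p, 'n) func \<Rightarrow>
    (('p, 'n, 'q, 'k) func, 'p, 'k) ntrans \<Rightarrow> (('o, 'm, 'q, 'k) func, 'o, 'k) ntrans" where
  "precomp_nat A P \<theta> = \<lparr>NDom = comp_func A (NDom \<theta>) P, NCod = comp_func A (NCod \<theta>) P,
     NCmp = (\<lambda>a\<in>Obj A. NCmp \<theta> (FOb P a))\<rparr>"

lemma precomp_nat_simps [simp]:
  "NDom (precomp_nat A P \<theta>) = comp_func A (NDom \<theta>) P"
  "NCod (precomp_nat A P \<theta>) = comp_func A (NCod \<theta>) P"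
  "X \<in> Obj A \<Longrightarrow> NCmp (precomp_nat A P \<theta>) X = NCmp \<theta> (FOb P X)"
  "NCmp (precomp_nat A P \<theta>) \<in> extensional (Obj A)"
  by (auto simp: precomp_nat_def)

lemma is_nat_trans_precomp_nat:
  assumes "is_functor A B P" "is_nat_trans B X \<theta>"
  shows "is_nat_trans A X (precomp_nat A P \<theta>)"
proof -
  note t = is_nat_transD[OF assms(2)]
  interpret P: is_functor A B P by fact
  interpret A: category A by (fact P.dom_category)
  show ?thesis
  proof (rule is_nat_transI)
    fix f a b assume f: "f \<in> Hom A a b"
    have "f \<in> Arr A"
      using f by (simp add: Hom_iff)
    then show "NCmp (precomp_nat A P \<theta>) b \<cdot>\<^bsub>X\<^esub> FAr (NDom (precomp_nat A P \<theta>)) f =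
        FAr (NCod (precomp_nat A P \<theta>)) f \<cdot>\<^bsub>X\<^esub> NCmp (precomp_nat A P \<theta>) a"
      using t(5)[OF P.ar_hom[OF f]] A.hom_obj[OF f] by simp
  qed (use t assms is_functor_comp P.ob_obj in auto)
qed

lemma precomp_nat_ide:
  assumes "is_functor A B P"
  shows "precomp_nat A P (Ide (functor_cat B X) G) = Ide (functor_cat A X) (comp_func A G P)"
  using is_functor.ob_obj[OF assms] by (intro ntrans_eqI[of _ _ "Obj A"]) auto

lemma precomp_nat_cmp:
  assumes "is_functor A B P"
  shows "precomp_nat A P (\<eta> \<cdot>\<^bsub>functor_cat B X\<^esub> \<theta>) =
    precomp_nat A P \<eta> \<cdot>\<^bsub>functor_cat A X\<^esub> precomp_nat A P \<theta>"
  using is_functor.ob_obj[OF assms] by (intro ntrans_eqI[of _ _ "Obj A"]) auto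

lemma precomp_simps [simp]:
  "is_functor B X G \<Longrightarrow> FOb (precomp A B P X) G = comp_func A G P"
  "is_nat_trans B X \<theta> \<Longrightarrow> FAr (precomp A B P X) \<theta> = precomp_nat A P \<theta>"
  by (auto simp: precomp_def precomp_nat_def)

lemma is_functor_precomp:
  assumes P: "is_functor A B P"
  shows "is_functor (functor_cat B X) (functor_cat A X) (precomp A B P X)"
proof -
  interpret P: is_functor A B P by fact
  show ?thesis
  proof (rule is_functor.intro)
    fix \<theta> F G assume \<theta>: "\<theta> \<in> Hom (functor_cat B X) F G"
    then have t: "is_nat_trans B X \<theta>" "NDom \<theta> = F" "NCod \<theta> = G"
      by (simp_all add: Hom_functor_cat)
    note FG = is_nat_transD(1,2)[OF t(1), unfolded t(2,3)]
    show "FAr (precomp A B P X) \<theta>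
        \<in> Hom (functor_cat A X) (FOb (precomp A B P X) F) (FOb (precomp A B P X) G)"
      using t is_nat_trans_precomp_nat[OF P t(1)] FG by (simp add: Hom_functor_cat)
    fix \<eta> H assume "\<eta> \<in> Hom (functor_cat B X) G H"
    then show "FAr (precomp A B P X) (\<eta> \<cdot>\<^bsub>functor_cat B X\<^esub> \<theta>) =
      FAr (precomp A B P X) \<eta> \<cdot>\<^bsub>functor_cat A X\<^esub> FAr (precomp A B P X) \<theta>"
      using t nat_trans_cmp[OF t(1)] precomp_nat_cmp[OF P, of X] by (simp add: Hom_functor_cat)
  next
    show "FOb (precomp A B P X) F \<in> Obj (functor_cat A X)" if "F \<in> Obj (functor_cat B X)" for F
      using that by (simp add: is_functor_comp[OF P])
    show "FAr (precomp A B P X) (Ide (functor_cat B X) F) =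
        Ide (functor_cat A X) (FOb (precomp A B P X) F)" if "F \<in> Obj (functor_cat B X)" for F
      using that precomp_nat_ide[OF P, of X] nat_trans_ide[of B X F] by simp
  qed (auto simp: precomp_def category_functor_cat)
qed

lemma functor_full_subcat_corestrict:
  assumes "is_functor A C F" "\<And>X. X \<in> Obj A \<Longrightarrow> FOb F X \<in> S"
  shows "is_functor A (full_subcat C S) F"
proof -
  interpret is_functor A C F by fact
  interpret A: category A by (fact dom_category)
  show ?thesis
  proof (rule is_functor.intro)
    show "FAr F f \<in> Hom (full_subcat C S) (FOb F X) (FOb F Y)" if "f \<in> Hom A X Y" for f X Y
      using ar_hom[OF that] assms(2) A.hom_obj[OF that] by (simp add: Hom_full_subcat)
    show "FAr F (g \<cdot>\<^bsub>A\<^esub> f) = FAr F g \<cdot>\<^bsub>full_subcat C S\<^esub> FAr F f"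
      if "f \<in> Hom A X Y" "g \<in> Hom A Y Z" for f g X Y Z
      using ar_cmp[OF that] by simp
    show "FOb F X \<in> Obj (full_subcat C S)" if "X \<in> Obj A" for X
      using ob_obj[OF that] assms(2)[OF that] by simp
  qed (use dom_category cod_category ob_ext ar_ext ar_ide category_full_subcat in auto)
qed

text \<open>Functors preserve isomorphisms, so \<open>G P\<close> inverts \<open>W\<close> as soon
  as \<open>P\<close> does; this places the values in the full subcategory.\<close>

lemma is_functor_precomp_inv:
  assumes P: "is_functor A B P" and W: "W \<subseteq> Arr A" "\<And>w. w \<in> W \<Longrightarrow> is_iso B (FAr P w)"
  shows "is_functor (functor_cat B X) (functor_cat_inv A W X) (precomp A B P X)"
  unfolding functor_cat_inv_def
proof (rule functor_full_subcat_corestrict[OF is_functor_precomp[OF P]])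
  fix G assume "G \<in> Obj (functor_cat B X)"
  then have G: "is_functor B X G"
    by simp
  then show "FOb (precomp A B P X) G \<in> {F. \<forall>w\<in>W. is_iso X (FAr F w)}"
    using W is_functor.preserves_iso[OF G] by (auto simp: subset_iff)
qed

text \<open>The endofunctor \<open>H |-> H K\<close> on the functors that invert \<open>W\<close>.
  The cases \<open>K = RQ\<close>, \<open>K = Q\<close> and \<open>K = id\<close> are the corners of
  the span in the final comparison. The composite with \<open>id_func\<close> restricts the source
  to the full subcategory.\<close>

definition precomp_endo :: "('o, 'm, 'x) cat_scheme \<Rightarrow> 'm set \<Rightarrow> ('q, 'k, 'z) cat_scheme \<Rightarrow>
    ('o, 'm, 'o, 'm) func \<Rightarrow>
    (('o, 'm, 'q, 'k) func, (('o, 'm, 'q, 'k) func, 'o, 'k) ntrans,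
     ('o, 'm, 'q, 'k) func, (('o, 'm, 'q, 'k) func, 'o, 'k) ntrans) func" where
  "precomp_endo A W X K =
     comp_func (functor_cat_inv A W X) (precomp A A K X) (id_func (functor_cat_inv A W X))"

lemma is_functor_precomp_endo:
  assumes K: "is_functor A A K" and W: "W \<subseteq> Arr A" "FAr K ` W \<subseteq> W"
  shows "is_functor (functor_cat_inv A W X) (functor_cat_inv A W X) (precomp_endo A W X K)"
  unfolding precomp_endo_def functor_cat_inv_def
  by (rule functor_full_subcat_corestrict[OF functor_full_subcat_dom[OF is_functor_precomp[OF K]]])
    (use W in \<open>auto simp: subset_iff\<close>)

lemma precomp_endo_simps:
  "H \<in> Obj (functor_cat_inv A W X) \<Longrightarrow> FOb (precomp_endo A W X K) H = comp_func A H K"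
  "\<theta> \<in> Arr (functor_cat_inv A W X) \<Longrightarrow> FAr (precomp_endo A W X K) \<theta> = precomp_nat A K \<theta>"
  by (auto simp: precomp_endo_def Obj_functor_cat_inv Arr_functor_cat_inv)

lemma is_nat_trans_postcomp:
  fixes \<tau> :: "(('o, 'm, 'p, 'n) func, 'o, 'n) ntrans" and H :: "('p, 'n, 'q, 'k) func"
  assumes "is_nat_trans A B \<tau>" "is_functor B X H"
  shows "is_nat_trans A X \<lparr>NDom = comp_func A H (NDom \<tau>), NCod = comp_func A H (NCod \<tau>),
    NCmp = (\<lambda>a\<in>Obj A. FAr H (NCmp \<tau> a))\<rparr>"
proof (rule is_nat_transI, goal_cases)
  note t = is_nat_transD[OF assms(1)]
  interpret H: is_functor B X H by fact
  interpret F: is_functor A B "NDom \<tau>" by fact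
  interpret G: is_functor A B "NCod \<tau>" by fact
  interpret A: category A by (fact F.dom_category)
  {
    case (4 a)
    then show ?case
      using H.ar_hom t(4) by simp
  next
    case (5 f a b)
    then show ?case
      using H.ar_cmp[OF F.ar_hom[OF 5] t(4)[OF A.hom_obj(2)[OF 5]]] A.hom_obj[OF 5]
        H.ar_cmp[OF t(4)[OF A.hom_obj(1)[OF 5]] G.ar_hom[OF 5]] t(5)[OF 5]
      by (simp add: Hom_iff)
  }
qed (use assms is_nat_transD[OF assms(1)] in \<open>auto intro: is_functor_comp\<close>)

text \<open>The isomorphism has \<open>H \<tau>\<close> as its component at \<open>H\<close>. The
  components \<open>H(\<tau>_a)\<close> of that transformation are invertible because \<tau>_a lies
  in \<open>W\<close> and \<open>H\<close> inverts \<open>W\<close>, even when \<tau>_a is not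
  invertible in \<open>A\<close>.\<close>

lemma precomp_endo_isomorphic:
  assumes \<tau>: "is_nat_trans A A \<tau>" "NDom \<tau> = K" "NCod \<tau> = L"
    and W: "W \<subseteq> Arr A" "FAr K ` W \<subseteq> W" "FAr L ` W \<subseteq> W"
    and \<tau>W: "\<And>a. a \<in> Obj A \<Longrightarrow> NCmp \<tau> a \<in> W"
  shows "isomorphic (functor_cat (functor_cat_inv A W X) (functor_cat_inv A W X))
    (precomp_endo A W X K) (precomp_endo A W X L)"
proof -
  let ?E = "functor_cat_inv A W X"
  note t = is_nat_transD[OF \<tau>(1), unfolded \<tau>(2,3)]
  note PK = is_functor_precomp_endo[OF t(1) W(1,2), of X]
    and PL = is_functor_precomp_endo[OF t(2) W(1,3), of X]
  interpret A: category A
    using t(1) by (rule is_functor.dom_category)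
  define \<mu> where "\<mu> H = \<lparr>NDom = comp_func A H K, NCod = comp_func A H L,
    NCmp = (\<lambda>a\<in>Obj A. FAr H (NCmp \<tau> a))\<rparr>" for H :: "('a, 'b, 'd, 'e) func"
  have \<mu>: "\<mu> H \<in> Hom ?E (comp_func A H K) (comp_func A H L)" "is_iso ?E (\<mu> H)" if H: "H \<in> Obj ?E" for H
  proof -
    have H': "is_functor A X H" "\<And>w. w \<in> W \<Longrightarrow> is_iso X (FAr H w)"
      using H by (auto simp: Obj_functor_cat_inv)
    have inv: "\<forall>w\<in>W. is_iso X (FAr (comp_func A H P) w)" if "FAr P ` W \<subseteq> W" for P :: "('a, 'b, 'a, 'b) func"
      using that W(1) H'(2) by (metis comp_func_simps(2) image_subset_iff subsetD)
    have nt: "is_nat_trans A X (\<mu> H)"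
      using is_nat_trans_postcomp[OF \<tau>(1) H'(1)] \<tau> by (simp add: \<mu>_def)
    then show hom: "\<mu> H \<in> Hom ?E (comp_func A H K) (comp_func A H L)"
      using inv[OF W(2)] inv[OF W(3)] by (simp add: Hom_functor_cat_inv \<mu>_def)
    have iso: "is_iso (functor_cat A X) (\<mu> H)"
      by (rule nat_iso[OF nt]) (use \<tau>W H' in \<open>auto simp: \<mu>_def\<close>)
    then show "is_iso ?E (\<mu> H)"
      using is_iso_full_subcat[OF iso hom[unfolded functor_cat_inv_def]]
      by (simp add: functor_cat_inv_def)
  qed
  define N where "N = \<lparr>NDom = precomp_endo A W X K, NCod = precomp_endo A W X L,
    NCmp = (\<lambda>H\<in>Obj ?E. \<mu> H)\<rparr>"
  have "is_nat_trans ?E ?E N"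
  proof (rule is_nat_transI, goal_cases)
    case (4 H)
    then show ?case
      using \<mu>(1) by (simp add: N_def precomp_endo_simps)
  next
    case (5 \<theta> F G)
    interpret E: category ?E by (fact category_functor_cat_inv)
    have nt: "is_nat_trans A X \<theta>" "NDom \<theta> = F" "NCod \<theta> = G" and "\<theta> \<in> Arr ?E"
      using 5 by (auto simp: Hom_functor_cat_inv Hom_iff Arr_functor_cat_inv)
    have "\<mu> G \<cdot>\<^bsub>functor_cat A X\<^esub> precomp_nat A K \<theta> = precomp_nat A L \<theta> \<cdot>\<^bsub>functor_cat A X\<^esub> \<mu> F"
    proof (rule ntrans_eqI[of _ _ "Obj A"])
      fix a assume a: "a \<in> Obj A"
      \<comment> \<open>Naturality in \<open>H\<close> along \<theta> is, at each object
        \<open>a\<close>, the naturality square of \<theta> at the arrow \<tau>_a.\<close>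
      show "NCmp (\<mu> G \<cdot>\<^bsub>functor_cat A X\<^esub> precomp_nat A K \<theta>) a =
          NCmp (precomp_nat A L \<theta> \<cdot>\<^bsub>functor_cat A X\<^esub> \<mu> F) a"
        using a is_nat_transD(5)[OF nt(1) t(4)[OF a]] nt by (simp add: \<mu>_def)
    qed (use nt in \<open>simp_all add: \<mu>_def\<close>)
    then show ?case
      using E.hom_obj[OF 5] \<open>\<theta> \<in> Arr ?E\<close> by (simp add: N_def precomp_endo_simps)
  qed (use PK PL in \<open>auto simp: N_def\<close>)
  moreover from this have "is_iso (functor_cat ?E ?E) N"
    using \<mu>(2) by (intro nat_iso) (auto simp: N_def)
  ultimately show ?thesis
    unfolding isomorphic_def by (auto simp: Hom_functor_cat N_def intro!: bexI[of _ N])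
qed

text \<open>An equality of records, not merely an isomorphism: by extensionality the composite of
  \<open>H\<close> with \<open>id_func A\<close> is literally \<open>H\<close>.\<close>

lemma precomp_endo_id:
  assumes "category A" "W \<subseteq> Arr A"
  shows "precomp_endo A W X (id_func A) = id_func (functor_cat_inv A W X)"
proof -
  note i = is_functor_id[OF assms(1)]
  have c: "comp_func A H (id_func A) = H" if "is_functor A X H" for H :: "('a, 'b, 'd, 'e) func"
    by (rule func_eqI[OF is_functor_comp[OF i that] that]) simp_all
  show ?thesis
  proof (rule func_eqI[OF _ is_functor_id[OF category_functor_cat_inv]])
    show "is_functor (functor_cat_inv A W X) (functor_cat_inv A W X) (precomp_endo A W X (id_func A))"
      using assms by (intro is_functor_precomp_endo[OF i]) auto
    fix \<theta> :: "(('a, 'b, 'd, 'e) func, 'a, 'e) ntrans" assume \<theta>: "\<theta> \<in> Arr (functor_cat_inv A W X)"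
    then have "is_nat_trans A X \<theta>"
      by (simp add: Arr_functor_cat_inv)
    note nt = is_nat_transD[OF this]
    have "precomp_nat A (id_func A) \<theta> = \<theta>"
      by (rule ntrans_eqI[of _ _ "Obj A"]) (use nt c in auto)
    then show "FAr (precomp_endo A W X (id_func A)) \<theta> = FAr (id_func (functor_cat_inv A W X)) \<theta>"
      using \<theta> by (simp add: precomp_endo_simps)
  qed (use c in \<open>auto simp: precomp_endo_simps Obj_functor_cat_inv\<close>)
qed

section \<open>Strict 2-categories\<close>

lemma disc_simps [simp]:
  "Obj (disc C) = Obj C" "Arr (disc C) = Arr C" "Dom (disc C) = Dom C" "Cod (disc C) = Cod C"
  "Ide (disc C) = Ide C" "Cmp (disc C) = Cmp C" "Cell (disc C) = Arr C" "Src (disc C) f = f"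
  "Tgt (disc C) f = f" "VIde (disc C) f = f" "VCmp (disc C) g f = f" "HCmp (disc C) = Cmp C"
  by (simp_all add: disc_def)

lemma Hom_disc [simp]: "Hom (disc C) X Y = Hom C X Y"
  by (simp add: Hom_def)

lemma Cells_disc: "\<alpha> \<in> Cells (disc C) f g \<longleftrightarrow> f \<in> Arr C \<and> \<alpha> = f \<and> \<alpha> = g"
  by (auto simp: Cells_def)

lemma hom_cat_simps [simp]:
  "Obj (hom_cat B X Y) = Hom B X Y" "Arr (hom_cat B X Y) = {\<alpha> \<in> Cell B. Src B \<alpha> \<in> Hom B X Y}"
  "Dom (hom_cat B X Y) = Src B" "Cod (hom_cat B X Y) = Tgt B"
  "Ide (hom_cat B X Y) = VIde B" "Cmp (hom_cat B X Y) = VCmp B"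
  by (simp_all add: hom_cat_def)

lemma Hom_hom_cat: "\<alpha> \<in> Hom (hom_cat B X Y) f g \<longleftrightarrow> f \<in> Hom B X Y \<and> \<alpha> \<in> Cells B f g"
  by (auto simp: Hom_iff[of \<alpha>] Cells_def)

lemma category_disc_iff: "category (disc C) \<longleftrightarrow> category C"
  by (simp add: category_def)

lemma category2_disc:
  assumes "category C"
  shows "category2 (disc C)"
proof -
  interpret category C by fact
  have cl: "g \<cdot>\<^bsub>C\<^esub> f \<in> Arr C" if "f \<in> Arr C" "g \<in> Arr C" "Dom C g = Cod C f" for f g
    using that cmp_hom[of f "Dom C f" "Cod C f" g "Cod C g"] by (simp add: Hom_iff)
  show ?thesis
  proof (rule category2.intro)
    show "category2_axioms (disc C)"
    proof (rule category2_axioms.intro)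
      show "category (hom_cat (disc C) X Y)" for X Y
        by (rule category.intro) (auto simp: Hom_hom_cat Cells_disc, auto simp: Hom_iff)
    qed (auto simp: Cells_disc Hom_iff cmp_assoc intro: ide_left ide_right cl)
  qed (simp add: category_disc_iff assms)
qed

section \<open>Vertical composition, whiskering and equivalences\<close>

context category2
begin

text \<open>The arrows of \<open>hom_cat\<close> are selected by their source alone. That the target
  lies in the same hom set follows from \<open>hom_cat\<close> being a category, whose
  \<open>Cod\<close> takes values in its objects.\<close>

lemma cell_tgt: "f \<in> Hom B X Y \<Longrightarrow> \<alpha> \<in> Cells B f g \<Longrightarrow> g \<in> Hom B X Y"
  using category.hom_obj(2)[OF hom_category, of X Y \<alpha> f g] hom_obj[of f X Y] by (simp add: Hom_hom_cat)

lemma vide_cells: "f \<in> Hom B X Y \<Longrightarrow> VIde B f \<in> Cells B f f"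
  using category.ide_hom[OF hom_category, of X Y f] hom_obj[of f X Y] by (simp add: Hom_hom_cat)

lemma vcmp_cells:
  "f \<in> Hom B X Y \<Longrightarrow> \<alpha> \<in> Cells B f g \<Longrightarrow> \<beta> \<in> Cells B g h \<Longrightarrow> VCmp B \<beta> \<alpha> \<in> Cells B f h"
  using category.cmp_hom[OF hom_category, of X Y \<alpha> f g \<beta> h] hom_obj[of f X Y] cell_tgt[of f X Y \<alpha> g]
  by (simp add: Hom_hom_cat)

lemma vcmp_ide_left: "f \<in> Hom B X Y \<Longrightarrow> \<alpha> \<in> Cells B f g \<Longrightarrow> VCmp B (VIde B g) \<alpha> = \<alpha>"
  using category.ide_left[OF hom_category, of X Y \<alpha> f g] hom_obj[of f X Y] by (simp add: Hom_hom_cat)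

lemma vcmp_ide_right: "f \<in> Hom B X Y \<Longrightarrow> \<alpha> \<in> Cells B f g \<Longrightarrow> VCmp B \<alpha> (VIde B f) = \<alpha>"
  using category.ide_right[OF hom_category, of X Y \<alpha> f g] hom_obj[of f X Y] by (simp add: Hom_hom_cat)

lemma vcmp_assoc:
  "f \<in> Hom B X Y \<Longrightarrow> \<alpha> \<in> Cells B f g \<Longrightarrow> \<beta> \<in> Cells B g h \<Longrightarrow> \<gamma> \<in> Cells B h k \<Longrightarrow>
    VCmp B \<gamma> (VCmp B \<beta> \<alpha>) = VCmp B (VCmp B \<gamma> \<beta>) \<alpha>"
  using category.cmp_assoc[OF hom_category, of X Y \<alpha> f g \<beta> h \<gamma> k] hom_obj[of f X Y]
    cell_tgt[of f X Y \<alpha> g] cell_tgt[of g X Y \<beta> h]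
  by (simp add: Hom_hom_cat)

lemma inv_cellE:
  assumes "is_inv_cell B \<alpha>" "f \<in> Hom B X Y" "\<alpha> \<in> Cells B f g"
  obtains \<beta> where "\<beta> \<in> Cells B g f" "VCmp B \<beta> \<alpha> = VIde B f" "VCmp B \<alpha> \<beta> = VIde B g"
proof -
  have "is_iso (hom_cat B X Y) \<alpha>"
    using assms by (auto simp: is_inv_cell_def Cells_def Hom_iff)
  moreover have "\<alpha> \<in> Hom (hom_cat B X Y) f g"
    using assms by (simp add: Hom_hom_cat)
  ultimately obtain \<beta> where "\<beta> \<in> Hom (hom_cat B X Y) g f"
      "VCmp B \<beta> \<alpha> = VIde B f" "VCmp B \<alpha> \<beta> = VIde B g"
    by (auto elim: is_isoE)
  then show ?thesis
    by (intro that) (auto simp: Hom_hom_cat)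
qed

abbreviation wl :: "'m \<Rightarrow> 'c \<Rightarrow> 'c" where "wl r \<alpha> \<equiv> HCmp B (VIde B r) \<alpha>"
abbreviation wr :: "'c \<Rightarrow> 'm \<Rightarrow> 'c" where "wr \<alpha> l \<equiv> HCmp B \<alpha> (VIde B l)"

lemma wl_cells:
  assumes "f \<in> Hom B X Y" "r \<in> Hom B Y Z" "\<alpha> \<in> Cells B f g"
  shows "wl r \<alpha> \<in> Cells B (r \<cdot>\<^bsub>B\<^esub> f) (r \<cdot>\<^bsub>B\<^esub> g)"
  by (rule hcmp_cells[OF assms vide_cells[OF assms(2)]])

lemma wr_cells:
  assumes "l \<in> Hom B X Y" "f \<in> Hom B Y Z" "\<alpha> \<in> Cells B f g"
  shows "wr \<alpha> l \<in> Cells B (f \<cdot>\<^bsub>B\<^esub> l) (g \<cdot>\<^bsub>B\<^esub> l)"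
  by (rule hcmp_cells[OF assms(1,2) vide_cells[OF assms(1)] assms(3)])

lemma wl_vcmp:
  assumes "f \<in> Hom B X Y" "r \<in> Hom B Y Z" "\<alpha> \<in> Cells B f g" "\<beta> \<in> Cells B g h"
  shows "wl r (VCmp B \<beta> \<alpha>) = VCmp B (wl r \<beta>) (wl r \<alpha>)"
  using interchange[OF assms vide_cells vide_cells] vcmp_ide_left[OF _ vide_cells] assms(2)
  by metis

lemma wr_vcmp:
  assumes "l \<in> Hom B X Y" "f \<in> Hom B Y Z" "\<alpha> \<in> Cells B f g" "\<beta> \<in> Cells B g h"
  shows "wr (VCmp B \<beta> \<alpha>) l = VCmp B (wr \<beta> l) (wr \<alpha> l)"
  using interchange[OF assms(1,2) vide_cells vide_cells assms(3,4)] vcmp_ide_left[OF _ vide_cells]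
    assms(1)
  by metis

text \<open>Interchange with identity cells inserted in either order. The first form is the
  convention by which \<open>Ho\<close> composes horizontally; the agreement of the two forms lets a
  cell \<eta> slide past \<alpha>.\<close>

lemma hcmp_decomp:
  assumes f: "f \<in> Hom B X Y" and h: "h \<in> Hom B Y Z" and \<alpha>: "\<alpha> \<in> Cells B f g" and \<beta>: "\<beta> \<in> Cells B h k"
  shows "HCmp B \<beta> \<alpha> = VCmp B (wr \<beta> g) (wl h \<alpha>)" "HCmp B \<beta> \<alpha> = VCmp B (wl k \<alpha>) (wr \<beta> f)"
proof -
  note g = cell_tgt[OF f \<alpha>] and k = cell_tgt[OF h \<beta>]
  show "HCmp B \<beta> \<alpha> = VCmp B (wr \<beta> g) (wl h \<alpha>)"
    using interchange[OF f h \<alpha> vide_cells[OF g] vide_cells[OF h] \<beta>]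
    by (simp add: vcmp_ide_left[OF f \<alpha>] vcmp_ide_right[OF h \<beta>])
  show "HCmp B \<beta> \<alpha> = VCmp B (wl k \<alpha>) (wr \<beta> f)"
    using interchange[OF f h vide_cells[OF f] \<alpha> \<beta> vide_cells[OF k]]
    by (simp add: vcmp_ide_right[OF f \<alpha>] vcmp_ide_left[OF h \<beta>])
qed

text \<open>Conjugating by the invertible \<open>\<eta> : id \<Rightarrow> ts\<close> recovers \<open>\<alpha>\<close> from \<open>ts\<alpha>\<close>.\<close>

lemma whisker_conj:
  assumes s: "s \<in> Hom B W Z" and t: "t \<in> Hom B Z W"
    and \<eta>: "\<eta> \<in> Cells B (Ide B W) (t \<cdot>\<^bsub>B\<^esub> s)" "\<eta>' \<in> Cells B (t \<cdot>\<^bsub>B\<^esub> s) (Ide B W)"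
    and inv: "VCmp B \<eta>' \<eta> = VIde B (Ide B W)"
    and f: "f \<in> Hom B X W" and \<alpha>: "\<alpha> \<in> Cells B f g"
  shows "\<alpha> = VCmp B (wr \<eta>' g) (VCmp B (wl t (wl s \<alpha>)) (wr \<eta> f))"
proof -
  note W = hom_obj(1)[OF s] and ts = cmp_hom[OF s t] and g = cell_tgt[OF f \<alpha>]
  note i = ide_hom[OF W]
  have "wl t (wl s \<alpha>) = wl (t \<cdot>\<^bsub>B\<^esub> s) \<alpha>"
    using hcmp_assoc[OF f s t \<alpha> vide_cells[OF s] vide_cells[OF t]] by (simp add: hcmp_vide[OF s t])
  moreover have "VCmp B (wl (t \<cdot>\<^bsub>B\<^esub> s) \<alpha>) (wr \<eta> f) = VCmp B (wr \<eta> g) (wl (Ide B W) \<alpha>)"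
    using hcmp_decomp[OF f i \<alpha> \<eta>(1)] by simp
  moreover have "wl (Ide B W) \<alpha> = \<alpha>"
    by (rule hcmp_ide_left[OF f \<alpha>])
  moreover have "VCmp B (wr \<eta>' g) (VCmp B (wr \<eta> g) \<alpha>) = VCmp B (wr (VCmp B \<eta>' \<eta>) g) \<alpha>"
    using vcmp_assoc[OF f \<alpha>] wr_cells[OF g i \<eta>(1)] wr_cells[OF g ts \<eta>(2)]
    by (simp add: ide_left[OF g] wr_vcmp[OF g i \<eta>])
  moreover have "wr (VIde B (Ide B W)) g = VIde B g"
    by (rule hcmp_ide_left[OF g vide_cells[OF g]])
  ultimately show ?thesis
    by (simp add: inv vcmp_ide_left[OF f \<alpha>])
qed

text \<open>Postcomposition with an equivalence is fully faithful on hom categories. Faithfulness is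
  conjugation by the unit. For fullness, \<open>is_equivalence\<close> supplies no triangle
  identities, so \<open>s \<alpha> = \<gamma>\<close> is not computed directly; one shows
  \<open>t s \<alpha> = t \<gamma>\<close> and cancels \<open>t\<close>, which is faithful for the
  same reason as \<open>s\<close>.\<close>

lemma equivalence_whisker_bij:
  assumes s: "s \<in> Hom B W Z" "is_equivalence B s" and f: "f \<in> Hom B X W" and g: "g \<in> Hom B X W"
    and \<gamma>: "\<gamma> \<in> Cells B (s \<cdot>\<^bsub>B\<^esub> f) (s \<cdot>\<^bsub>B\<^esub> g)"
  shows "\<exists>!\<alpha>. \<alpha> \<in> Cells B f g \<and> wl s \<alpha> = \<gamma>"
proof -
  note W = hom_obj(1)[OF s(1)] and Z = hom_obj(2)[OF s(1)]
  obtain t \<eta> \<epsilon> where t: "t \<in> Hom B Z W"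
    and \<eta>: "\<eta> \<in> Cells B (Ide B W) (t \<cdot>\<^bsub>B\<^esub> s)" "is_inv_cell B \<eta>"
    and \<epsilon>: "\<epsilon> \<in> Cells B (s \<cdot>\<^bsub>B\<^esub> t) (Ide B Z)" "is_inv_cell B \<epsilon>"
    using s unfolding is_equivalence_def by (auto simp: Hom_iff[of s])
  note ts = cmp_hom[OF s(1) t] and st = cmp_hom[OF t s(1)]
  note iW = ide_hom[OF W] and iZ = ide_hom[OF Z]
  obtain \<eta>' where \<eta>': "\<eta>' \<in> Cells B (t \<cdot>\<^bsub>B\<^esub> s) (Ide B W)"
    "VCmp B \<eta>' \<eta> = VIde B (Ide B W)" "VCmp B \<eta> \<eta>' = VIde B (t \<cdot>\<^bsub>B\<^esub> s)"
    using inv_cellE[OF \<eta>(2) iW \<eta>(1)] .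
  obtain \<epsilon>' where \<epsilon>': "\<epsilon>' \<in> Cells B (Ide B Z) (s \<cdot>\<^bsub>B\<^esub> t)"
    "VCmp B \<epsilon>' \<epsilon> = VIde B (s \<cdot>\<^bsub>B\<^esub> t)" "VCmp B \<epsilon> \<epsilon>' = VIde B (Ide B Z)"
    using inv_cellE[OF \<epsilon>(2) st \<epsilon>(1)] .
  have s_inj: "\<alpha> = \<beta>" if "\<alpha> \<in> Cells B f g" "\<beta> \<in> Cells B f g" "wl s \<alpha> = wl s \<beta>" for \<alpha> \<beta>
    using whisker_conj[OF s(1) t \<eta>(1) \<eta>'(1,2) f that(1)]
      whisker_conj[OF s(1) t \<eta>(1) \<eta>'(1,2) f that(2)] that(3) by simp
  note sf = cmp_hom[OF f s(1)] and sg = cmp_hom[OF g s(1)]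
  \<comment> \<open>The conjugation formula with \<open>s\<close> and \<open>t\<close> exchanged:
    the unit is now \<epsilon>' from the identity to \<open>s t\<close>, and \<epsilon> is its
    inverse.\<close>
  have t_inj: "\<alpha> = \<beta>" if "\<alpha> \<in> Cells B (s \<cdot>\<^bsub>B\<^esub> f) (s \<cdot>\<^bsub>B\<^esub> g)" "\<beta> \<in> Cells B (s \<cdot>\<^bsub>B\<^esub> f) (s \<cdot>\<^bsub>B\<^esub> g)"
    "wl t \<alpha> = wl t \<beta>" for \<alpha> \<beta>
    using whisker_conj[OF t s(1) \<epsilon>'(1) \<epsilon>(1) \<epsilon>'(3) sf that(1)]
      whisker_conj[OF t s(1) \<epsilon>'(1) \<epsilon>(1) \<epsilon>'(3) sf that(2)] that(3) by simp
  have assoc: "t \<cdot>\<^bsub>B\<^esub> (s \<cdot>\<^bsub>B\<^esub> h) = t \<cdot>\<^bsub>B\<^esub> s \<cdot>\<^bsub>B\<^esub> h" if "h \<in> Hom B X W" for h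
    by (rule cmp_assoc[OF that s(1) t])
  have t\<gamma>: "wl t \<gamma> \<in> Cells B (t \<cdot>\<^bsub>B\<^esub> s \<cdot>\<^bsub>B\<^esub> f) (t \<cdot>\<^bsub>B\<^esub> s \<cdot>\<^bsub>B\<^esub> g)"
    using wl_cells[OF sf t \<gamma>] by (simp add: assoc f g)
  have \<eta>f: "wr \<eta> f \<in> Cells B f (t \<cdot>\<^bsub>B\<^esub> s \<cdot>\<^bsub>B\<^esub> f)" and \<eta>g: "wr \<eta> g \<in> Cells B g (t \<cdot>\<^bsub>B\<^esub> s \<cdot>\<^bsub>B\<^esub> g)"
    using wr_cells[OF f iW \<eta>(1)] wr_cells[OF g iW \<eta>(1)] by (simp_all add: ide_left[OF f] ide_left[OF g])
  have \<eta>'f: "wr \<eta>' f \<in> Cells B (t \<cdot>\<^bsub>B\<^esub> s \<cdot>\<^bsub>B\<^esub> f) f" and \<eta>'g: "wr \<eta>' g \<in> Cells B (t \<cdot>\<^bsub>B\<^esub> s \<cdot>\<^bsub>B\<^esub> g) g"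
    using wr_cells[OF f ts \<eta>'(1)] wr_cells[OF g ts \<eta>'(1)] by (simp_all add: ide_left[OF f] ide_left[OF g])
  \<comment> \<open>Forced by the conjugation formula, with \<gamma> in the place of
    \<open>s \<alpha>\<close>.\<close>
  define \<alpha> where "\<alpha> = VCmp B (wr \<eta>' g) (VCmp B (wl t \<gamma>) (wr \<eta> f))"
  have c1: "VCmp B (wl t \<gamma>) (wr \<eta> f) \<in> Cells B f (t \<cdot>\<^bsub>B\<^esub> s \<cdot>\<^bsub>B\<^esub> g)"
    by (rule vcmp_cells[OF f \<eta>f t\<gamma>])
  have \<alpha>: "\<alpha> \<in> Cells B f g"
    unfolding \<alpha>_def by (rule vcmp_cells[OF f c1 \<eta>'g])
  have inv: "VCmp B (wr \<eta> h) (wr \<eta>' h) = VIde B (t \<cdot>\<^bsub>B\<^esub> s \<cdot>\<^bsub>B\<^esub> h)" if h: "h \<in> Hom B X W" for h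
    using wr_vcmp[OF h ts \<eta>'(1) \<eta>(1)] \<eta>'(3) by (simp add: hcmp_vide[OF h ts])
  note tsf = cmp_hom[OF f ts] and tsg = cmp_hom[OF g ts]
  have "wl t (wl s \<alpha>) = wl (t \<cdot>\<^bsub>B\<^esub> s) \<alpha>"
    using hcmp_assoc[OF f s(1) t \<alpha> vide_cells[OF s(1)] vide_cells[OF t]] by (simp add: hcmp_vide[OF s(1) t])
  also have "\<dots> = VCmp B (wl (t \<cdot>\<^bsub>B\<^esub> s) \<alpha>) (VCmp B (wr \<eta> f) (wr \<eta>' f))"
    using vcmp_ide_right[OF tsf wl_cells[OF f ts \<alpha>]] by (simp add: inv[OF f])
  also have "\<dots> = VCmp B (VCmp B (wl (t \<cdot>\<^bsub>B\<^esub> s) \<alpha>) (wr \<eta> f)) (wr \<eta>' f)"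
    by (rule vcmp_assoc[OF tsf \<eta>'f \<eta>f wl_cells[OF f ts \<alpha>]])
  \<comment> \<open>Naturality of \<eta>: \<open>t s \<alpha>\<close> after \<eta>_f equals \<eta>_g
    after \<alpha>. Inserting the definition of \<alpha> then cancels \<eta>_g against its
    inverse.\<close>
  also have "VCmp B (wl (t \<cdot>\<^bsub>B\<^esub> s) \<alpha>) (wr \<eta> f) = VCmp B (wr \<eta> g) \<alpha>"
    using hcmp_decomp[OF f iW \<alpha> \<eta>(1)] hcmp_ide_left[OF f \<alpha>] by simp
  also have "VCmp B (wr \<eta> g) \<alpha> = VCmp B (wl t \<gamma>) (wr \<eta> f)"
    unfolding \<alpha>_def using vcmp_assoc[OF f c1 \<eta>'g \<eta>g] vcmp_ide_left[OF f c1] by (simp add: inv[OF g])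
  also have "VCmp B (VCmp B (wl t \<gamma>) (wr \<eta> f)) (wr \<eta>' f) = wl t \<gamma>"
    using vcmp_assoc[OF tsf \<eta>'f \<eta>f t\<gamma>] vcmp_ide_right[OF tsf t\<gamma>] by (simp add: inv[OF f])
  finally have "wl s \<alpha> = \<gamma>"
    using t_inj[OF wl_cells[OF f s(1) \<alpha>] \<gamma>] by blast
  then show ?thesis
    using \<alpha> s_inj by blast
qed

end

section \<open>2-functors, and functors regarded as 2-functors\<close>

lemma is_functor2I:
  fixes F :: "('o, 'm, 'c, 'p, 'n, 'e) func2"
  assumes "is_functor A B F" "category2 A" "category2 B" "FCell F \<in> extensional (Cell A)"
    and "\<And>\<alpha> f g. \<alpha> \<in> Cells A f g \<Longrightarrow> FCell F \<alpha> \<in> Cells B (FAr F f) (FAr F g)"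
    and "\<And>f. f \<in> Arr A \<Longrightarrow> FCell F (VIde A f) = VIde B (FAr F f)"
    and "\<And>\<alpha> \<beta> f g h. \<alpha> \<in> Cells A f g \<Longrightarrow> \<beta> \<in> Cells A g h \<Longrightarrow>
      FCell F (VCmp A \<beta> \<alpha>) = VCmp B (FCell F \<beta>) (FCell F \<alpha>)"
    and "\<And>\<alpha> \<beta> f g h k X Y Z. f \<in> Hom A X Y \<Longrightarrow> h \<in> Hom A Y Z \<Longrightarrow> \<alpha> \<in> Cells A f g \<Longrightarrow> \<beta> \<in> Cells A h k \<Longrightarrow>
      FCell F (HCmp A \<beta> \<alpha>) = HCmp B (FCell F \<beta>) (FCell F \<alpha>)"
  shows "is_functor2 A B F"
  using assms by (intro is_functor2.intro is_functor2_axioms.intro)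

lemma func2_eqI:
  fixes F G :: "('o, 'm, 'c, 'p, 'n, 'e) func2"
  assumes "is_functor2 A B F" "is_functor2 A B G"
    and "\<And>X. X \<in> Obj A \<Longrightarrow> FOb F X = FOb G X" "\<And>f. f \<in> Arr A \<Longrightarrow> FAr F f = FAr G f"
    and "\<And>\<alpha>. \<alpha> \<in> Cell A \<Longrightarrow> FCell F \<alpha> = FCell G \<alpha>"
  shows "F = G"
proof -
  interpret F: is_functor2 A B F by fact
  interpret G: is_functor2 A B G by fact
  have "FOb F = FOb G" "FAr F = FAr G" "FCell F = FCell G"
    using assms(3-5) F.ob_ext G.ob_ext F.ar_ext G.ar_ext F.cell_ext G.cell_ext
    by (metis extensionalityI)+
  then show ?thesis
    by simp
qed

lemma comp_func2_simps [simp]: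
  "X \<in> Obj A \<Longrightarrow> FOb (comp_func2 A G F) X = FOb G (FOb F X)"
  "f \<in> Arr A \<Longrightarrow> FAr (comp_func2 A G F) f = FAr G (FAr F f)"
  "\<alpha> \<in> Cell A \<Longrightarrow> FCell (comp_func2 A G F) \<alpha> = FCell G (FCell F \<alpha>)"
  by (auto simp: comp_func2_def)

lemma is_functor2_comp:
  assumes "is_functor2 A B F" "is_functor2 B C G"
  shows "is_functor2 A C (comp_func2 A G F)"
proof -
  interpret F: is_functor2 A B F by fact
  interpret G: is_functor2 B C G by fact
  interpret A: category2 A by (fact F.dom_category2)
  have ob: "FOb (comp_func2 A G F) = FOb (comp_func A G F)"
    and ar: "FAr (comp_func2 A G F) = FAr (comp_func A G F)"
    by (simp_all add: comp_func2_def comp_func_def)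
  have arr: "f \<in> Arr A" "g \<in> Arr A" "\<alpha> \<in> Cell A" if "\<alpha> \<in> Cells A f g" for \<alpha> f g
    using that A.src_arr A.cell_tgt[OF A.arr_hom that] by (auto simp: Cells_def Hom_iff)
  show ?thesis
  proof (rule is_functor2I)
    have "is_functor A C (comp_func A G F)"
      by (rule is_functor_comp) unfold_locales
    then show "is_functor A C (comp_func2 A G F)"
      unfolding is_functor_def ob ar .
  next
    fix \<alpha> f g assume \<alpha>: "\<alpha> \<in> Cells A f g"
    show "FCell (comp_func2 A G F) \<alpha> \<in> Cells C (FAr (comp_func2 A G F) f) (FAr (comp_func2 A G F) g)"
      using F.cell_cells[OF \<alpha>] G.cell_cells arr[OF \<alpha>] by simp
    fix \<beta> h assume \<beta>: "\<beta> \<in> Cells A g h"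
    show "FCell (comp_func2 A G F) (VCmp A \<beta> \<alpha>) =
        VCmp C (FCell (comp_func2 A G F) \<beta>) (FCell (comp_func2 A G F) \<alpha>)"
      using F.cell_vcmp[OF \<alpha> \<beta>] G.cell_vcmp[OF F.cell_cells[OF \<alpha>] F.cell_cells[OF \<beta>]] arr(3)[OF \<alpha>] arr(3)[OF \<beta>]
        arr(3)[OF A.vcmp_cells[OF A.arr_hom[OF arr(1)[OF \<alpha>]] \<alpha> \<beta>]] by simp
  next
    fix f assume f: "f \<in> Arr A"
    then show "FCell (comp_func2 A G F) (VIde A f) = VIde C (FAr (comp_func2 A G F) f)"
      using F.cell_vide[OF f] G.cell_vide F.ar_arr[OF f] arr(3)[OF A.vide_cells[OF A.arr_hom[OF f]]]
      by (simp add: Hom_iff)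
  next
    fix \<alpha> \<beta> f g h k X Y Z
    assume a: "f \<in> Hom A X Y" "h \<in> Hom A Y Z" "\<alpha> \<in> Cells A f g" "\<beta> \<in> Cells A h k"
    show "FCell (comp_func2 A G F) (HCmp A \<beta> \<alpha>) =
        HCmp C (FCell (comp_func2 A G F) \<beta>) (FCell (comp_func2 A G F) \<alpha>)"
      using F.cell_hcmp[OF a] arr(3)[OF a(3)] arr(3)[OF a(4)] arr(3)[OF A.hcmp_cells[OF a]]
        G.cell_hcmp[OF F.ar_hom[OF a(1)] F.ar_hom[OF a(2)] F.cell_cells[OF a(3)] F.cell_cells[OF a(4)]]
      by simp
  qed (auto simp: F.dom_category2 G.cod_category2 comp_func2_def)
qed

lemma is_functor_disc_iff [simp]:
  "is_functor (disc A) B F \<longleftrightarrow> is_functor A B F" "is_functor A (disc B) F \<longleftrightarrow> is_functor A B F"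
  by (simp_all add: is_functor_def category_disc_iff)

lemma is_nat_trans_disc_iff [simp]:
  "is_nat_trans (disc A) B \<theta> \<longleftrightarrow> is_nat_trans A B \<theta>" "is_nat_trans A (disc B) \<theta> \<longleftrightarrow> is_nat_trans A B \<theta>"
  by (simp_all add: is_nat_trans_def)

lemma is_functor_cong:
  "FOb F = FOb G \<Longrightarrow> FAr F = FAr G \<Longrightarrow> is_functor A B F \<longleftrightarrow> is_functor A B G"
  by (simp add: is_functor_def)

lemma disc_func_simps [simp]:
  "FOb (disc_func F) = FOb F" "FAr (disc_func F) = FAr F" "FCell (disc_func F) = FAr F"
  by (simp_all add: disc_func_def)

lemma is_functor_underlying: "is_functor2 A B F \<Longrightarrow> is_functor A B (underlying_func F)"
  by (rule is_functor_cong[THEN iffD1, OF _ _ is_functor2.axioms(1)]) (simp_all add: underlying_func_def)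

lemma is_functor2_disc:
  assumes "is_functor A B F"
  shows "is_functor2 (disc A) (disc B) (disc_func F)"
proof -
  interpret is_functor A B F by fact
  have "is_functor A B (disc_func F)"
    using is_functor_cong[THEN iffD1, OF _ _ assms, of "disc_func F"] by simp
  then show ?thesis
    using ar_ext dom_category cod_category ar_arr
    by (intro is_functor2I)
      (auto simp: Cells_disc category2_disc Hom_iff intro!: ar_cmp)
qed

definition disc_nat :: "(('o, 'm, 'p, 'n) func, 'o, 'n) ntrans \<Rightarrow> (('o, 'm, 'm, 'p, 'n, 'n) func2, 'o, 'n) ntrans" where
  "disc_nat \<theta> = \<lparr>NDom = disc_func (NDom \<theta>), NCod = disc_func (NCod \<theta>), NCmp = NCmp \<theta>\<rparr>"

definition precomp2_nat :: "('o, 'm, 'c, 'x) cat2_scheme \<Rightarrow> ('o, 'm, 'c, 'p, 'n, 'e) func2 \<Rightarrow>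
    (('p, 'n, 'e, 'q, 'k, 'l) func2, 'p, 'k) ntrans \<Rightarrow> (('o, 'm, 'c, 'q, 'k, 'l) func2, 'o, 'k) ntrans" where
  "precomp2_nat A P \<theta> = \<lparr>NDom = comp_func2 A (NDom \<theta>) P, NCod = comp_func2 A (NCod \<theta>) P,
     NCmp = (\<lambda>a\<in>Obj A. NCmp \<theta> (FOb P a))\<rparr>"

lemma disc_nat_simps [simp]:
  "NDom (disc_nat \<theta>) = disc_func (NDom \<theta>)" "NCod (disc_nat \<theta>) = disc_func (NCod \<theta>)"
  "NCmp (disc_nat \<theta>) = NCmp \<theta>"
  by (simp_all add: disc_nat_def)

lemma precomp2_nat_simps [simp]:
  "NDom (precomp2_nat A P \<theta>) = comp_func2 A (NDom \<theta>) P"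
  "NCod (precomp2_nat A P \<theta>) = comp_func2 A (NCod \<theta>) P"
  "X \<in> Obj A \<Longrightarrow> NCmp (precomp2_nat A P \<theta>) X = NCmp \<theta> (FOb P X)"
  "NCmp (precomp2_nat A P \<theta>) \<in> extensional (Obj A)"
  by (simp_all add: precomp2_nat_def)

text \<open>All cells of \<open>disc\<close> are arrows and \<open>HCmp\<close> is composition of
  arrows, so compatibility with 2-cells is the naturality square once more.\<close>

lemma is_nat_trans2_disc_nat:
  assumes "is_nat_trans A B \<theta>"
  shows "is_nat_trans2 (disc A) (disc B) (disc_nat \<theta>)"
proof -
  note t = is_nat_transD[OF assms]
  note d = is_functor2_disc[OF t(1)] is_functor2_disc[OF t(2)]
  have "is_functor A B (disc_func (NDom \<theta>))" "is_functor A B (disc_func (NCod \<theta>))"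
    using is_functor2.axioms(1)[OF d(1)] is_functor2.axioms(1)[OF d(2)] by simp_all
  then have "is_nat_trans A B (disc_nat \<theta>)"
    using t(3-5) by (intro is_nat_transI) simp_all
  then show ?thesis
    using d t(5) by (auto simp: is_nat_trans2_def Cells_disc)
qed

lemma is_nat_trans2_precomp2_nat:
  assumes P: "is_functor2 A B P" and \<theta>: "is_nat_trans2 B D \<theta>"
  shows "is_nat_trans2 A D (precomp2_nat A P \<theta>)"
proof -
  interpret P: is_functor2 A B P by fact
  interpret A: category2 A by (fact P.dom_category2)
  have nt: "is_nat_trans B D \<theta>" and F: "is_functor2 B D (NDom \<theta>)" "is_functor2 B D (NCod \<theta>)"
    using \<theta> by (simp_all add: is_nat_trans2_def)
  have cell: "HCmp D (VIde D (NCmp \<theta> Y)) (FCell (NDom \<theta>) \<alpha>) = HCmp D (FCell (NCod \<theta>) \<alpha>) (VIde D (NCmp \<theta> X))"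
      if "f \<in> Hom B X Y" "\<alpha> \<in> Cells B f g" for X Y f g \<alpha>
    using \<theta> that unfolding is_nat_trans2_def by blast+
  note t = is_nat_transD[OF nt] and c = is_functor2_comp[OF P F(1)] is_functor2_comp[OF P F(2)]
  have "is_nat_trans A D (precomp2_nat A P \<theta>)"
  proof (rule is_nat_transI)
    fix f X Y assume f: "f \<in> Hom A X Y"
    have "f \<in> Arr A"
      using f by (simp add: Hom_iff)
    then show "NCmp (precomp2_nat A P \<theta>) Y \<cdot>\<^bsub>D\<^esub> FAr (NDom (precomp2_nat A P \<theta>)) f =
        FAr (NCod (precomp2_nat A P \<theta>)) f \<cdot>\<^bsub>D\<^esub> NCmp (precomp2_nat A P \<theta>) X"
      using t(5)[OF P.ar_hom[OF f]] A.hom_obj[OF f] by simp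
  qed (use t(4) P.ob_obj c[THEN is_functor2.axioms(1)] in auto)
  moreover have "HCmp D (VIde D (NCmp (precomp2_nat A P \<theta>) Y)) (FCell (NDom (precomp2_nat A P \<theta>)) \<alpha>) =
      HCmp D (FCell (NCod (precomp2_nat A P \<theta>)) \<alpha>) (VIde D (NCmp (precomp2_nat A P \<theta>) X))"
    if f: "f \<in> Hom A X Y" and \<alpha>: "\<alpha> \<in> Cells A f g" for X Y f g \<alpha>
    using cell[OF P.ar_hom[OF f] P.cell_cells[OF \<alpha>]] \<alpha> A.hom_obj[OF f] by (simp add: Cells_def)
  ultimately show ?thesis
    using c unfolding is_nat_trans2_def precomp2_nat_simps by blast
qed

lemma disc_hom_simps [simp]:
  "is_functor A X F \<Longrightarrow> FOb (disc_hom A X) F = disc_func F"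
  "is_nat_trans A X \<theta> \<Longrightarrow> FAr (disc_hom A X) \<theta> = disc_nat \<theta>"
  by (simp_all add: disc_hom_def disc_nat_def)

lemma precomp2_simps [simp]:
  "is_functor2 B D G \<Longrightarrow> FOb (precomp2 A B P D) G = comp_func2 A G P"
  "is_nat_trans2 B D \<theta> \<Longrightarrow> FAr (precomp2 A B P D) \<theta> = precomp2_nat A P \<theta>"
  by (simp_all add: precomp2_def precomp2_nat_def functor_cat2_def)

section \<open>The category of connected components and functors out of it\<close>

context category2
begin

lemma arr_component_alt:
  assumes "f \<in> Hom B X Y"
  shows "arr_component B f =
    {g. (f, g) \<in> (\<Union>\<alpha>\<in>{\<alpha> \<in> Cell B. Src B \<alpha> \<in> Hom B X Y}. {(Src B \<alpha>, Tgt B \<alpha>), (Tgt B \<alpha>, Src B \<alpha>)})\<^sup>*}"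
  using assms by (simp add: arr_component_def component_def Hom_iff)

lemma arr_component_self: "f \<in> arr_component B f"
  by (simp add: arr_component_def component_def)

text \<open>The induction principle for components: what is constant along single 2-cells is
  constant along zigzags. Instances of \<phi> yield that members of a component are parallel, that
  composition descends, and that functors descend.\<close>

lemma arr_component_invariant:
  assumes f: "f \<in> Hom B X Y" and g: "g \<in> arr_component B f"
    and inv: "\<And>f g \<alpha>. f \<in> Hom B X Y \<Longrightarrow> \<alpha> \<in> Cells B f g \<Longrightarrow> \<phi> f = \<phi> g"
  shows "\<phi> g = \<phi> f"
proof -
  have \<phi>: "\<phi> (Src B \<alpha>) = \<phi> (Tgt B \<alpha>)" if "\<alpha> \<in> Cell B" "Src B \<alpha> \<in> Hom B X Y" for \<alpha>
    using that by (intro inv[of _ \<alpha>]) (auto simp: Cells_def)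
  show ?thesis
    using g unfolding arr_component_alt[OF f] mem_Collect_eq
    by (induction rule: rtrancl_induct) (auto simp: \<phi>)
qed

lemma arr_component_hom: "f \<in> Hom B X Y \<Longrightarrow> g \<in> arr_component B f \<Longrightarrow> g \<in> Hom B X Y"
  using arr_component_invariant[of f X Y g "\<lambda>h. h \<in> Hom B X Y"] cell_tgt by simp

lemma arr_component_cell:
  assumes f: "f \<in> Hom B X Y" and \<alpha>: "\<alpha> \<in> Cells B f g"
  shows "arr_component B f = arr_component B g"
proof -
  let ?R = "\<Union>\<alpha>\<in>{\<alpha> \<in> Cell B. Src B \<alpha> \<in> Hom B X Y}. {(Src B \<alpha>, Tgt B \<alpha>), (Tgt B \<alpha>, Src B \<alpha>)}"
  have "(f, g) \<in> ?R" "(g, f) \<in> ?R"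
    using f \<alpha> by (auto simp: Cells_def)
  then show ?thesis
    unfolding arr_component_alt[OF f] arr_component_alt[OF cell_tgt[OF f \<alpha>]]
    by (auto intro: converse_rtrancl_into_rtrancl)
qed

text \<open>Whiskering a 2-cell on either side is again a 2-cell, so each factor can be moved within
  its component while the other is held fixed.\<close>

lemma arr_component_cmp:
  assumes f: "f \<in> Hom B X Y" and g: "g \<in> Hom B Y Z"
    and f': "f' \<in> arr_component B f" and g': "g' \<in> arr_component B g"
  shows "arr_component B (g' \<cdot>\<^bsub>B\<^esub> f') = arr_component B (g \<cdot>\<^bsub>B\<^esub> f)"
proof -
  have "arr_component B (g' \<cdot>\<^bsub>B\<^esub> f') = arr_component B (g' \<cdot>\<^bsub>B\<^esub> f)"
  proof (rule arr_component_invariant[OF f f'])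
    fix h k \<alpha> assume "h \<in> Hom B X Y" "\<alpha> \<in> Cells B h k"
    then show "arr_component B (g' \<cdot>\<^bsub>B\<^esub> h) = arr_component B (g' \<cdot>\<^bsub>B\<^esub> k)"
      using arr_component_cell[OF cmp_hom wl_cells] arr_component_hom[OF g g'] by blast
  qed
  also have "\<dots> = arr_component B (g \<cdot>\<^bsub>B\<^esub> f)"
  proof (rule arr_component_invariant[OF g g'])
    fix h k \<alpha> assume "h \<in> Hom B Y Z" "\<alpha> \<in> Cells B h k"
    then show "arr_component B (h \<cdot>\<^bsub>B\<^esub> f) = arr_component B (k \<cdot>\<^bsub>B\<^esub> f)"
      using arr_component_cell[OF cmp_hom wr_cells] f by blast
  qed
  finally show ?thesis .
qed

lemma pi0_simps [simp]:
  "Obj (pi0 B) = Obj B" "Arr (pi0 B) = arr_component B ` Arr B"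
  "Ide (pi0 B) X = arr_component B (Ide B X)"
  by (simp_all add: pi0_def)

text \<open>The union that defines \<open>Cmp\<close> in \<open>pi0\<close> has nonempty index sets
  and, by \<open>arr_component_cmp\<close>, a constant family; it is therefore the common
  value.\<close>

lemma pi0_cmp:
  assumes f: "f \<in> Hom B X Y" and g: "g \<in> Hom B Y Z"
  shows "arr_component B g \<cdot>\<^bsub>pi0 B\<^esub> arr_component B f = arr_component B (g \<cdot>\<^bsub>B\<^esub> f)"
proof -
  have "(\<Union>g'\<in>arr_component B g. \<Union>f'\<in>arr_component B f. arr_component B (g' \<cdot>\<^bsub>B\<^esub> f')) =
      (\<Union>g'\<in>arr_component B g. \<Union>f'\<in>arr_component B f. arr_component B (g \<cdot>\<^bsub>B\<^esub> f))"
    by (intro SUP_cong refl arr_component_cmp[OF f g])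
  also have "\<dots> = arr_component B (g \<cdot>\<^bsub>B\<^esub> f)"
    using arr_component_self[of f] arr_component_self[of g] by auto
  finally show ?thesis
    by (simp add: pi0_def)
qed

lemma Hom_pi0: "K \<in> Hom (pi0 B) X Y \<longleftrightarrow> (\<exists>f\<in>Hom B X Y. K = arr_component B f)"
proof -
  \<comment> \<open>Members of a component are parallel, so the images to which \<open>pi0\<close>
    applies \<open>the_elem\<close> are singletons.\<close>
  have dc: "Dom (pi0 B) (arr_component B f) = Dom B f" "Cod (pi0 B) (arr_component B f) = Cod B f"
    if f: "f \<in> Arr B" for f
  proof -
    have "Dom B g = Dom B f" "Cod B g = Cod B f" if "g \<in> arr_component B f" for g
      using arr_component_hom[OF arr_hom[OF f] that] by (simp_all add: Hom_iff)
    then have "Dom B ` arr_component B f = (\<lambda>_. Dom B f) ` arr_component B f"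
      "Cod B ` arr_component B f = (\<lambda>_. Cod B f) ` arr_component B f"
      by (auto intro!: image_cong)
    then show "Dom (pi0 B) (arr_component B f) = Dom B f" "Cod (pi0 B) (arr_component B f) = Cod B f"
      by (simp_all add: pi0_def image_constant[OF arr_component_self])
  qed
  show ?thesis
  proof
    assume "K \<in> Hom (pi0 B) X Y"
    then obtain f where "f \<in> Arr B" "K = arr_component B f" "Dom (pi0 B) K = X" "Cod (pi0 B) K = Y"
      by (auto simp: Hom_iff)
    then show "\<exists>f\<in>Hom B X Y. K = arr_component B f"
      using dc[of f] by (intro bexI[of _ f]) (simp_all add: Hom_iff)
  next
    assume "\<exists>f\<in>Hom B X Y. K = arr_component B f"
    then show "K \<in> Hom (pi0 B) X Y"
      using dc by (auto simp: Hom_iff)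
  qed
qed

lemma category_pi0: "category (pi0 B)"
proof (rule category.intro)
  show "K \<in> Arr (pi0 B) \<Longrightarrow> Dom (pi0 B) K \<in> Obj (pi0 B)"
    and "K \<in> Arr (pi0 B) \<Longrightarrow> Cod (pi0 B) K \<in> Obj (pi0 B)" for K
    using Hom_pi0[of K "Dom (pi0 B) K" "Cod (pi0 B) K"] hom_obj by (auto simp: Hom_iff[of K])
  show "Ide (pi0 B) X \<in> Hom (pi0 B) X X" if "X \<in> Obj (pi0 B)" for X
    using that ide_hom by (auto simp: Hom_pi0)
  show "L \<cdot>\<^bsub>pi0 B\<^esub> K \<in> Hom (pi0 B) X Z" if "K \<in> Hom (pi0 B) X Y" "L \<in> Hom (pi0 B) Y Z" for K L X Y Z
    using that pi0_cmp cmp_hom unfolding Hom_pi0 by blast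
  show "Ide (pi0 B) Y \<cdot>\<^bsub>pi0 B\<^esub> K = K" "K \<cdot>\<^bsub>pi0 B\<^esub> Ide (pi0 B) X = K" if "K \<in> Hom (pi0 B) X Y" for K X Y
    using that pi0_cmp[OF _ ide_hom[OF hom_obj(2)]] pi0_cmp[OF ide_hom[OF hom_obj(1)]] ide_left ide_right
    unfolding Hom_pi0 by auto
  show "N \<cdot>\<^bsub>pi0 B\<^esub> (L \<cdot>\<^bsub>pi0 B\<^esub> K) = (N \<cdot>\<^bsub>pi0 B\<^esub> L) \<cdot>\<^bsub>pi0 B\<^esub> K"
    if K: "K \<in> Hom (pi0 B) X Y" and L: "L \<in> Hom (pi0 B) Y Z" and N: "N \<in> Hom (pi0 B) Z V" for K L N X Y Z V
  proof -
    obtain f g h where f: "f \<in> Hom B X Y" "K = arr_component B f"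
      and g: "g \<in> Hom B Y Z" "L = arr_component B g" and h: "h \<in> Hom B Z V" "N = arr_component B h"
      using K L N unfolding Hom_pi0 by blast
    show ?thesis
      by (simp add: f(2) g(2) h(2) pi0_cmp[OF f(1) g(1)] pi0_cmp[OF g(1) h(1)]
          pi0_cmp[OF cmp_hom[OF f(1) g(1)] h(1)] pi0_cmp[OF f(1) cmp_hom[OF g(1) h(1)]]
          cmp_assoc[OF f(1) g(1) h(1)])
  qed
qed

lemma pi0_func_simps [simp]:
  "X \<in> Obj B \<Longrightarrow> FOb (pi0_func B) X = X"
  "f \<in> Arr B \<Longrightarrow> FAr (pi0_func B) f = arr_component B f"
  "\<alpha> \<in> Cell B \<Longrightarrow> FCell (pi0_func B) \<alpha> = arr_component B (Src B \<alpha>)"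
  by (simp_all add: pi0_func_def)

lemma is_functor2_pi0_func: "is_functor2 B (disc (pi0 B)) (pi0_func B)"
proof (rule is_functor2I)
  have "is_functor B (pi0 B) (pi0_func B)"
  proof (rule is_functor.intro)
    fix f X Y assume f: "f \<in> Hom B X Y"
    then have "arr_component B f \<in> Hom (pi0 B) X Y"
      unfolding Hom_pi0 by blast
    then show "FAr (pi0_func B) f \<in> Hom (pi0 B) (FOb (pi0_func B) X) (FOb (pi0_func B) Y)"
      using hom_obj[OF f] f by (simp add: Hom_iff[of f])
    fix g Z assume g: "g \<in> Hom B Y Z"
    show "FAr (pi0_func B) (g \<cdot>\<^bsub>B\<^esub> f) = FAr (pi0_func B) g \<cdot>\<^bsub>pi0 B\<^esub> FAr (pi0_func B) f"
      using f g cmp_hom[OF f g] pi0_cmp[OF f g] by (simp add: Hom_iff)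
  next
    show "FAr (pi0_func B) (Ide B X) = Ide (pi0 B) (FOb (pi0_func B) X)" if "X \<in> Obj B" for X
      using ide_hom[OF that] that by (simp add: Hom_iff)
  qed (auto simp: category_pi0 category_axioms pi0_func_def)
  then show "is_functor B (disc (pi0 B)) (pi0_func B)"
    by simp
next
  fix \<alpha> f g assume \<alpha>: "\<alpha> \<in> Cells B f g"
  then have f: "f \<in> Hom B (Dom B f) (Cod B f)"
    using src_arr by (auto simp: Cells_def Hom_iff)
  show "FCell (pi0_func B) \<alpha> \<in> Cells (disc (pi0 B)) (FAr (pi0_func B) f) (FAr (pi0_func B) g)"
    using arr_component_cell[OF f \<alpha>] f cell_tgt[OF f \<alpha>] \<alpha> by (simp add: Cells_disc Hom_iff) (simp add: Cells_def)
  fix \<beta> h assume \<beta>: "\<beta> \<in> Cells B g h"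
  show "FCell (pi0_func B) (VCmp B \<beta> \<alpha>) =
      VCmp (disc (pi0 B)) (FCell (pi0_func B) \<beta>) (FCell (pi0_func B) \<alpha>)"
    using \<alpha> vcmp_cells[OF f \<alpha> \<beta>] by (simp add: Cells_def)
next
  fix f assume "f \<in> Arr B"
  then show "FCell (pi0_func B) (VIde B f) = VIde (disc (pi0 B)) (FAr (pi0_func B) f)"
    using vide_cells[OF arr_hom] by (simp add: Cells_def)
next
  fix \<alpha> \<beta> f g h k X Y Z
  assume a: "f \<in> Hom B X Y" "h \<in> Hom B Y Z" "\<alpha> \<in> Cells B f g" "\<beta> \<in> Cells B h k"
  show "FCell (pi0_func B) (HCmp B \<beta> \<alpha>) =
      HCmp (disc (pi0 B)) (FCell (pi0_func B) \<beta>) (FCell (pi0_func B) \<alpha>)"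
    using hcmp_cells[OF a] pi0_cmp[OF a(1,2)] a(3,4) by (simp add: Cells_def)
qed (auto simp: category2_axioms category2_disc category_pi0, auto simp: pi0_func_def)

text \<open>Evaluation at an arbitrary representative. The result is meaningful when
  \<open>F\<close> agrees on the ends of every 2-cell, a condition that the lemmas below carry as a
  premise.\<close>

definition pi0_lift :: "('o, 'm, 'p, 'n) func \<Rightarrow> ('o, 'm set, 'p, 'n) func" where
  "pi0_lift F = \<lparr>FOb = FOb F, FAr = (\<lambda>K\<in>Arr (pi0 B). FAr F (SOME f. f \<in> K))\<rparr>"

lemma FOb_pi0_lift [simp]: "FOb (pi0_lift F) = FOb F"
  by (simp add: pi0_lift_def)

lemma FAr_pi0_lift:
  assumes "f \<in> Hom B X Y" "\<And>f g \<alpha>. \<alpha> \<in> Cells B f g \<Longrightarrow> FAr F f = FAr F g"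
  shows "FAr (pi0_lift F) (arr_component B f) = FAr F f"
proof -
  have "(SOME g. g \<in> arr_component B f) \<in> arr_component B f"
    using arr_component_self by (rule someI[where P = "\<lambda>g. g \<in> arr_component B f"])
  then have "FAr F (SOME g. g \<in> arr_component B f) = FAr F f"
    by (rule arr_component_invariant[OF assms(1)]) (rule assms(2))
  then show ?thesis
    using assms(1) by (auto simp: pi0_lift_def Hom_iff)
qed

lemma is_functor_pi0_lift:
  assumes "is_functor B X F" and inv: "\<And>f g \<alpha>. \<alpha> \<in> Cells B f g \<Longrightarrow> FAr F f = FAr F g"
  shows "is_functor (pi0 B) X (pi0_lift F)"
proof -
  interpret F: is_functor B X F by fact
  note lift = FAr_pi0_lift[OF _ inv]
  show ?thesis
  proof (rule is_functor.intro)
    fix K Y Z assume K: "K \<in> Hom (pi0 B) Y Z"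
    then obtain f where f: "f \<in> Hom B Y Z" "K = arr_component B f"
      unfolding Hom_pi0 by blast
    show "FAr (pi0_lift F) K \<in> Hom X (FOb (pi0_lift F) Y) (FOb (pi0_lift F) Z)"
      using F.ar_hom[OF f(1)] f(2) by (simp add: lift[OF f(1)])
    fix L V assume "L \<in> Hom (pi0 B) Z V"
    then obtain g where g: "g \<in> Hom B Z V" "L = arr_component B g"
      unfolding Hom_pi0 by blast
    show "FAr (pi0_lift F) (L \<cdot>\<^bsub>pi0 B\<^esub> K) = FAr (pi0_lift F) L \<cdot>\<^bsub>X\<^esub> FAr (pi0_lift F) K"
      using F.ar_cmp[OF f(1) g(1)]
      by (simp add: f(2) g(2) pi0_cmp[OF f(1) g(1)] lift[OF f(1)] lift[OF g(1)] lift[OF cmp_hom[OF f(1) g(1)]])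
  next
    show "FAr (pi0_lift F) (Ide (pi0 B) Y) = Ide X (FOb (pi0_lift F) Y)" if "Y \<in> Obj (pi0 B)" for Y
      using that by (simp add: lift[OF ide_hom] F.ar_ide)
  qed (use F.ob_ext F.ob_obj F.cod_category category_pi0 in \<open>auto simp: pi0_lift_def\<close>)
qed

text \<open>The components can stay the same because \<open>pi0\<close> has the objects of
  \<open>B\<close>, and each of its arrows has a representative at which naturality is already
  known.\<close>

lemma is_nat_trans_pi0_lift:
  assumes \<theta>: "is_nat_trans B X \<theta>"
    and inv: "\<And>f g \<alpha>. \<alpha> \<in> Cells B f g \<Longrightarrow> FAr (NDom \<theta>) f = FAr (NDom \<theta>) g"
      "\<And>f g \<alpha>. \<alpha> \<in> Cells B f g \<Longrightarrow> FAr (NCod \<theta>) f = FAr (NCod \<theta>) g"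
  shows "is_nat_trans (pi0 B) X \<lparr>NDom = pi0_lift (NDom \<theta>), NCod = pi0_lift (NCod \<theta>), NCmp = NCmp \<theta>\<rparr>"
proof (rule is_nat_transI, goal_cases)
  case (5 K Y Z)
  then obtain f where f: "f \<in> Hom B Y Z" "K = arr_component B f"
    unfolding Hom_pi0 by blast
  then show ?case
    using is_nat_transD(5)[OF \<theta> f(1)]
    by (simp add: FAr_pi0_lift[OF f(1) inv(1)] FAr_pi0_lift[OF f(1) inv(2)])
qed (use is_nat_transD[OF \<theta>] is_functor_pi0_lift[OF _ inv(1)] is_functor_pi0_lift[OF _ inv(2)] in auto)

end

section \<open>The homotopy 2-category\<close>

lemma is_homotopyE:
  assumes "is_homotopy A \<Sigma> f g H"
  obtains X Y where "f \<in> Hom A X Y" "g \<in> Hom A X Y" "is_cylinder A \<Sigma> X (fst H)"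
    "snd H \<in> Hom A (cylW (fst H)) Y"
    "snd H \<cdot>\<^bsub>A\<^esub> cyl_d0 (fst H) = f" "snd H \<cdot>\<^bsub>A\<^esub> cyl_d1 (fst H) = g"
  using assms unfolding is_homotopy_def by blast

lemma is_cylinderD:
  assumes "is_cylinder A \<Sigma> X K"
  shows "cyl_d0 K \<in> Hom A X (cylW K)" "cyl_d1 K \<in> Hom A X (cylW K)"
    "cyl_s K \<in> Hom A (cylW K) (cylZ K)" "cyl_x K \<in> Hom A X (cylZ K)" "cyl_s K \<in> \<Sigma>"
    "cyl_s K \<cdot>\<^bsub>A\<^esub> cyl_d0 K = cyl_x K" "cyl_s K \<cdot>\<^bsub>A\<^esub> cyl_d1 K = cyl_x K"
  using assms by (auto simp: is_cylinder_def)

text \<open>One of the pairs \<open>(D, F)\<close> against which equivalence of homotopy sequences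
  is tested. Identities between the resulting 2-cells of \<open>D\<close> are proved here for a
  fixed pair and reach \<open>Ho\<close> through \<open>homotopy_cell_eqI\<close>.\<close>

locale localizing = category A
  for A :: "('o, 'm, 'z) cat_scheme" (structure) +
  fixes \<Sigma> :: "'m set" and D :: "('d0, 'd1, 'd2) cat2" and F :: "('o, 'm, 'm, 'd0, 'd1, 'd2) func2"
  assumes functor2: "is_functor2 (disc A) D F"
    and equivalence: "s \<in> \<Sigma> \<Longrightarrow> is_equivalence D (FAr F s)"
begin

sublocale D: category2 D
  using functor2 by (rule is_functor2.cod_category2)

lemma F_functor: "is_functor A D F"
  using is_functor2.axioms(1)[OF functor2] by simp

lemmas F_hom = is_functor.ar_hom[OF F_functor] and F_cmp = is_functor.ar_cmp[OF F_functor]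

text \<open>Both \<open>F d0\<close> and \<open>F d1\<close> become \<open>F x\<close> after
  \<open>F s\<close>, so the identity cell of \<open>F x\<close> joins the two composites, and
  whiskering with the equivalence \<open>F s\<close> is bijective.\<close>

lemma hat_cyl_ex1:
  assumes "is_cylinder A \<Sigma> X K"
  shows "\<exists>!\<alpha>. \<alpha> \<in> Cells D (FAr F (cyl_d0 K)) (FAr F (cyl_d1 K)) \<and>
    HCmp D (VIde D (FAr F (cyl_s K))) \<alpha> = VIde D (FAr F (cyl_x K))"
proof -
  have K: "cyl_d0 K \<in> Hom A X (cylW K)" "cyl_d1 K \<in> Hom A X (cylW K)"
    "cyl_s K \<in> Hom A (cylW K) (cylZ K)" "cyl_x K \<in> Hom A X (cylZ K)" "cyl_s K \<in> \<Sigma>"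
    "cyl_s K \<cdot> cyl_d0 K = cyl_x K" "cyl_s K \<cdot> cyl_d1 K = cyl_x K"
    using assms by (auto simp: is_cylinder_def)
  show ?thesis
    using D.vide_cells[OF F_hom[OF K(4)]] F_cmp[OF K(1,3)] F_cmp[OF K(2,3)] K(6,7)
    by (intro D.equivalence_whisker_bij[OF F_hom[OF K(3)] equivalence[OF K(5)] F_hom[OF K(1)] F_hom[OF K(2)]])
      simp
qed

lemma hat_cyl:
  assumes "is_cylinder A \<Sigma> X K"
  shows "hat_cyl D F K \<in> Cells D (FAr F (cyl_d0 K)) (FAr F (cyl_d1 K))"
    "HCmp D (VIde D (FAr F (cyl_s K))) (hat_cyl D F K) = VIde D (FAr F (cyl_x K))"
  using theI'[OF hat_cyl_ex1[OF assms]] by (simp_all add: hat_cyl_def)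

lemma hat_cyl_eqI:
  assumes "is_cylinder A \<Sigma> X K" "\<alpha> \<in> Cells D (FAr F (cyl_d0 K)) (FAr F (cyl_d1 K))"
    "HCmp D (VIde D (FAr F (cyl_s K))) \<alpha> = VIde D (FAr F (cyl_x K))"
  shows "hat_cyl D F K = \<alpha>"
  unfolding hat_cyl_def using assms(2,3) by (intro the1_equality[OF hat_cyl_ex1[OF assms(1)]]) simp

lemma hat_homotopy_cells:
  assumes "is_homotopy A \<Sigma> f g H"
  shows "hat_homotopy D F H \<in> Cells D (FAr F f) (FAr F g)"
proof -
  obtain X Y where H: "is_cylinder A \<Sigma> X (fst H)" "snd H \<in> Hom A (cylW (fst H)) Y"
    "snd H \<cdot> cyl_d0 (fst H) = f" "snd H \<cdot> cyl_d1 (fst H) = g"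
    using assms unfolding is_homotopy_def by blast
  have d: "cyl_d0 (fst H) \<in> Hom A X (cylW (fst H))" "cyl_d1 (fst H) \<in> Hom A X (cylW (fst H))"
    using H(1) by (auto simp: is_cylinder_def)
  show ?thesis
    using D.wl_cells[OF F_hom[OF d(1)] F_hom[OF H(2)] hat_cyl(1)[OF H(1)]]
    by (simp add: hat_homotopy_def F_cmp[OF d(1) H(2), symmetric] F_cmp[OF d(2) H(2), symmetric] H(3,4))
qed

end

section \<open>Sequences of homotopies and their whiskering\<close>

lemma homotopy_seq_hom:
  "f \<in> Hom A X Y \<Longrightarrow> is_homotopy_seq A \<Sigma> f g Hs \<Longrightarrow> g \<in> Hom A X Y"
proof (induction Hs arbitrary: g)
  case (Cons H Hs)
  then obtain k where "k \<in> Hom A X Y" "is_homotopy A \<Sigma> k g H"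
    by auto
  then show ?case
    by (auto elim!: is_homotopyE simp: Hom_iff)
qed simp

lemma homotopy_seq_arr: "is_homotopy_seq A \<Sigma> f g Hs \<Longrightarrow> f \<in> Arr A"
  by (induction Hs arbitrary: g) auto

lemma homotopy_seq_append:
  "is_homotopy_seq A \<Sigma> f g Hs \<Longrightarrow> is_homotopy_seq A \<Sigma> g k Ks \<Longrightarrow> is_homotopy_seq A \<Sigma> f k (Ks @ Hs)"
  by (induction Ks arbitrary: k) auto

context category
begin

lemma homotopy_whisker_left:
  assumes f: "f \<in> Hom C X Y" and r: "r \<in> Hom C Y Z" and H: "is_homotopy C \<Sigma> f g H"
  shows "is_homotopy C \<Sigma> (r \<cdot> f) (r \<cdot> g) (whisker_left C r H)"
proof -
  obtain X' Y' where H: "f \<in> Hom C X' Y'" "g \<in> Hom C X' Y'" "is_cylinder C \<Sigma> X' (fst H)"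
    "snd H \<in> Hom C (cylW (fst H)) Y'" "snd H \<cdot> cyl_d0 (fst H) = f" "snd H \<cdot> cyl_d1 (fst H) = g"
    using H by (rule is_homotopyE)
  have [simp]: "X' = X" "Y' = Y"
    using f H(1) by (auto simp: Hom_iff)
  note d = is_cylinderD[OF H(3)]
  show ?thesis
    unfolding is_homotopy_def whisker_left_def
    using H r cmp_hom[OF f r] cmp_hom[OF H(2), of r Z] cmp_hom[OF H(4), of r Z]
      cmp_assoc[OF d(1) H(4), of r Z] cmp_assoc[OF d(2) H(4), of r Z]
    by (intro exI[of _ X] exI[of _ Z]) simp
qed

lemma cylinder_whisker_right:
  assumes l: "l \<in> Hom C V X" and K: "is_cylinder C \<Sigma> X (fst H)"
  shows "is_cylinder C \<Sigma> V (fst (whisker_right C H l))"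
  using is_cylinderD[OF K] cmp_hom[OF l] cmp_assoc[OF l]
  by (simp add: whisker_right_def is_cylinder_def)

lemma homotopy_whisker_right:
  assumes l: "l \<in> Hom C V X" and f: "f \<in> Hom C X Y" and H: "is_homotopy C \<Sigma> f g H"
  shows "is_homotopy C \<Sigma> (f \<cdot> l) (g \<cdot> l) (whisker_right C H l)"
proof -
  obtain X' Y' where H: "f \<in> Hom C X' Y'" "g \<in> Hom C X' Y'" "is_cylinder C \<Sigma> X' (fst H)"
    "snd H \<in> Hom C (cylW (fst H)) Y'" "snd H \<cdot> cyl_d0 (fst H) = f" "snd H \<cdot> cyl_d1 (fst H) = g"
    using H by (rule is_homotopyE)
  have [simp]: "X' = X" "Y' = Y"
    using f H(1) by (auto simp: Hom_iff)
  note d = is_cylinderD[OF H(3)]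
  note c = cylinder_whisker_right[OF l, of \<Sigma> H]
  show ?thesis
    unfolding is_homotopy_def
    using H c cmp_hom[OF l f] cmp_hom[OF l, of g Y]
      cmp_assoc[OF l, of _ "cylW (fst H)" "snd H" Y] d
    by (intro exI[of _ V] exI[of _ Y]) (simp add: whisker_right_def)
qed

lemma homotopy_seq_whisker_left:
  assumes f: "f \<in> Hom C X Y" and r: "r \<in> Hom C Y Z"
  shows "is_homotopy_seq C \<Sigma> f g Hs \<Longrightarrow>
    is_homotopy_seq C \<Sigma> (r \<cdot> f) (r \<cdot> g) (map (whisker_left C r) Hs)"
proof (induction Hs arbitrary: g)
  case Nil
  then show ?case
    using cmp_hom[OF f r] by (simp add: Hom_iff)
next
  case (Cons H Hs)
  then obtain k where k: "is_homotopy_seq C \<Sigma> f k Hs" "is_homotopy C \<Sigma> k g H"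
    by auto
  then show ?case
    using Cons.IH[OF k(1)] homotopy_whisker_left[OF homotopy_seq_hom[OF f k(1)] r k(2)] by auto
qed

lemma homotopy_seq_whisker_right:
  assumes l: "l \<in> Hom C V X" and f: "f \<in> Hom C X Y"
  shows "is_homotopy_seq C \<Sigma> f g Hs \<Longrightarrow>
    is_homotopy_seq C \<Sigma> (f \<cdot> l) (g \<cdot> l) (map (\<lambda>H. whisker_right C H l) Hs)"
proof (induction Hs arbitrary: g)
  case Nil
  then show ?case
    using cmp_hom[OF l f] by (simp add: Hom_iff)
next
  case (Cons H Hs)
  then obtain k where k: "is_homotopy_seq C \<Sigma> f k Hs" "is_homotopy C \<Sigma> k g H"
    by auto
  then show ?case
    using Cons.IH[OF k(1)] homotopy_whisker_right[OF l homotopy_seq_hom[OF f k(1)] k(2)] by auto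
qed

text \<open>The head of a list is the last homotopy, so this sequence passes from \<open>h f\<close>
  to \<open>h g\<close> by \<open>Hs\<close> whiskered with \<open>h\<close>, and then to
  \<open>k g\<close> by \<open>Ks\<close> whiskered with \<open>g\<close>.\<close>

lemma homotopy_seq_hcmp:
  assumes f: "f \<in> Hom C X Y" and h: "h \<in> Hom C Y Z"
    and Hs: "is_homotopy_seq C \<Sigma> f g Hs" and Ks: "is_homotopy_seq C \<Sigma> h k Ks"
  shows "is_homotopy_seq C \<Sigma> (h \<cdot> f) (k \<cdot> g)
    (map (\<lambda>K. whisker_right C K g) Ks @ map (whisker_left C h) Hs)"
  by (rule homotopy_seq_append[OF homotopy_seq_whisker_left[OF f h Hs]
        homotopy_seq_whisker_right[OF homotopy_seq_hom[OF f Hs] h Ks]])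

end

section \<open>Compatibility of the test 2-cells with concatenation and whiskering\<close>

context localizing
begin

lemma hat_seq_cells:
  assumes f: "f \<in> Hom A X Y"
  shows "is_homotopy_seq A \<Sigma> f g Hs \<Longrightarrow> hat_seq D F f Hs \<in> Cells D (FAr F f) (FAr F g)"
proof (induction Hs arbitrary: g)
  case Nil
  then show ?case
    using D.vide_cells[OF F_hom[OF f]] by simp
next
  case (Cons H Hs)
  then obtain k where k: "is_homotopy_seq A \<Sigma> f k Hs" "is_homotopy A \<Sigma> k g H"
    by auto
  then show ?case
    using D.vcmp_cells[OF F_hom[OF f] Cons.IH[OF k(1)] hat_homotopy_cells[OF k(2)]] by simp
qed

lemma hat_seq_append:
  assumes f: "f \<in> Hom A X Y" and Hs: "is_homotopy_seq A \<Sigma> f g Hs"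
  shows "is_homotopy_seq A \<Sigma> g k Ks \<Longrightarrow>
    hat_seq D F f (Ks @ Hs) = VCmp D (hat_seq D F g Ks) (hat_seq D F f Hs)"
proof (induction Ks arbitrary: k)
  case Nil
  then show ?case
    using D.vcmp_ide_left[OF F_hom[OF f] hat_seq_cells[OF f Hs]] by simp
next
  case (Cons K Ks)
  then obtain l where l: "is_homotopy_seq A \<Sigma> g l Ks" "is_homotopy A \<Sigma> l k K"
    by auto
  show ?case
    using Cons.IH[OF l(1)] D.vcmp_assoc[OF F_hom[OF f] hat_seq_cells[OF f Hs]
        hat_seq_cells[OF homotopy_seq_hom[OF f Hs] l(1)] hat_homotopy_cells[OF l(2)]]
    by simp
qed

text \<open>The cylinder is unchanged and only \<open>h\<close> becomes \<open>r h\<close>, so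
  associativity of horizontal composition suffices.\<close>

lemma hat_whisker_left:
  assumes f: "f \<in> Hom A X Y" and r: "r \<in> Hom A Y Z" and H: "is_homotopy A \<Sigma> f g H"
  shows "hat_homotopy D F (whisker_left A r H) = HCmp D (VIde D (FAr F r)) (hat_homotopy D F H)"
proof -
  obtain X' Y' where H: "f \<in> Hom A X' Y'" "is_cylinder A \<Sigma> X' (fst H)" "snd H \<in> Hom A (cylW (fst H)) Y'"
    using H by (rule is_homotopyE)
  have [simp]: "X' = X" "Y' = Y"
    using f H(1) by (auto simp: Hom_iff)
  note s = F_hom[OF is_cylinderD(1)[OF H(2)]] F_hom[OF H(3)[simplified]] F_hom[OF r]
  show ?thesis
    using D.hcmp_assoc[OF s hat_cyl(1)[OF H(2)] D.vide_cells[OF s(2)] D.vide_cells[OF s(3)]]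
      D.hcmp_vide[OF s(2,3)] F_cmp[OF H(3)[simplified] r]
    by (simp add: hat_homotopy_def whisker_left_def)
qed

text \<open>Here the cylinder changes. The cell of the old cylinder whiskered with
  \<open>F l\<close> satisfies the equation that determines the cell of the new one, so uniqueness
  identifies the two.\<close>

lemma hat_whisker_right:
  assumes l: "l \<in> Hom A V X" and f: "f \<in> Hom A X Y" and H: "is_homotopy A \<Sigma> f g H"
  shows "hat_homotopy D F (whisker_right A H l) = HCmp D (hat_homotopy D F H) (VIde D (FAr F l))"
proof -
  obtain X' Y' where H: "f \<in> Hom A X' Y'" "is_cylinder A \<Sigma> X' (fst H)" "snd H \<in> Hom A (cylW (fst H)) Y'"
    using H by (rule is_homotopyE)
  have [simp]: "X' = X" "Y' = Y"
    using f H(1) by (auto simp: Hom_iff)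
  let ?K = "fst H"
  note c = H(2)[simplified]
  note d = is_cylinderD[OF c]
  note Fl = F_hom[OF l] and Fd = F_hom[OF d(1)] and Fs = F_hom[OF d(3)] and Fh = F_hom[OF H(3)[simplified]]
  have "hat_cyl D F (fst (whisker_right A H l)) = HCmp D (hat_cyl D F ?K) (VIde D (FAr F l))"
  proof (rule hat_cyl_eqI[OF cylinder_whisker_right[OF l c]])
    show "HCmp D (hat_cyl D F ?K) (VIde D (FAr F l)) \<in>
      Cells D (FAr F (cyl_d0 (fst (whisker_right A H l)))) (FAr F (cyl_d1 (fst (whisker_right A H l))))"
      using D.wr_cells[OF Fl Fd hat_cyl(1)[OF c]] F_cmp[OF l d(1)] F_cmp[OF l d(2)]
      by (simp add: whisker_right_def)
    show "HCmp D (VIde D (FAr F (cyl_s (fst (whisker_right A H l)))))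
        (HCmp D (hat_cyl D F ?K) (VIde D (FAr F l))) =
      VIde D (FAr F (cyl_x (fst (whisker_right A H l))))"
      using D.hcmp_assoc[OF Fl Fd Fs D.vide_cells[OF Fl] hat_cyl(1)[OF c] D.vide_cells[OF Fs]]
        hat_cyl(2)[OF c] D.hcmp_vide[OF Fl F_hom[OF d(4)]] F_cmp[OF l d(4)]
      by (simp add: whisker_right_def)
  qed
  moreover have "snd (whisker_right A H l) = snd H"
    by (simp add: whisker_right_def)
  ultimately show ?thesis
    using D.hcmp_assoc[OF Fl Fd Fh D.vide_cells[OF Fl] hat_cyl(1)[OF c] D.vide_cells[OF Fh]]
    by (simp add: hat_homotopy_def)
qed

lemma hat_seq_whisker_left:
  assumes f: "f \<in> Hom A X Y" and r: "r \<in> Hom A Y Z"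
  shows "is_homotopy_seq A \<Sigma> f g Hs \<Longrightarrow>
    hat_seq D F (r \<cdot> f) (map (whisker_left A r) Hs) = HCmp D (VIde D (FAr F r)) (hat_seq D F f Hs)"
proof (induction Hs arbitrary: g)
  case Nil
  then show ?case
    using D.hcmp_vide[OF F_hom[OF f] F_hom[OF r]] F_cmp[OF f r] by simp
next
  case (Cons H Hs)
  then obtain k where k: "is_homotopy_seq A \<Sigma> f k Hs" "is_homotopy A \<Sigma> k g H"
    by auto
  show ?case
    using Cons.IH[OF k(1)] hat_whisker_left[OF homotopy_seq_hom[OF f k(1)] r k(2)]
      D.wl_vcmp[OF F_hom[OF f] F_hom[OF r] hat_seq_cells[OF f k(1)] hat_homotopy_cells[OF k(2)]]
    by simp
qed

lemma hat_seq_whisker_right: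
  assumes l: "l \<in> Hom A V X" and f: "f \<in> Hom A X Y"
  shows "is_homotopy_seq A \<Sigma> f g Hs \<Longrightarrow>
    hat_seq D F (f \<cdot> l) (map (\<lambda>H. whisker_right A H l) Hs) = HCmp D (hat_seq D F f Hs) (VIde D (FAr F l))"
proof (induction Hs arbitrary: g)
  case Nil
  then show ?case
    using D.hcmp_vide[OF F_hom[OF l] F_hom[OF f]] F_cmp[OF l f] by simp
next
  case (Cons H Hs)
  then obtain k where k: "is_homotopy_seq A \<Sigma> f k Hs" "is_homotopy A \<Sigma> k g H"
    by auto
  show ?case
    using Cons.IH[OF k(1)] hat_whisker_right[OF l homotopy_seq_hom[OF f k(1)] k(2)]
      D.wr_vcmp[OF F_hom[OF l] F_hom[OF f] hat_seq_cells[OF f k(1)] hat_homotopy_cells[OF k(2)]]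
    by simp
qed

text \<open>The list follows the first decomposition in \<open>hcmp_decomp\<close>, so its image is
  the horizontal composite in \<open>D\<close>.\<close>

lemma hat_seq_hcmp:
  assumes f: "f \<in> Hom A X Y" and h: "h \<in> Hom A Y Z"
    and Hs: "is_homotopy_seq A \<Sigma> f g Hs" and Ks: "is_homotopy_seq A \<Sigma> h k Ks"
  shows "hat_seq D F (h \<cdot> f) (map (\<lambda>K. whisker_right A K g) Ks @ map (whisker_left A h) Hs) =
    HCmp D (hat_seq D F h Ks) (hat_seq D F f Hs)"
proof -
  note g = homotopy_seq_hom[OF f Hs]
  show ?thesis
    using hat_seq_append[OF cmp_hom[OF f h] homotopy_seq_whisker_left[OF f h Hs]
        homotopy_seq_whisker_right[OF g h Ks]]
      hat_seq_whisker_left[OF f h Hs] hat_seq_whisker_right[OF g h Ks]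
      D.hcmp_decomp(1)[OF F_hom[OF f] F_hom[OF h] hat_seq_cells[OF f Hs] hat_seq_cells[OF h Ks]]
    by simp
qed

end

section \<open>The 2-cells of \<open>Ho\<close> and the 2-category laws\<close>

context
  fixes U :: "('d0 \<times> 'd1 \<times> 'd2) itself" and A :: "('o, 'm, 'z) cat_scheme" and \<Sigma> :: "'m set"
begin

abbreviation homotopy_cell :: "'m \<Rightarrow> 'm \<Rightarrow> ('o, 'm) homotopy list \<Rightarrow> ('o, 'm) homotopy_cell" where
  "homotopy_cell f g Hs \<equiv> (f, g, homotopy_class U A \<Sigma> f g Hs)"

text \<open>The transfer principle from test 2-categories to \<open>Ho\<close>: equivalence of
  sequences is by definition agreement under all tests, so agreement of representatives makes the
  classes equal.\<close>

lemma homotopy_cell_eqI: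
  assumes "is_homotopy_seq A \<Sigma> f g Hs" "is_homotopy_seq A \<Sigma> f g Ks" "category A"
    and "\<And>(D :: ('d0, 'd1, 'd2) cat2) F. localizing A \<Sigma> D F \<Longrightarrow> hat_seq D F f Hs = hat_seq D F f Ks"
  shows "homotopy_cell f g Hs = homotopy_cell f g Ks"
  using assms
  by (auto simp: homotopy_class_def homotopy_seq_equiv_def localizing_def localizing_axioms_def)

lemma homotopy_class_self: "is_homotopy_seq A \<Sigma> f g Hs \<Longrightarrow> Hs \<in> homotopy_class U A \<Sigma> f g Hs"
  by (simp add: homotopy_class_def homotopy_seq_equiv_def)

lemma homotopy_classD:
  assumes "Ks \<in> homotopy_class U A \<Sigma> f g Hs"
  shows "is_homotopy_seq A \<Sigma> f g Hs" "is_homotopy_seq A \<Sigma> f g Ks"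
    "localizing A \<Sigma> (D :: ('d0, 'd1, 'd2) cat2) F \<Longrightarrow> hat_seq D F f Ks = hat_seq D F f Hs"
  using assms by (simp_all add: homotopy_class_def homotopy_seq_equiv_def localizing_def localizing_axioms_def)

text \<open>Keeps the unions in \<open>VCmp\<close> and \<open>HCmp\<close> from being
  empty.\<close>

lemma homotopy_class_ne: "is_homotopy_seq A \<Sigma> f g Hs \<Longrightarrow> homotopy_class U A \<Sigma> f g Hs \<noteq> {}"
  using homotopy_class_self by blast

lemma Ho_simps [simp]:
  "Obj (Ho U A \<Sigma>) = Obj A" "Arr (Ho U A \<Sigma>) = Arr A" "Dom (Ho U A \<Sigma>) = Dom A"
  "Cod (Ho U A \<Sigma>) = Cod A" "Ide (Ho U A \<Sigma>) = Ide A" "Cmp (Ho U A \<Sigma>) = Cmp A"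
  "Src (Ho U A \<Sigma>) (f, g, S) = f" "Tgt (Ho U A \<Sigma>) (f, g, S) = g"
  "VIde (Ho U A \<Sigma>) f = homotopy_cell f f []"
  by (simp_all add: Ho_def)

lemma Hom_Ho [simp]: "Hom (Ho U A \<Sigma>) X Y = Hom A X Y"
  by (simp add: Hom_def)

lemma Cells_Ho:
  "\<alpha> \<in> Cells (Ho U A \<Sigma>) f g \<longleftrightarrow> (\<exists>Hs. is_homotopy_seq A \<Sigma> f g Hs \<and> \<alpha> = homotopy_cell f g Hs)"
  by (auto simp: Cells_def Ho_def)

context
  assumes A: "category A"
begin

interpretation category A by (fact A)

text \<open>The image of \<open>Ks @ Hs\<close> is the composite of the images of \<open>Ks\<close>
  and \<open>Hs\<close>, so its class depends only on their classes. The union in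
  \<open>VCmp\<close> thus repeats a single set.\<close>

lemma Ho_vcmp:
  assumes f: "f \<in> Hom A X Y" and Hs: "is_homotopy_seq A \<Sigma> f g Hs" and Ks: "is_homotopy_seq A \<Sigma> g k Ks"
  shows "VCmp (Ho U A \<Sigma>) (homotopy_cell g k Ks) (homotopy_cell f g Hs) = homotopy_cell f k (Ks @ Hs)"
proof -
  have "homotopy_cell f k (Ks' @ Hs') = homotopy_cell f k (Ks @ Hs)"
    if "Ks' \<in> homotopy_class U A \<Sigma> g k Ks" "Hs' \<in> homotopy_class U A \<Sigma> f g Hs" for Ks' Hs'
    using homotopy_classD[OF that(1)] homotopy_classD[OF that(2)]
    by (intro homotopy_cell_eqI homotopy_seq_append A) (auto simp: localizing.hat_seq_append[OF _ f])
  then show ?thesis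
    by (simp add: Ho_def homotopy_class_ne[OF Ks] homotopy_class_ne[OF Hs])
qed

lemma Ho_hcmp:
  assumes f: "f \<in> Hom A X Y" and h: "h \<in> Hom A Y Z"
    and Hs: "is_homotopy_seq A \<Sigma> f g Hs" and Ks: "is_homotopy_seq A \<Sigma> h k Ks"
  shows "HCmp (Ho U A \<Sigma>) (homotopy_cell h k Ks) (homotopy_cell f g Hs) =
    homotopy_cell (h \<cdot>\<^bsub>A\<^esub> f) (k \<cdot>\<^bsub>A\<^esub> g)
      (map (\<lambda>K. whisker_right A K g) Ks @ map (whisker_left A h) Hs)"
proof -
  have "homotopy_cell (h \<cdot>\<^bsub>A\<^esub> f) (k \<cdot>\<^bsub>A\<^esub> g) (map (\<lambda>K. whisker_right A K g) Ks' @ map (whisker_left A h) Hs') =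
      homotopy_cell (h \<cdot>\<^bsub>A\<^esub> f) (k \<cdot>\<^bsub>A\<^esub> g) (map (\<lambda>K. whisker_right A K g) Ks @ map (whisker_left A h) Hs)"
    if "Ks' \<in> homotopy_class U A \<Sigma> h k Ks" "Hs' \<in> homotopy_class U A \<Sigma> f g Hs" for Ks' Hs'
    using homotopy_classD[OF that(1)] homotopy_classD[OF that(2)]
    by (intro homotopy_cell_eqI homotopy_seq_hcmp[OF f h] A) (simp_all add: localizing.hat_seq_hcmp[OF _ f h])
  then show ?thesis
    by (simp add: Ho_def homotopy_class_ne[OF Ks] homotopy_class_ne[OF Hs])
qed

lemma Ho_vide_cells: "f \<in> Hom A X Y \<Longrightarrow> VIde (Ho U A \<Sigma>) f \<in> Cells (Ho U A \<Sigma>) f f"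
  unfolding Cells_Ho by (intro exI[of _ "[]"]) (simp add: Hom_iff)

text \<open>After \<open>Ho_vcmp\<close> the vertical laws are those of list concatenation with unit
  \<open>[]\<close>, valid already for representatives.\<close>

lemma category_hom_cat_Ho: "category (hom_cat (Ho U A \<Sigma>) X Y)"
proof (rule category.intro, unfold Hom_hom_cat hom_cat_simps Hom_Ho)
  fix \<alpha> assume "\<alpha> \<in> {\<alpha> \<in> Cell (Ho U A \<Sigma>). Src (Ho U A \<Sigma>) \<alpha> \<in> Hom A X Y}"
  then have "\<alpha> \<in> Cells (Ho U A \<Sigma>) (Src (Ho U A \<Sigma>) \<alpha>) (Tgt (Ho U A \<Sigma>) \<alpha>)"
    and src: "Src (Ho U A \<Sigma>) \<alpha> \<in> Hom A X Y"
    by (simp_all add: Cells_def)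
  then show "Src (Ho U A \<Sigma>) \<alpha> \<in> Hom A X Y" "Tgt (Ho U A \<Sigma>) \<alpha> \<in> Hom A X Y"
    using homotopy_seq_hom[OF src] unfolding Cells_Ho by blast+
next
  show "f \<in> Hom A X Y \<and> VIde (Ho U A \<Sigma>) f \<in> Cells (Ho U A \<Sigma>) f f" if "f \<in> Hom A X Y" for f
    using that Ho_vide_cells by blast
next
  fix f g \<alpha> assume "f \<in> Hom A X Y \<and> \<alpha> \<in> Cells (Ho U A \<Sigma>) f g"
  then obtain Hs where f: "f \<in> Hom A X Y" and Hs: "is_homotopy_seq A \<Sigma> f g Hs" "\<alpha> = homotopy_cell f g Hs"
    unfolding Cells_Ho by blast
  note g = homotopy_seq_hom[OF f Hs(1)]
  show "VCmp (Ho U A \<Sigma>) (VIde (Ho U A \<Sigma>) g) \<alpha> = \<alpha>"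
    using Ho_vcmp[OF f Hs(1), of g "[]"] g by (simp add: Hs(2) Hom_iff)
  show "VCmp (Ho U A \<Sigma>) \<alpha> (VIde (Ho U A \<Sigma>) f) = \<alpha>"
    using Ho_vcmp[OF f, of f "[]" g Hs] f by (simp add: Hs Hom_iff)
  fix h \<beta> assume "g \<in> Hom A X Y \<and> \<beta> \<in> Cells (Ho U A \<Sigma>) g h"
  then obtain Ks where Ks: "is_homotopy_seq A \<Sigma> g h Ks" "\<beta> = homotopy_cell g h Ks"
    unfolding Cells_Ho by blast
  show "f \<in> Hom A X Y \<and> VCmp (Ho U A \<Sigma>) \<beta> \<alpha> \<in> Cells (Ho U A \<Sigma>) f h"
    unfolding Cells_Ho Ks(2) Hs(2) Ho_vcmp[OF f Hs(1) Ks(1)]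
    using f homotopy_seq_append[OF Hs(1) Ks(1)] by blast
  fix k \<gamma> assume "h \<in> Hom A X Y \<and> \<gamma> \<in> Cells (Ho U A \<Sigma>) h k"
  then obtain Ls where Ls: "is_homotopy_seq A \<Sigma> h k Ls" "\<gamma> = homotopy_cell h k Ls"
    unfolding Cells_Ho by blast
  show "VCmp (Ho U A \<Sigma>) \<gamma> (VCmp (Ho U A \<Sigma>) \<beta> \<alpha>) = VCmp (Ho U A \<Sigma>) (VCmp (Ho U A \<Sigma>) \<gamma> \<beta>) \<alpha>"
    unfolding Hs(2) Ks(2) Ls(2) Ho_vcmp[OF f Hs(1) Ks(1)] Ho_vcmp[OF g Ks(1) Ls(1)]
      Ho_vcmp[OF f homotopy_seq_append[OF Hs(1) Ks(1)] Ls(1)]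
      Ho_vcmp[OF f Hs(1) homotopy_seq_append[OF Ks(1) Ls(1)]]
    by simp
qed

lemma category2_Ho: "category2 (Ho U A \<Sigma>)"
proof (rule category2.intro)
  show "category (Ho U A \<Sigma>)"
    using A by (simp add: category_def)
  show "category2_axioms (Ho U A \<Sigma>)"
  proof (rule category2_axioms.intro, unfold Hom_Ho Ho_simps(6) Cells_Ho Ho_simps(1-2))
    show "Src (Ho U A \<Sigma>) \<alpha> \<in> Arr A" if "\<alpha> \<in> Cell (Ho U A \<Sigma>)" for \<alpha>
      using that homotopy_seq_arr by (auto simp: Ho_def)
    show "category (hom_cat (Ho U A \<Sigma>) X Y)" for X Y
      by (rule category_hom_cat_Ho)
  next
    fix f g h k X Y Z \<alpha> \<beta>
    assume f: "f \<in> Hom A X Y" and h: "h \<in> Hom A Y Z"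
      and "\<exists>Hs. is_homotopy_seq A \<Sigma> f g Hs \<and> \<alpha> = homotopy_cell f g Hs"
      and "\<exists>Hs. is_homotopy_seq A \<Sigma> h k Hs \<and> \<beta> = homotopy_cell h k Hs"
    then obtain Hs Ks where s: "is_homotopy_seq A \<Sigma> f g Hs" "is_homotopy_seq A \<Sigma> h k Ks"
      and c: "\<alpha> = homotopy_cell f g Hs" "\<beta> = homotopy_cell h k Ks"
      by blast
    show "\<exists>Hs. is_homotopy_seq A \<Sigma> (h \<cdot>\<^bsub>A\<^esub> f) (k \<cdot>\<^bsub>A\<^esub> g) Hs \<and>
        HCmp (Ho U A \<Sigma>) \<beta> \<alpha> = homotopy_cell (h \<cdot>\<^bsub>A\<^esub> f) (k \<cdot>\<^bsub>A\<^esub> g) Hs"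
      unfolding c Ho_hcmp[OF f h s] using homotopy_seq_hcmp[OF f h s] by blast
  next
    fix f h X Y Z
    assume f: "f \<in> Hom A X Y" and h: "h \<in> Hom A Y Z"
    then show "HCmp (Ho U A \<Sigma>) (VIde (Ho U A \<Sigma>) h) (VIde (Ho U A \<Sigma>) f) = VIde (Ho U A \<Sigma>) (h \<cdot>\<^bsub>A\<^esub> f)"
      using Ho_hcmp[OF f h, of f "[]" h "[]"] by (simp add: Hom_iff)
  next
    fix f f' f'' h h' h'' X Y Z \<alpha> \<alpha>' \<beta> \<beta>'
    assume f: "f \<in> Hom A X Y" and h: "h \<in> Hom A Y Z"
      and "\<exists>Hs. is_homotopy_seq A \<Sigma> f f' Hs \<and> \<alpha> = homotopy_cell f f' Hs"
      and "\<exists>Hs. is_homotopy_seq A \<Sigma> f' f'' Hs \<and> \<alpha>' = homotopy_cell f' f'' Hs"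
      and "\<exists>Hs. is_homotopy_seq A \<Sigma> h h' Hs \<and> \<beta> = homotopy_cell h h' Hs"
      and "\<exists>Hs. is_homotopy_seq A \<Sigma> h' h'' Hs \<and> \<beta>' = homotopy_cell h' h'' Hs"
    then obtain Hs Hs' Ks Ks' where H: "is_homotopy_seq A \<Sigma> f f' Hs" "is_homotopy_seq A \<Sigma> f' f'' Hs'"
      and K: "is_homotopy_seq A \<Sigma> h h' Ks" "is_homotopy_seq A \<Sigma> h' h'' Ks'"
      and c: "\<alpha> = homotopy_cell f f' Hs" "\<alpha>' = homotopy_cell f' f'' Hs'"
        "\<beta> = homotopy_cell h h' Ks" "\<beta>' = homotopy_cell h' h'' Ks'"
      by blast
    note f' = homotopy_seq_hom[OF f H(1)] and h' = homotopy_seq_hom[OF h K(1)]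
    note HH = homotopy_seq_append[OF H] and KK = homotopy_seq_append[OF K]
    note s1 = homotopy_seq_hcmp[OF f h H(1) K(1)] and s2 = homotopy_seq_hcmp[OF f' h' H(2) K(2)]
    note hf = cmp_hom[OF f h]
    show "HCmp (Ho U A \<Sigma>) (VCmp (Ho U A \<Sigma>) \<beta>' \<beta>) (VCmp (Ho U A \<Sigma>) \<alpha>' \<alpha>) =
        VCmp (Ho U A \<Sigma>) (HCmp (Ho U A \<Sigma>) \<beta>' \<alpha>') (HCmp (Ho U A \<Sigma>) \<beta> \<alpha>)"
      unfolding c Ho_vcmp[OF f H] Ho_vcmp[OF h K] Ho_hcmp[OF f h H(1) K(1)] Ho_hcmp[OF f' h' H(2) K(2)]
        Ho_hcmp[OF f h HH KK] Ho_vcmp[OF hf s1 s2]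
    \<comment> \<open>The two lists differ: between the outer blocks, one performs
      \<open>Hs'\<close> before \<open>Ks\<close> and the other \<open>Ks\<close> before
      \<open>Hs'\<close>. Equality appears only for the images in \<open>D\<close>, where it is the
      interchange law.\<close>
    proof (rule homotopy_cell_eqI[OF homotopy_seq_hcmp[OF f h HH KK] homotopy_seq_append[OF s1 s2] A])
      fix D :: "('d0, 'd1, 'd2) cat2" and F assume "localizing A \<Sigma> D F"
      then interpret localizing A \<Sigma> D F .
      show "hat_seq D F (h \<cdot>\<^bsub>A\<^esub> f) (map (\<lambda>K. whisker_right A K f'') (Ks' @ Ks) @ map (whisker_left A h) (Hs' @ Hs)) =
        hat_seq D F (h \<cdot>\<^bsub>A\<^esub> f) ((map (\<lambda>K. whisker_right A K f'') Ks' @ map (whisker_left A h') Hs') @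
          map (\<lambda>K. whisker_right A K f') Ks @ map (whisker_left A h) Hs)"
        unfolding hat_seq_hcmp[OF f h HH KK] hat_seq_append[OF hf s1 s2] hat_seq_append[OF f H]
          hat_seq_append[OF h K] hat_seq_hcmp[OF f h H(1) K(1)] hat_seq_hcmp[OF f' h' H(2) K(2)]
        by (rule D.interchange[OF F_hom[OF f] F_hom[OF h] hat_seq_cells[OF f H(1)] hat_seq_cells[OF f' H(2)]
              hat_seq_cells[OF h K(1)] hat_seq_cells[OF h' K(2)]])
    qed
  next
    fix f f' h h' k k' X Y Z V \<alpha> \<beta> \<gamma>
    assume f: "f \<in> Hom A X Y" and h: "h \<in> Hom A Y Z" and k: "k \<in> Hom A Z V"
      and "\<exists>Hs. is_homotopy_seq A \<Sigma> f f' Hs \<and> \<alpha> = homotopy_cell f f' Hs"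
      and "\<exists>Hs. is_homotopy_seq A \<Sigma> h h' Hs \<and> \<beta> = homotopy_cell h h' Hs"
      and "\<exists>Hs. is_homotopy_seq A \<Sigma> k k' Hs \<and> \<gamma> = homotopy_cell k k' Hs"
    then obtain Hs Ks Ls where s: "is_homotopy_seq A \<Sigma> f f' Hs" "is_homotopy_seq A \<Sigma> h h' Ks"
        "is_homotopy_seq A \<Sigma> k k' Ls"
      and c: "\<alpha> = homotopy_cell f f' Hs" "\<beta> = homotopy_cell h h' Ks" "\<gamma> = homotopy_cell k k' Ls"
      by blast
    note hf = cmp_hom[OF f h] and kh = cmp_hom[OF h k]
    note s1 = homotopy_seq_hcmp[OF f h s(1,2)] and s2 = homotopy_seq_hcmp[OF h k s(2,3)]
    note t1 = homotopy_seq_hcmp[OF hf k s1 s(3)] and t2 = homotopy_seq_hcmp[OF f kh s(1) s2]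
    \<comment> \<open>Cells carry their source and target arrows, so both associativities in
      \<open>A\<close> are needed to give the two sides literally the same ends before their classes
      are compared.\<close>
    note a = cmp_assoc[OF f h k]
      cmp_assoc[OF homotopy_seq_hom[OF f s(1)] homotopy_seq_hom[OF h s(2)] homotopy_seq_hom[OF k s(3)]]
    show "HCmp (Ho U A \<Sigma>) \<gamma> (HCmp (Ho U A \<Sigma>) \<beta> \<alpha>) = HCmp (Ho U A \<Sigma>) (HCmp (Ho U A \<Sigma>) \<gamma> \<beta>) \<alpha>"
      unfolding c Ho_hcmp[OF f h s(1,2)] Ho_hcmp[OF h k s(2,3)] Ho_hcmp[OF hf k s1 s(3)]
        Ho_hcmp[OF f kh s(1) s2] unfolding a
    proof (rule homotopy_cell_eqI[OF t1[unfolded a] t2 A])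
      fix D :: "('d0, 'd1, 'd2) cat2" and F assume "localizing A \<Sigma> D F"
      then interpret localizing A \<Sigma> D F .
      note F = F_hom[OF f] F_hom[OF h] F_hom[OF k]
      show "hat_seq D F (k \<cdot>\<^bsub>A\<^esub> h \<cdot>\<^bsub>A\<^esub> f) (map (\<lambda>K. whisker_right A K (h' \<cdot>\<^bsub>A\<^esub> f')) Ls @
            map (whisker_left A k) (map (\<lambda>K. whisker_right A K f') Ks @ map (whisker_left A h) Hs)) =
          hat_seq D F (k \<cdot>\<^bsub>A\<^esub> h \<cdot>\<^bsub>A\<^esub> f) (map (\<lambda>K. whisker_right A K f')
            (map (\<lambda>K. whisker_right A K h') Ls @ map (whisker_left A k) Ks) @ map (whisker_left A (k \<cdot>\<^bsub>A\<^esub> h)) Hs)"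
        unfolding hat_seq_hcmp[OF hf k s1 s(3), unfolded a] hat_seq_hcmp[OF f kh s(1) s2]
          hat_seq_hcmp[OF f h s(1,2)] hat_seq_hcmp[OF h k s(2,3)]
        by (rule D.hcmp_assoc[OF F hat_seq_cells[OF f s(1)] hat_seq_cells[OF h s(2)] hat_seq_cells[OF k s(3)]])
    qed
  next
    fix f g X Y \<alpha>
    assume f: "f \<in> Hom A X Y" and "\<exists>Hs. is_homotopy_seq A \<Sigma> f g Hs \<and> \<alpha> = homotopy_cell f g Hs"
    then obtain Hs where s: "is_homotopy_seq A \<Sigma> f g Hs" and c: "\<alpha> = homotopy_cell f g Hs"
      by blast
    note g = homotopy_seq_hom[OF f s] and o = hom_obj[OF f]
    note i = ide_hom[OF o(1)] ide_hom[OF o(2)]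
    have n: "is_homotopy_seq A \<Sigma> (Ide A X) (Ide A X) []" "is_homotopy_seq A \<Sigma> (Ide A Y) (Ide A Y) []"
      using i by (simp_all add: Hom_iff)
    note l = ide_left[OF f] ide_left[OF g] ide_right[OF f] ide_right[OF g]
    note h1 = homotopy_seq_hcmp[OF f i(2) s n(2), unfolded l] and h2 = homotopy_seq_hcmp[OF i(1) f n(1) s, unfolded l]
    show "HCmp (Ho U A \<Sigma>) (VIde (Ho U A \<Sigma>) (Ide (Ho U A \<Sigma>) Y)) \<alpha> = \<alpha>"
      unfolding c Ho_simps Ho_hcmp[OF f i(2) s n(2)] l
    proof (rule homotopy_cell_eqI[OF h1 s A])
      fix D :: "('d0, 'd1, 'd2) cat2" and F assume "localizing A \<Sigma> D F"
      then interpret localizing A \<Sigma> D F .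
      show "hat_seq D F f (map (\<lambda>K. whisker_right A K g) [] @ map (whisker_left A (Ide A Y)) Hs) = hat_seq D F f Hs"
        using hat_seq_hcmp[OF f i(2) s n(2)] D.hcmp_ide_left[OF F_hom[OF f] hat_seq_cells[OF f s]]
        by (simp add: l is_functor.ar_ide[OF F_functor o(2)])
    qed
    show "HCmp (Ho U A \<Sigma>) \<alpha> (VIde (Ho U A \<Sigma>) (Ide (Ho U A \<Sigma>) X)) = \<alpha>"
      unfolding c Ho_simps Ho_hcmp[OF i(1) f n(1) s] l
    proof (rule homotopy_cell_eqI[OF h2 s A])
      fix D :: "('d0, 'd1, 'd2) cat2" and F assume "localizing A \<Sigma> D F"
      then interpret localizing A \<Sigma> D F .
      show "hat_seq D F f (map (\<lambda>K. whisker_right A K (Ide A X)) Hs @ map (whisker_left A f) []) = hat_seq D F f Hs"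
        using hat_seq_hcmp[OF i(1) f n(1) s] D.hcmp_ide_right[OF F_hom[OF f] hat_seq_cells[OF f s]]
        by (simp add: l is_functor.ar_ide[OF F_functor o(1)])
    qed
  qed
qed

text \<open>The only cells of \<open>disc A\<close> are identities, so preservation of the two
  compositions amounts to the vertical unit law and to \<open>hcmp_vide\<close> in
  \<open>Ho\<close>.\<close>

lemma is_functor2_Ho_incl: "is_functor2 (disc A) (Ho U A \<Sigma>) (Ho_incl U A \<Sigma>)"
proof (rule is_functor2I)
  have "is_functor A (Ho U A \<Sigma>) (Ho_incl U A \<Sigma>)"
  proof (rule is_functor.intro)
    show "category (Ho U A \<Sigma>)"
      using A by (simp add: category_def)
    fix f X Y assume f: "f \<in> Hom A X Y"
    then show "FAr (Ho_incl U A \<Sigma>) f \<in> Hom (Ho U A \<Sigma>) (FOb (Ho_incl U A \<Sigma>) X) (FOb (Ho_incl U A \<Sigma>) Y)"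
      using hom_obj[OF f] by (simp add: Ho_incl_def Hom_iff)
    fix g Z assume g: "g \<in> Hom A Y Z"
    show "FAr (Ho_incl U A \<Sigma>) (g \<cdot>\<^bsub>A\<^esub> f) =
        FAr (Ho_incl U A \<Sigma>) g \<cdot>\<^bsub>Ho U A \<Sigma>\<^esub> FAr (Ho_incl U A \<Sigma>) f"
      using cmp_hom[OF f g] f g by (simp add: Ho_incl_def Hom_iff)
  next
    show "FAr (Ho_incl U A \<Sigma>) (Ide A X) = Ide (Ho U A \<Sigma>) (FOb (Ho_incl U A \<Sigma>) X)" if "X \<in> Obj A" for X
      using ide_hom[OF that] that by (simp add: Ho_incl_def Hom_iff)
  qed (auto simp: A Ho_incl_def)
  then show "is_functor (disc A) (Ho U A \<Sigma>) (Ho_incl U A \<Sigma>)"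
    by simp
next
  fix \<alpha> f g assume "\<alpha> \<in> Cells (disc A) f g"
  then have \<alpha>: "f \<in> Hom A (Dom A f) (Cod A f)" "\<alpha> = f" "g = f"
    by (auto simp: Cells_disc Hom_iff)
  then show "FCell (Ho_incl U A \<Sigma>) \<alpha> \<in> Cells (Ho U A \<Sigma>) (FAr (Ho_incl U A \<Sigma>) f) (FAr (Ho_incl U A \<Sigma>) g)"
    using Ho_vide_cells[OF \<alpha>(1)] by (simp add: Ho_incl_def Hom_iff)
  fix \<beta> h assume "\<beta> \<in> Cells (disc A) g h"
  then show "FCell (Ho_incl U A \<Sigma>) (VCmp (disc A) \<beta> \<alpha>) =
      VCmp (Ho U A \<Sigma>) (FCell (Ho_incl U A \<Sigma>) \<beta>) (FCell (Ho_incl U A \<Sigma>) \<alpha>)"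
    using category2.vcmp_ide_left[OF category2_Ho _ Ho_vide_cells[OF \<alpha>(1)]] \<alpha>
    by (simp add: Cells_disc Ho_incl_def Hom_iff del: Ho_simps(9))
next
  fix \<alpha> \<beta> f g h k X Y Z
  assume a: "f \<in> Hom (disc A) X Y" "h \<in> Hom (disc A) Y Z" "\<alpha> \<in> Cells (disc A) f g" "\<beta> \<in> Cells (disc A) h k"
  then show "FCell (Ho_incl U A \<Sigma>) (HCmp (disc A) \<beta> \<alpha>) =
      HCmp (Ho U A \<Sigma>) (FCell (Ho_incl U A \<Sigma>) \<beta>) (FCell (Ho_incl U A \<Sigma>) \<alpha>)"
    using category2.hcmp_vide[OF category2_Ho, of f X Y h Z] cmp_hom[of f X Y h Z]
    by (simp add: Cells_disc Ho_incl_def Hom_iff del: Ho_simps(9))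
qed (auto simp: A category2_disc category2_Ho, auto simp: Ho_incl_def)

end

end

text \<open>The one-dimensional counterpart of \<open>hat_cyl\<close>: since \<open>H s\<close> is
  monic, \<open>H d0 = H d1\<close>, and composing with \<open>H h\<close> equates the ends of one
  homotopy. Induction runs along the sequence.\<close>

lemma functor_homotopy_eq:
  assumes H: "is_functor A X H" and inv: "\<And>s. s \<in> \<Sigma> \<Longrightarrow> is_iso X (FAr H s)"
    and f: "f \<in> Hom A V Y" and Hs: "is_homotopy_seq A \<Sigma> f g Hs"
  shows "FAr H f = FAr H g"
  using Hs
proof (induction Hs arbitrary: g)
  case (Cons K Hs)
  interpret H: is_functor A X H by (fact H)
  interpret X: category X by (fact H.cod_category)
  obtain k where k: "FAr H f = FAr H k" "is_homotopy A \<Sigma> k g K"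
    using Cons by auto
  obtain V' Y' where K: "is_cylinder A \<Sigma> V' (fst K)" "snd K \<in> Hom A (cylW (fst K)) Y'"
    "snd K \<cdot>\<^bsub>A\<^esub> cyl_d0 (fst K) = k" "snd K \<cdot>\<^bsub>A\<^esub> cyl_d1 (fst K) = g"
    using k(2) by (rule is_homotopyE)
  note d = is_cylinderD[OF K(1)]
  have "FAr H (cyl_d0 (fst K)) = FAr H (cyl_d1 (fst K))"
    using H.ar_cmp[OF d(1,3)] H.ar_cmp[OF d(2,3)] d(6,7)
    by (intro X.iso_cancel[OF inv[OF d(5)] H.ar_hom[OF d(3)] H.ar_hom[OF d(1)] H.ar_hom[OF d(2)]]) simp
  then show ?case
    using H.ar_cmp[OF d(1) K(2)] H.ar_cmp[OF d(2) K(2)] K(3,4) k(1) by simp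
qed simp

text \<open>In contrast to cylinder objects in the sense of Quillen, \<open>x\<close> is an
  arbitrary arrow in the place of an identity and the legs satisfy no cofibration condition. This
  freedom lets \<open>f\<close> and \<open>g\<close> themselves be the legs, with
  \<open>x = s f\<close>.\<close>

lemma homotopy_of_equalized:
  assumes "f \<in> Hom A X Y" "g \<in> Hom A X Y" "s \<in> Hom A Y Z" "s \<in> \<Sigma>" "s \<cdot>\<^bsub>A\<^esub> f = s \<cdot>\<^bsub>A\<^esub> g" "category A"
  shows "\<exists>\<alpha>. \<alpha> \<in> Cells (Ho U A \<Sigma>) f g"
proof -
  interpret category A by fact
  let ?H = "(\<lparr>cylW = Y, cylZ = Z, cyl_d0 = f, cyl_d1 = g, cyl_s = s, cyl_x = s \<cdot>\<^bsub>A\<^esub> f\<rparr>, Ide A Y)"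
  have "is_homotopy A \<Sigma> f g ?H"
    unfolding is_homotopy_def is_cylinder_def
    using assms cmp_hom[OF assms(1,3)] ide_hom[OF hom_obj(2)[OF assms(1)]] ide_left[OF assms(1)] ide_left[OF assms(2)]
    by (intro exI[of _ X] exI[of _ Y]) simp
  then have "is_homotopy_seq A \<Sigma> f g [?H]"
    using assms(1) by (simp add: Hom_iff)
  then show ?thesis
    unfolding Cells_Ho by blast
qed

section \<open>Fibrant-cofibrant replacement\<close>

lemma is_retractI:
  assumes "f \<in> Hom C X Y" "g \<in> Hom C X' Y'" "i \<in> Hom C X X'" "r \<in> Hom C X' X" "j \<in> Hom C Y Y'" "s \<in> Hom C Y' Y"
    and "r \<cdot>\<^bsub>C\<^esub> i = Ide C X" "s \<cdot>\<^bsub>C\<^esub> j = Ide C Y" "g \<cdot>\<^bsub>C\<^esub> i = j \<cdot>\<^bsub>C\<^esub> f" "f \<cdot>\<^bsub>C\<^esub> r = s \<cdot>\<^bsub>C\<^esub> g"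
  shows "is_retract C f g"
proof -
  have fg: "f \<in> Arr C" "Dom C f = X" "Cod C f = Y" "g \<in> Arr C" "Dom C g = X'" "Cod C g = Y'"
    using assms(1,2) by (simp_all add: Hom_iff)
  show ?thesis
    unfolding is_retract_def fg using fg(1,4) assms(3-) by blast
qed

context normal_model_category
begin

sublocale model_category M "Weq M" "Cofb M" "Fibr M"
  by (fact model)

sublocale ct: functorial_factorization M "Cofb M" "Fibr M \<inter> Weq M" "fac_ct M"
  by (fact fact_ct)

sublocale tf: functorial_factorization M "Cofb M \<inter> Weq M" "Fibr M" "fac_tf M"
  by (fact fact_tf)

text \<open>The axioms do not state this. Factor the identity as \<open>p j\<close> with
  \<open>p\<close> a weak equivalence; then \<open>j\<close> and \<open>p\<close> exhibit the
  identity as a retract of \<open>p\<close>.\<close>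

lemma ide_Weq:
  assumes X: "X \<in> Obj M"
  shows "Ide M X \<in> Weq M"
proof -
  note i = ide_hom[OF X]
  obtain E j p where f: "j \<in> Hom M X E" "p \<in> Hom M E X" "p \<in> Weq M" "Ide M X = p \<cdot>\<^bsub>M\<^esub> j"
    using factor_cof_tfib[OF i] by blast
  have "is_retract M (Ide M X) p"
    by (rule is_retractI[where X = X and Y = X and X' = E and Y' = X and i = j and r = p and j = "Ide M X" and s = "Ide M X"])
      (simp_all add: i f(1,2) f(4)[symmetric] ide_left[OF i] ide_left[OF f(2)] ide_right[OF i])
  then show ?thesis
    using W_retracts f(3) unfolding closed_under_retracts_def by blast
qed

lemma Weq_comp: "f \<in> Hom M X Y \<Longrightarrow> g \<in> Hom M Y Z \<Longrightarrow> f \<in> Weq M \<Longrightarrow> g \<in> Weq M \<Longrightarrow> g \<cdot>\<^bsub>M\<^esub> f \<in> Weq M"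
  using W_comp unfolding closed_under_comp_def by (simp add: Hom_iff)

lemma Cofb_comp: "f \<in> Hom M X Y \<Longrightarrow> g \<in> Hom M Y Z \<Longrightarrow> f \<in> Cofb M \<Longrightarrow> g \<in> Cofb M \<Longrightarrow> g \<cdot>\<^bsub>M\<^esub> f \<in> Cofb M"
  using Cof_comp unfolding closed_under_comp_def by (simp add: Hom_iff)

lemma Fibr_comp: "f \<in> Hom M X Y \<Longrightarrow> g \<in> Hom M Y Z \<Longrightarrow> f \<in> Fibr M \<Longrightarrow> g \<in> Fibr M \<Longrightarrow> g \<cdot>\<^bsub>M\<^esub> f \<in> Fibr M"
  using Fib_comp unfolding closed_under_comp_def by (simp add: Hom_iff)

lemma ini_obj: "ini M \<in> Obj M" and ter_obj: "ter M \<in> Obj M"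
  using initial terminal by (auto simp: is_initial_def is_terminal_def)

lemma from_ini: "X \<in> Obj M \<Longrightarrow> from_ini M X \<in> Hom M (ini M) X"
  using initial theI'[of "\<lambda>f. f \<in> Hom M (ini M) X"] by (auto simp: is_initial_def from_ini_def)

lemma to_ter: "X \<in> Obj M \<Longrightarrow> to_ter M X \<in> Hom M X (ter M)"
  using terminal theI'[of "\<lambda>f. f \<in> Hom M X (ter M)"] by (auto simp: is_terminal_def to_ter_def)

lemma from_ini_eq: "f \<in> Hom M (ini M) X \<Longrightarrow> f = from_ini M X"
  using initial from_ini[of X] hom_obj(2)[of f "ini M" X] unfolding is_initial_def by blast

lemma to_ter_eq: "f \<in> Hom M X (ter M) \<Longrightarrow> f = to_ter M X"
  using terminal to_ter[of X] hom_obj(1)[of f X "ter M"] unfolding is_terminal_def by blast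

lemma cofibrantI: "f \<in> Hom M (ini M) X \<Longrightarrow> f \<in> Cofb M \<Longrightarrow> cofibrant M X"
  using from_ini_eq[of f X] hom_obj(2)[of f] by (simp add: cofibrant_def)

lemma fibrantI: "f \<in> Hom M X (ter M) \<Longrightarrow> f \<in> Fibr M \<Longrightarrow> fibrant M X"
  using to_ter_eq[of f X] hom_obj(1)[of f] by (simp add: fibrant_def)

lemma cofibrant_obj: "cofibrant M X \<Longrightarrow> X \<in> Obj M" and fibrant_obj: "fibrant M X \<Longrightarrow> X \<in> Obj M"
  by (simp_all add: cofibrant_def fibrant_def)

text \<open>Together with its dual below this keeps the middle object of a factorization of an arrow
  of \<open>fc_cat M\<close> inside \<open>fc_cat M\<close>.\<close>

lemma cofibrant_Cofb_cod: "cofibrant M X \<Longrightarrow> i \<in> Hom M X Y \<Longrightarrow> i \<in> Cofb M \<Longrightarrow> cofibrant M Y"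
  using cofibrantI[OF cmp_hom[OF from_ini] Cofb_comp[OF from_ini]] by (simp add: cofibrant_def)

lemma fibrant_Fibr_dom: "fibrant M Y \<Longrightarrow> p \<in> Hom M X Y \<Longrightarrow> p \<in> Fibr M \<Longrightarrow> fibrant M X"
  using fibrantI[OF cmp_hom[OF _ to_ter] Fibr_comp[OF _ to_ter]] by (simp add: fibrant_def)

lemma Q_ob_cofibrant:
  assumes X: "X \<in> Obj M"
  shows "cofibrant M (Q_ob M X)"
  using ct.lam_hom[of "from_ini M X"] ct.lam_class[of "from_ini M X"] from_ini[OF X]
  by (intro cofibrantI[of "fac_lam (fac_ct M) (from_ini M X)"]) (simp_all add: Q_ob_def Hom_iff)

lemma p_ar:
  assumes X: "X \<in> Obj M"
  shows "p_ar M X \<in> Hom M (Q_ob M X) X" "p_ar M X \<in> Weq M"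
  using ct.rho_hom[of "from_ini M X"] ct.rho_class[of "from_ini M X"] from_ini[OF X]
  by (simp_all add: p_ar_def Q_ob_def Hom_iff)

lemma R_ob_fibrant:
  assumes X: "X \<in> Obj M"
  shows "fibrant M (R_ob M X)"
  using tf.rho_hom[of "to_ter M X"] tf.rho_class[of "to_ter M X"] to_ter[OF X]
  by (intro fibrantI[of "fac_rho (fac_tf M) (to_ter M X)"]) (simp_all add: R_ob_def Hom_iff)

lemma v_ar:
  assumes X: "X \<in> Obj M"
  shows "v_ar M X \<in> Hom M X (R_ob M X)" "v_ar M X \<in> Weq M" "v_ar M X \<in> Cofb M"
  using tf.lam_hom[of "to_ter M X"] tf.lam_class[of "to_ter M X"] to_ter[OF X]
  by (simp_all add: v_ar_def R_ob_def Hom_iff)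

text \<open>\<open>v_X\<close> is a cofibration, so \<open>R\<close> does not destroy the cofibrancy
  gained from \<open>Q\<close>; hence \<open>RQ\<close> takes values in objects that are both
  fibrant and cofibrant.\<close>

lemma R_ob_cofibrant: "cofibrant M X \<Longrightarrow> cofibrant M (R_ob M X)"
  using cofibrant_Cofb_cod v_ar[OF cofibrant_obj] by blast

lemma square_from_ini:
  assumes f: "f \<in> Hom M X Y"
  shows "is_square M (from_ini M X) (from_ini M Y) (Ide M (ini M)) f"
proof -
  note i = from_ini[OF hom_obj(1)[OF f]] from_ini[OF hom_obj(2)[OF f]]
  show ?thesis
    using i f ide_hom[OF ini_obj] ide_right[OF i(2)] from_ini_eq[OF cmp_hom[OF i(1) f]]
    by (simp add: is_square_def Hom_iff)
qed

lemma square_to_ter: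
  assumes f: "f \<in> Hom M X Y"
  shows "is_square M (to_ter M X) (to_ter M Y) f (Ide M (ter M))"
proof -
  note t = to_ter[OF hom_obj(1)[OF f]] to_ter[OF hom_obj(2)[OF f]]
  show ?thesis
    using t f ide_hom[OF ter_obj] ide_left[OF t(1)] to_ter_eq[OF cmp_hom[OF f t(2)]]
    by (simp add: is_square_def Hom_iff)
qed

lemma Q_ar:
  assumes f: "f \<in> Hom M X Y"
  shows "Q_ar M f \<in> Hom M (Q_ob M X) (Q_ob M Y)" "p_ar M Y \<cdot>\<^bsub>M\<^esub> Q_ar M f = f \<cdot>\<^bsub>M\<^esub> p_ar M X"
  using ct.map_hom[OF square_from_ini[OF f]] ct.map_rho[OF square_from_ini[OF f]] f
  by (simp_all add: Q_ar_def Q_ob_def p_ar_def Hom_iff)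

lemma R_ar:
  assumes f: "f \<in> Hom M X Y"
  shows "R_ar M f \<in> Hom M (R_ob M X) (R_ob M Y)" "R_ar M f \<cdot>\<^bsub>M\<^esub> v_ar M X = v_ar M Y \<cdot>\<^bsub>M\<^esub> f"
  using tf.map_hom[OF square_to_ter[OF f]] tf.map_lam[OF square_to_ter[OF f]] f
  by (simp_all add: R_ar_def R_ob_def v_ar_def Hom_iff)

text \<open>\<open>r_func\<close> is given as a single record; with \<open>Q\<close> and
  \<open>R\<close> as separate functors its functor laws follow from those of a composite.\<close>

definition Q_func :: "('o, 'm, 'o, 'm) func" where
  "Q_func = \<lparr>FOb = (\<lambda>X\<in>Obj M. Q_ob M X), FAr = (\<lambda>f\<in>Arr M. Q_ar M f)\<rparr>"

definition R_func :: "('o, 'm, 'o, 'm) func" where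
  "R_func = \<lparr>FOb = (\<lambda>X\<in>Obj M. R_ob M X), FAr = (\<lambda>f\<in>Arr M. R_ar M f)\<rparr>"

lemma QR_func_simps [simp]:
  "X \<in> Obj M \<Longrightarrow> FOb Q_func X = Q_ob M X" "f \<in> Arr M \<Longrightarrow> FAr Q_func f = Q_ar M f"
  "X \<in> Obj M \<Longrightarrow> FOb R_func X = R_ob M X" "f \<in> Arr M \<Longrightarrow> FAr R_func f = R_ar M f"
  by (simp_all add: Q_func_def R_func_def)

lemma is_functor_Q: "is_functor M M Q_func"
proof (rule is_functor.intro)
  fix f X Y assume f: "f \<in> Hom M X Y"
  then show "FAr Q_func f \<in> Hom M (FOb Q_func X) (FOb Q_func Y)"
    using Q_ar(1)[OF f] hom_obj[OF f] by (simp add: Hom_iff)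
  fix g Z assume g: "g \<in> Hom M Y Z"
  show "FAr Q_func (g \<cdot>\<^bsub>M\<^esub> f) = FAr Q_func g \<cdot>\<^bsub>M\<^esub> FAr Q_func f"
    using f g cmp_hom[OF f g] ide_left[OF ide_hom[OF ini_obj]]
      ct.map_cmp[OF square_from_ini[OF f] square_from_ini[OF g]]
    by (simp add: Hom_iff Q_ar_def)
next
  fix X assume X: "X \<in> Obj M"
  show "FAr Q_func (Ide M X) = Ide M (FOb Q_func X)"
    using ide_hom[OF X] X ct.map_ide[of "from_ini M X"] from_ini[OF X]
    by (simp add: Hom_iff Q_ar_def Q_ob_def)
next
  show "FOb Q_func X \<in> Obj M" if "X \<in> Obj M" for X
    using cofibrant_obj[OF Q_ob_cofibrant[OF that]] that by simp
qed (auto simp: category_axioms, auto simp: Q_func_def)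

lemma is_functor_R: "is_functor M M R_func"
proof (rule is_functor.intro)
  fix f X Y assume f: "f \<in> Hom M X Y"
  then show "FAr R_func f \<in> Hom M (FOb R_func X) (FOb R_func Y)"
    using R_ar(1)[OF f] hom_obj[OF f] by (simp add: Hom_iff)
  fix g Z assume g: "g \<in> Hom M Y Z"
  show "FAr R_func (g \<cdot>\<^bsub>M\<^esub> f) = FAr R_func g \<cdot>\<^bsub>M\<^esub> FAr R_func f"
    using f g cmp_hom[OF f g] ide_left[OF ide_hom[OF ter_obj]]
      tf.map_cmp[OF square_to_ter[OF f] square_to_ter[OF g]]
    by (simp add: Hom_iff R_ar_def)
next
  fix X assume X: "X \<in> Obj M"
  show "FAr R_func (Ide M X) = Ide M (FOb R_func X)"
    using ide_hom[OF X] X tf.map_ide[of "to_ter M X"] to_ter[OF X]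
    by (simp add: Hom_iff R_ar_def R_ob_def)
next
  show "FOb R_func X \<in> Obj M" if "X \<in> Obj M" for X
    using fibrant_obj[OF R_ob_fibrant[OF that]] that by simp
qed (auto simp: category_axioms, auto simp: R_func_def)

lemma r_func_eq: "r_func M = comp_func M R_func Q_func"
proof -
  have "Q_ob M X \<in> Obj M" if "X \<in> Obj M" for X
    by (rule cofibrant_obj[OF Q_ob_cofibrant[OF that]])
  moreover have "Q_ar M f \<in> Arr M" if "f \<in> Arr M" for f
    using Q_ar(1)[OF arr_hom[OF that]] by (simp add: Hom_iff)
  ultimately show ?thesis
    by (simp add: r_func_def comp_func_def cong: restrict_cong)
qed

lemma r_func_simps [simp]:
  "X \<in> Obj M \<Longrightarrow> FOb (r_func M) X = R_ob M (Q_ob M X)" "f \<in> Arr M \<Longrightarrow> FAr (r_func M) f = R_ar M (Q_ar M f)"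
  by (simp_all add: r_func_def)

text \<open>In \<open>p_Y . Q f = f . p_X\<close> both \<open>p\<close> are weak equivalences, so
  3-for-2 applies. The argument for \<open>R\<close> below uses \<open>v\<close> in the same
  way.\<close>

lemma Q_Weq:
  assumes "f \<in> Weq M"
  shows "Q_ar M f \<in> Weq M"
proof -
  have f: "f \<in> Hom M (Dom M f) (Cod M f)"
    using assms W_arr arr_hom by blast
  show ?thesis
    using three_for_two_right[OF Q_ar(1)[OF f] p_ar(1)[OF hom_obj(2)[OF f]] p_ar(2)[OF hom_obj(2)[OF f]]]
      Weq_comp[OF p_ar(1)[OF hom_obj(1)[OF f]] f p_ar(2)[OF hom_obj(1)[OF f]] assms] Q_ar(2)[OF f]
    by simp
qed

lemma R_Weq:
  assumes "f \<in> Weq M"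
  shows "R_ar M f \<in> Weq M"
proof -
  have f: "f \<in> Hom M (Dom M f) (Cod M f)"
    using assms W_arr arr_hom by blast
  show ?thesis
    using three_for_two_left[OF v_ar(1)[OF hom_obj(1)[OF f]] R_ar(1)[OF f] v_ar(2)[OF hom_obj(1)[OF f]]]
      Weq_comp[OF f v_ar(1)[OF hom_obj(2)[OF f]] assms v_ar(2)[OF hom_obj(2)[OF f]]] R_ar(2)[OF f]
    by simp
qed

text \<open>Normality speaks of objects and of \<open>p\<close> only. Once \<open>p_X\<close> and
  \<open>p_Y\<close> are identities, the naturality square of \<open>p\<close> reads
  \<open>Q f = f\<close>.\<close>

lemma Q_ar_cofibrant: "f \<in> Hom M X Y \<Longrightarrow> cofibrant M X \<Longrightarrow> cofibrant M Y \<Longrightarrow> Q_ar M f = f"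
  using Q_ar[of f X Y] normal_Q[of X] normal_Q[of Y] ide_left[of "Q_ar M f" X Y] ide_right[of f X Y] by simp

lemma R_ar_fibrant: "f \<in> Hom M X Y \<Longrightarrow> fibrant M X \<Longrightarrow> fibrant M Y \<Longrightarrow> R_ar M f = f"
  using R_ar[of f X Y] normal_R[of X] normal_R[of Y] ide_right[of "R_ar M f" X Y] ide_left[of f X Y] by simp

lemma is_nat_trans_p: "is_nat_trans M M \<lparr>NDom = Q_func, NCod = id_func M, NCmp = (\<lambda>X\<in>Obj M. p_ar M X)\<rparr>"
proof (rule is_nat_transI, goal_cases)
  case (4 X)
  then show ?case
    using p_ar(1) by simp
next
  case (5 f X Y)
  then show ?case
    using Q_ar(2)[OF 5] hom_obj[OF 5] by (simp add: Hom_iff[of f])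
qed (auto simp: is_functor_Q is_functor_id category_axioms)

lemma is_nat_trans_v:
  "is_nat_trans M M \<lparr>NDom = Q_func, NCod = r_func M, NCmp = (\<lambda>X\<in>Obj M. v_ar M (Q_ob M X))\<rparr>"
proof (rule is_nat_transI, goal_cases)
  case (4 X)
  then show ?case
    using v_ar(1)[OF cofibrant_obj[OF Q_ob_cofibrant]] by simp
next
  case (5 f X Y)
  then show ?case
    using R_ar(2)[OF Q_ar(1)[OF 5]] hom_obj[OF 5] by (simp add: Hom_iff[of f])
qed (auto simp: is_functor_Q r_func_eq is_functor_comp[OF is_functor_Q is_functor_R])

section \<open>The subcategory of fibrant-cofibrant objects\<close>

lemma category_fc: "category (fc_cat M)"
  unfolding fc_cat_def by (rule category_full_subcat[OF category_axioms])

lemma Obj_fc: "X \<in> Obj (fc_cat M) \<longleftrightarrow> fibrant M X \<and> cofibrant M X"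
  using fibrant_obj by (auto simp: fc_cat_def)

lemma Hom_fc: "f \<in> Hom (fc_cat M) X Y \<longleftrightarrow>
    f \<in> Hom M X Y \<and> fibrant M X \<and> cofibrant M X \<and> fibrant M Y \<and> cofibrant M Y"
  by (auto simp: fc_cat_def Hom_full_subcat)

lemma fc_simps [simp]: "Ide (fc_cat M) = Ide M" "Cmp (fc_cat M) = Cmp M"
  by (simp_all add: fc_cat_def)

lemma is_functor_r: "is_functor M (fc_cat M) (r_func M)"
  unfolding fc_cat_def
proof (rule functor_full_subcat_corestrict)
  show "is_functor M M (r_func M)"
    unfolding r_func_eq by (rule is_functor_comp[OF is_functor_Q is_functor_R])
  show "FOb (r_func M) X \<in> {X. fibrant M X \<and> cofibrant M X}" if "X \<in> Obj M" for X
    using that R_ob_fibrant R_ob_cofibrant Q_ob_cofibrant cofibrant_obj by simp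
qed

text \<open>\<open>Q\<close> fixes everything between cofibrant objects and \<open>R\<close>
  everything between fibrant ones; these are equalities, and the strict identity in
  \<open>extension_precomp\<close> rests on them.\<close>

lemma r_func_fc:
  "X \<in> Obj (fc_cat M) \<Longrightarrow> FOb (r_func M) X = X"
  "f \<in> Hom (fc_cat M) X Y \<Longrightarrow> FAr (r_func M) f = f"
  using normal_Q[of X] normal_R[of X] fibrant_obj[of X] Q_ar_cofibrant[of f X Y] R_ar_fibrant[of f X Y]
  by (auto simp: Obj_fc Hom_fc, auto simp: Hom_iff)

section \<open>The localization\<close>

context
  fixes U :: "('d0 \<times> 'd1 \<times> 'd2) itself"
begin

section \<open>Weak equivalences become invertible in \<open>pi0\<close>\<close>

interpretation B: category2 "Ho_fc U M"
  unfolding Ho_fc_def by (rule category2_Ho[OF category_fc])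

lemma Hom_Ho_fc [simp]: "Hom (Ho_fc U M) X Y = Hom (fc_cat M) X Y"
  by (simp add: Ho_fc_def)

lemma Ho_fc_simps [simp]:
  "Obj (Ho_fc U M) = Obj (fc_cat M)" "Arr (Ho_fc U M) = Arr (fc_cat M)" "Ide (Ho_fc U M) = Ide M"
  "Cmp (Ho_fc U M) = Cmp M"
  by (simp_all add: Ho_fc_def)

abbreviation cls :: "'m \<Rightarrow> 'm set" where "cls \<equiv> arr_component (Ho_fc U M)"

text \<open>Every 2-cell used to invert weak equivalences comes from here, with \<open>s\<close> a
  trivial fibration or a retraction of a trivial cofibration.\<close>

lemma cls_eqI:
  assumes f: "f \<in> Hom (fc_cat M) X Y" and g: "g \<in> Hom (fc_cat M) X Y" and s: "s \<in> Hom (fc_cat M) Y Z" "s \<in> Weq M"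
    and eq: "s \<cdot>\<^bsub>M\<^esub> f = s \<cdot>\<^bsub>M\<^esub> g"
  shows "cls f = cls g"
proof -
  have "s \<in> Weq M \<inter> Arr (fc_cat M)"
    using s by (simp add: Hom_iff)
  then obtain \<alpha> where "\<alpha> \<in> Cells (Ho_fc U M) f g"
    using homotopy_of_equalized[OF f g s(1) _ _ category_fc, of "Weq M \<inter> Arr (fc_cat M)" U] eq
    unfolding Ho_fc_def by auto
  then show ?thesis
    using f by (intro B.arr_component_cell[where X = X and Y = Y]) simp_all
qed

lemma is_iso_clsI:
  assumes f: "f \<in> Hom (fc_cat M) X Y" and g: "g \<in> Hom (fc_cat M) Y X"
    and "cls (g \<cdot>\<^bsub>M\<^esub> f) = cls (Ide M X)" "cls (f \<cdot>\<^bsub>M\<^esub> g) = cls (Ide M Y)"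
  shows "is_iso (pi0 (Ho_fc U M)) (cls f)"
proof (rule is_isoI)
  show "cls f \<in> Hom (pi0 (Ho_fc U M)) X Y" "cls g \<in> Hom (pi0 (Ho_fc U M)) Y X"
    using f g unfolding B.Hom_pi0 by auto
qed (use assms B.pi0_cmp[of f X Y g X] B.pi0_cmp[of g Y X f Y] in simp_all)

lemma is_iso_cls_trivial_fibration:
  assumes p: "p \<in> Hom (fc_cat M) X Y" "p \<in> Fibr M" "p \<in> Weq M"
  shows "is_iso (pi0 (Ho_fc U M)) (cls p)"
proof -
  have X: "fibrant M X" "cofibrant M X" "X \<in> Obj M" and Y: "fibrant M Y" "cofibrant M Y" "Y \<in> Obj M"
    and p': "p \<in> Hom M X Y"
    using p(1) fibrant_obj by (auto simp: Hom_fc)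
  note iX = from_ini[OF X(3)] and iY = from_ini[OF Y(3)]
  \<comment> \<open>A lift of \<open>id_Y\<close> along \<open>p\<close> against
    \<open>0 -> Y\<close> is a section, and \<open>0 -> Y\<close> is a cofibration because
    \<open>Y\<close> is cofibrant. The square commutes since both composites start at the initial
    object.\<close>
  have "is_square M (from_ini M Y) p (from_ini M X) (Ide M Y)"
    using iX iY p' ide_hom[OF Y(3)] ide_left[OF iY] from_ini_eq[OF cmp_hom[OF iX p']]
    by (simp add: is_square_def Hom_iff)
  then have "has_lift M (from_ini M Y) p (from_ini M X) (Ide M Y)"
    using lifting[of "from_ini M Y" p] p Y(2) by (simp add: cofibrant_def)
  then obtain s where s: "s \<in> Hom M Y X" "p \<cdot>\<^bsub>M\<^esub> s = Ide M Y"
    using iY p' unfolding has_lift_def by (auto simp: Hom_iff)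
  \<comment> \<open>\<open>p\<close> itself equalizes \<open>s p\<close> and the identity, so it can
    serve as the weak equivalence of the cylinder.\<close>
  have "p \<cdot>\<^bsub>M\<^esub> (s \<cdot>\<^bsub>M\<^esub> p) = p \<cdot>\<^bsub>M\<^esub> Ide M X"
    using cmp_assoc[OF p' s(1) p'] s(2) ide_left[OF p'] ide_right[OF p'] by simp
  then have "cls (s \<cdot>\<^bsub>M\<^esub> p) = cls (Ide M X)"
    using cmp_hom[OF p' s(1)] ide_hom[OF X(3)] p X Y by (intro cls_eqI[where X = X and Y = X and Z = Y and s = p]) (simp_all add: Hom_fc)
  then show ?thesis
    using s p X Y by (intro is_iso_clsI[where g = s and X = X and Y = Y]) (simp_all add: Hom_fc)
qed

text \<open>Not the formal dual of the preceding case. Precomposition with \<open>i\<close>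
  identifies \<open>i r\<close> with the identity, but a cylinder needs an arrow that identifies
  them by postcomposition. The retraction \<open>r\<close> does so, and it is a weak equivalence by
  3-for-2 from \<open>r i = id\<close>.\<close>

lemma is_iso_cls_trivial_cofibration:
  assumes i: "i \<in> Hom (fc_cat M) X Y" "i \<in> Cofb M" "i \<in> Weq M"
  shows "is_iso (pi0 (Ho_fc U M)) (cls i)"
proof -
  have X: "fibrant M X" "cofibrant M X" "X \<in> Obj M" and Y: "fibrant M Y" "cofibrant M Y" "Y \<in> Obj M"
    and i': "i \<in> Hom M X Y"
    using i(1) fibrant_obj by (auto simp: Hom_fc)
  note tX = to_ter[OF X(3)] and tY = to_ter[OF Y(3)]
  have "is_square M i (to_ter M X) (Ide M X) (to_ter M Y)"
    using tX tY i' ide_hom[OF X(3)] ide_right[OF tX] to_ter_eq[OF cmp_hom[OF i' tY]]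
    by (simp add: is_square_def Hom_iff)
  then have "has_lift M i (to_ter M X) (Ide M X) (to_ter M Y)"
    using lifting[of i "to_ter M X"] i X(1) by (simp add: fibrant_def)
  then obtain r where r: "r \<in> Hom M Y X" "r \<cdot>\<^bsub>M\<^esub> i = Ide M X"
    using tX i' unfolding has_lift_def by (auto simp: Hom_iff)
  have "r \<in> Weq M"
    using three_for_two_left[OF i' r(1) i(3)] r(2) ide_Weq[OF X(3)] by simp
  moreover have "r \<cdot>\<^bsub>M\<^esub> (i \<cdot>\<^bsub>M\<^esub> r) = r \<cdot>\<^bsub>M\<^esub> Ide M Y"
    using cmp_assoc[OF r(1) i' r(1)] r(2) ide_left[OF r(1)] ide_right[OF r(1)] by simp
  ultimately have "cls (i \<cdot>\<^bsub>M\<^esub> r) = cls (Ide M Y)"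
    using cmp_hom[OF r(1) i'] ide_hom[OF Y(3)] r X Y by (intro cls_eqI[where X = Y and Y = Y and Z = X and s = r]) (simp_all add: Hom_fc)
  then show ?thesis
    using r i X Y by (intro is_iso_clsI[where g = r and X = X and Y = Y]) (simp_all add: Hom_fc)
qed

text \<open>The middle object \<open>E\<close> of the factorization is cofibrant by the cofibration
  \<open>i\<close> out of \<open>X\<close> and fibrant by the fibration \<open>p\<close> into
  \<open>Y\<close>. Both factors therefore lie in \<open>fc_cat M\<close>, and \<open>p\<close> is a
  weak equivalence by 3-for-2.\<close>

lemma is_iso_cls_Weq:
  assumes f: "f \<in> Hom (fc_cat M) X Y" "f \<in> Weq M"
  shows "is_iso (pi0 (Ho_fc U M)) (cls f)"
proof -
  have X: "fibrant M X" "cofibrant M X" and Y: "fibrant M Y" "cofibrant M Y" and f': "f \<in> Hom M X Y"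
    using f(1) by (auto simp: Hom_fc)
  obtain E i p where i: "i \<in> Hom M X E" "i \<in> Cofb M" "i \<in> Weq M" and p: "p \<in> Hom M E Y" "p \<in> Fibr M"
    and pi: "f = p \<cdot>\<^bsub>M\<^esub> i"
    using factor_tcof_fib[OF f'] by blast
  have "p \<in> Weq M"
    using three_for_two_left[OF i(1) p(1) i(3)] f(2) pi by simp
  have i_fc: "i \<in> Hom (fc_cat M) X E" and p_fc: "p \<in> Hom (fc_cat M) E Y"
    using X Y i p cofibrant_Cofb_cod[OF X(2) i(1,2)] fibrant_Fibr_dom[OF Y(1) p] by (simp_all add: Hom_fc)
  have h: "cls i \<in> Hom (pi0 (Ho_fc U M)) X E" "cls p \<in> Hom (pi0 (Ho_fc U M)) E Y"
    unfolding B.Hom_pi0 using i_fc p_fc by auto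
  have "cls f = cls p \<cdot>\<^bsub>pi0 (Ho_fc U M)\<^esub> cls i"
    using B.pi0_cmp[of i X E p Y] i_fc p_fc pi by simp
  then show ?thesis
    using category.iso_comp[OF B.category_pi0 h is_iso_cls_trivial_cofibration[OF i_fc i(2,3)]
        is_iso_cls_trivial_fibration[OF p_fc p(2) \<open>p \<in> Weq M\<close>]] by simp
qed

section \<open>The functor \<open>pi0_q\<close>\<close>

lemma is_functor2_q: "is_functor2 (disc M) (Ho_fc U M) (q_func U M)"
  unfolding q_func_def Ho_fc_def
  by (rule is_functor2_comp[OF is_functor2_disc[OF is_functor_r] is_functor2_Ho_incl[OF category_fc]])

lemma r_func_fc_obj: "X \<in> Obj M \<Longrightarrow> FOb (r_func M) X \<in> Obj (fc_cat M)"
  using is_functor.ob_obj[OF is_functor_r] .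

lemma r_func_fc_arr: "f \<in> Arr M \<Longrightarrow> FAr (r_func M) f \<in> Arr (fc_cat M)"
  using is_functor.ar_arr[OF is_functor_r] by (simp add: Hom_iff)

lemma q_func_simps [simp]:
  "X \<in> Obj M \<Longrightarrow> FOb (q_func U M) X = FOb (r_func M) X"
  "f \<in> Arr M \<Longrightarrow> FAr (q_func U M) f = FAr (r_func M) f"
  "f \<in> Arr M \<Longrightarrow> FCell (q_func U M) f = VIde (Ho_fc U M) (FAr (r_func M) f)"
  using r_func_fc_obj[of X] r_func_fc_arr[of f]
  by (simp_all add: q_func_def Ho_incl_def Ho_fc_def del: r_func_simps)

lemma pi0_q_simps:
  "X \<in> Obj M \<Longrightarrow> FOb (pi0_q U M) X = FOb (r_func M) X"
  "f \<in> Arr M \<Longrightarrow> FAr (pi0_q U M) f = cls (FAr (r_func M) f)"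
  using r_func_fc_obj[of X] r_func_fc_arr[of f]
  by (simp_all add: pi0_q_def underlying_func_def del: r_func_simps)

lemma is_functor_pi0_q: "is_functor M (pi0 (Ho_fc U M)) (pi0_q U M)"
  using is_functor_underlying[OF is_functor2_comp[OF is_functor2_q B.is_functor2_pi0_func]]
  by (simp add: pi0_q_def)

text \<open>\<open>R\<close> and \<open>Q\<close> both preserve weak equivalences, which reduces the
  claim to weak equivalences inside \<open>fc_cat M\<close>.\<close>

lemma pi0_q_Weq:
  assumes "w \<in> Weq M"
  shows "is_iso (pi0 (Ho_fc U M)) (FAr (pi0_q U M) w)"
proof -
  have w: "w \<in> Arr M"
    using assms W_arr by blast
  show ?thesis
    using is_iso_cls_Weq[OF is_functor.ar_arr[OF is_functor_r w]] R_Weq[OF Q_Weq[OF assms]] w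
    by (simp add: pi0_q_simps)
qed

section \<open>Extending functors that invert weak equivalences to \<open>pi0\<close>\<close>

lemma is_functor_fc_incl: "is_functor (fc_cat M) M (id_func (fc_cat M))"
  using functor_full_subcat_cod[OF is_functor_id[OF category_fc, unfolded fc_cat_def] category_axioms]
  by (simp add: fc_cat_def)

text \<open>\<open>Ho\<close> adds 2-cells without touching objects, arrows or composition, and the
  one-dimensional notions see only the latter.\<close>

lemma is_functor_Ho_fc_iff: "is_functor (Ho_fc U M) X F \<longleftrightarrow> is_functor (fc_cat M) X F"
  using category_fc B.category_axioms by (simp add: is_functor_def)

lemma is_nat_trans_Ho_fc_iff: "is_nat_trans (Ho_fc U M) X \<theta> \<longleftrightarrow> is_nat_trans (fc_cat M) X \<theta>"
  by (simp add: is_nat_trans_def is_functor_Ho_fc_iff)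

definition extend :: "('o, 'm, 'p, 'n) func \<Rightarrow> ('o, 'm set, 'p, 'n) func" where
  "extend H = category2.pi0_lift (Ho_fc U M) (comp_func (fc_cat M) H (id_func (fc_cat M)))"

text \<open>Whiskering with the inclusion cuts the components down to fibrant-cofibrant objects, as
  extensionality over the objects of \<open>pi0\<close> demands.\<close>

definition extend_nat :: "(('o, 'm, 'p, 'n) func, 'o, 'n) ntrans \<Rightarrow> (('o, 'm set, 'p, 'n) func, 'o, 'n) ntrans" where
  "extend_nat \<theta> = \<lparr>NDom = extend (NDom \<theta>), NCod = extend (NCod \<theta>),
     NCmp = NCmp (precomp_nat (fc_cat M) (id_func (fc_cat M)) \<theta>)\<rparr>"

lemma fc_obj_arr: "Y \<in> Obj (fc_cat M) \<Longrightarrow> Y \<in> Obj M" "f \<in> Arr (fc_cat M) \<Longrightarrow> f \<in> Arr M"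
  by (auto simp: fc_cat_def Arr_full_subcat)

lemma extend_nat_simps [simp]:
  "NDom (extend_nat \<theta>) = extend (NDom \<theta>)" "NCod (extend_nat \<theta>) = extend (NCod \<theta>)"
  "Y \<in> Obj (fc_cat M) \<Longrightarrow> NCmp (extend_nat \<theta>) Y = NCmp \<theta> Y"
  "NCmp (extend_nat \<theta>) \<in> extensional (Obj (fc_cat M))"
  by (simp_all add: extend_nat_def)

text \<open>A 2-cell is represented by a sequence of homotopies in \<open>fc_cat M\<close> whose
  arrows \<open>s\<close> are weak equivalences there, and \<open>H\<close> inverts these. This is
  the premise under which \<open>pi0_lift\<close> is independent of representatives.\<close>

lemma restriction_inverts_cells:
  assumes "is_functor M X H" and inv: "\<forall>w\<in>Weq M. is_iso X (FAr H w)" and \<alpha>: "\<alpha> \<in> Cells (Ho_fc U M) f g"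
  shows "FAr (comp_func (fc_cat M) H (id_func (fc_cat M))) f =
    FAr (comp_func (fc_cat M) H (id_func (fc_cat M))) g"
proof -
  obtain Hs where Hs: "is_homotopy_seq (fc_cat M) (Weq M \<inter> Arr (fc_cat M)) f g Hs"
    using \<alpha> unfolding Ho_fc_def Cells_Ho by blast
  show ?thesis
    by (rule functor_homotopy_eq[OF is_functor_comp[OF is_functor_fc_incl assms(1)] _
          category.arr_hom[OF category_fc homotopy_seq_arr[OF Hs]] Hs]) (use inv in simp)
qed

lemma extend:
  assumes H: "is_functor M X H" "\<forall>w\<in>Weq M. is_iso X (FAr H w)"
  shows "is_functor (pi0 (Ho_fc U M)) X (extend H)"
    and "Y \<in> Obj (fc_cat M) \<Longrightarrow> FOb (extend H) Y = FOb H Y"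
    and "f \<in> Arr (fc_cat M) \<Longrightarrow> FAr (extend H) (cls f) = FAr H f"
proof -
  show "is_functor (pi0 (Ho_fc U M)) X (extend H)"
    unfolding extend_def
    using is_functor_comp[OF is_functor_fc_incl H(1)] restriction_inverts_cells[OF H]
    by (intro B.is_functor_pi0_lift) (simp_all add: is_functor_Ho_fc_iff)
  show "FOb (extend H) Y = FOb H Y" if "Y \<in> Obj (fc_cat M)"
    using that by (simp add: extend_def)
  show "FAr (extend H) (cls f) = FAr H f" if "f \<in> Arr (fc_cat M)"
    using B.FAr_pi0_lift[OF B.arr_hom restriction_inverts_cells[OF H]] that by (simp add: extend_def)
qed

lemma is_nat_trans_extend:
  assumes \<theta>: "\<theta> \<in> Arr (functor_cat_inv M (Weq M) X)"
  shows "is_nat_trans (pi0 (Ho_fc U M)) X (extend_nat \<theta>)"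
proof -
  have nt: "is_nat_trans M X \<theta>" and inv: "\<forall>w\<in>Weq M. is_iso X (FAr (NDom \<theta>) w)"
    "\<forall>w\<in>Weq M. is_iso X (FAr (NCod \<theta>) w)"
    using \<theta> by (simp_all add: Arr_functor_cat_inv)
  have "is_nat_trans (Ho_fc U M) X (precomp_nat (fc_cat M) (id_func (fc_cat M)) \<theta>)"
    using is_nat_trans_precomp_nat[OF is_functor_fc_incl nt] by (simp add: is_nat_trans_Ho_fc_iff)
  from B.is_nat_trans_pi0_lift[OF this] show ?thesis
    using restriction_inverts_cells[OF is_nat_transD(1)[OF nt] inv(1)]
      restriction_inverts_cells[OF is_nat_transD(2)[OF nt] inv(2)]
    by (simp add: extend_nat_def extend_def)
qed

text \<open>\<open>pi0_q\<close> sends \<open>f\<close> to the class of \<open>RQ f\<close>, and the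
  extension evaluates \<open>H\<close> on that representative; what remains is
  \<open>H RQ\<close>.\<close>

lemma extend_comp_pi0_q:
  assumes H: "is_functor M X H" "\<forall>w\<in>Weq M. is_iso X (FAr H w)"
  shows "comp_func M (extend H) (pi0_q U M) = comp_func M H (r_func M)"
  using extend(2,3)[OF H] r_func_fc_obj r_func_fc_arr
  by (simp add: comp_func_def pi0_q_simps del: r_func_simps cong: restrict_cong)

lemma comp_pi0_q_Weq:
  assumes "is_functor (pi0 (Ho_fc U M)) X K"
  shows "is_functor M X (comp_func M K (pi0_q U M))" "\<forall>w\<in>Weq M. is_iso X (FAr (comp_func M K (pi0_q U M)) w)"
proof -
  show "is_functor M X (comp_func M K (pi0_q U M))"
    by (rule is_functor_comp[OF is_functor_pi0_q assms])
  show "\<forall>w\<in>Weq M. is_iso X (FAr (comp_func M K (pi0_q U M)) w)"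
    using is_functor.preserves_iso[OF assms pi0_q_Weq] W_arr by (auto simp: subset_iff)
qed

text \<open>Every arrow of \<open>pi0\<close> is the class of some \<open>f\<close> in
  \<open>fc_cat M\<close>, where \<open>RQ f = f\<close>; so restricting \<open>K pi0_q\<close>
  recovers \<open>K\<close> on all classes.\<close>

lemma extend_precomp:
  assumes K: "is_functor (pi0 (Ho_fc U M)) X K"
  shows "extend (comp_func M K (pi0_q U M)) = K"
proof (rule func_eqI[OF extend(1)[OF comp_pi0_q_Weq[OF K]] K])
  show "FOb (extend (comp_func M K (pi0_q U M))) Y = FOb K Y" if "Y \<in> Obj (pi0 (Ho_fc U M))" for Y
    using that extend(2)[OF comp_pi0_q_Weq[OF K], of Y] r_func_fc(1)[of Y] fc_obj_arr(1)[of Y]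
    by (simp add: pi0_q_simps del: r_func_simps)
  fix L assume "L \<in> Arr (pi0 (Ho_fc U M))"
  then obtain f where f: "f \<in> Arr (fc_cat M)" "L = cls f"
    by auto
  show "FAr (extend (comp_func M K (pi0_q U M))) L = FAr K L"
    using extend(3)[OF comp_pi0_q_Weq[OF K] f(1)] r_func_fc(2)[OF category.arr_hom[OF category_fc f(1)]]
      fc_obj_arr(2)[OF f(1)] f(2)
    by (simp add: pi0_q_simps del: r_func_simps)
qed

definition extension :: "('p, 'n, 'z) cat_scheme \<Rightarrow>
    (('o, 'm, 'p, 'n) func, (('o, 'm, 'p, 'n) func, 'o, 'n) ntrans,
     ('o, 'm set, 'p, 'n) func, (('o, 'm set, 'p, 'n) func, 'o, 'n) ntrans) func" where
  "extension X = \<lparr>FOb = (\<lambda>H\<in>Obj (functor_cat_inv M (Weq M) X). extend H),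
     FAr = (\<lambda>\<theta>\<in>Arr (functor_cat_inv M (Weq M) X). extend_nat \<theta>)\<rparr>"

lemma extension_simps [simp]:
  "H \<in> Obj (functor_cat_inv M (Weq M) X) \<Longrightarrow> FOb (extension X) H = extend H"
  "\<theta> \<in> Arr (functor_cat_inv M (Weq M) X) \<Longrightarrow> FAr (extension X) \<theta> = extend_nat \<theta>"
  by (simp_all add: extension_def)

lemma is_functor_extension:
  "is_functor (functor_cat_inv M (Weq M) X) (functor_cat (pi0 (Ho_fc U M)) X) (extension X)"
proof (rule is_functor.intro)
  interpret E: category "functor_cat_inv M (Weq M) X"
    by (rule category_functor_cat_inv)
  {
    fix \<theta> F G assume \<theta>: "\<theta> \<in> Hom (functor_cat_inv M (Weq M) X) F G"
    have a: "\<theta> \<in> Arr (functor_cat_inv M (Weq M) X)" "NDom \<theta> = F" "NCod \<theta> = G"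
      using \<theta> by (simp_all add: Hom_iff)
    show "FAr (extension X) \<theta> \<in> Hom (functor_cat (pi0 (Ho_fc U M)) X) (FOb (extension X) F) (FOb (extension X) G)"
      using a is_nat_trans_extend[OF a(1)] E.hom_obj[OF \<theta>] by (simp add: Hom_functor_cat)
    fix \<eta> H assume \<eta>: "\<eta> \<in> Hom (functor_cat_inv M (Weq M) X) G H"
    have b: "\<eta> \<in> Arr (functor_cat_inv M (Weq M) X)" "NDom \<eta> = G" "NCod \<eta> = H"
      "\<eta> \<cdot>\<^bsub>functor_cat M X\<^esub> \<theta> \<in> Arr (functor_cat_inv M (Weq M) X)"
      using \<eta> E.cmp_hom[OF \<theta> \<eta>] by (simp_all add: Hom_iff)
    have "extend_nat (\<eta> \<cdot>\<^bsub>functor_cat M X\<^esub> \<theta>) =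
        extend_nat \<eta> \<cdot>\<^bsub>functor_cat (pi0 (Ho_fc U M)) X\<^esub> extend_nat \<theta>"
      using fc_obj_arr(1) functor_cat_cmp_simps(4)[where A = "pi0 (Ho_fc U M)", unfolded B.pi0_simps Ho_fc_simps]
      by (intro ntrans_eqI[of _ _ "Obj (fc_cat M)"]) auto
    then show "FAr (extension X) (\<eta> \<cdot>\<^bsub>functor_cat_inv M (Weq M) X\<^esub> \<theta>) =
        FAr (extension X) \<eta> \<cdot>\<^bsub>functor_cat (pi0 (Ho_fc U M)) X\<^esub> FAr (extension X) \<theta>"
      using a b by simp
  }
  fix H assume H: "H \<in> Obj (functor_cat_inv M (Weq M) X)"
  then show "FOb (extension X) H \<in> Obj (functor_cat (pi0 (Ho_fc U M)) X)"
    using extend(1)[of X H] by (simp add: Obj_functor_cat_inv)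
  have i: "Ide (functor_cat M X) H \<in> Arr (functor_cat_inv M (Weq M) X)"
    using E.ide_hom[OF H] by (simp add: Hom_iff)
  have H': "is_functor M X H" "\<forall>w\<in>Weq M. is_iso X (FAr H w)"
    using H by (simp_all add: Obj_functor_cat_inv)
  have "extend_nat (Ide (functor_cat M X) H) = Ide (functor_cat (pi0 (Ho_fc U M)) X) (extend H)"
    using extend(2)[OF H'] fc_obj_arr(1)
      functor_cat_ide_simps(4)[where A = "pi0 (Ho_fc U M)", unfolded B.pi0_simps Ho_fc_simps]
    by (intro ntrans_eqI[of _ _ "Obj (fc_cat M)"]) auto
  then show "FAr (extension X) (Ide (functor_cat_inv M (Weq M) X) H) =
      Ide (functor_cat (pi0 (Ho_fc U M)) X) (FOb (extension X) H)"
    using H i by simp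
qed (auto simp: category_functor_cat category_functor_cat_inv, auto simp: extension_def)

lemma extension_precomp:
  "comp_func (functor_cat (pi0 (Ho_fc U M)) X) (extension X) (precomp M (pi0 (Ho_fc U M)) (pi0_q U M) X) =
    id_func (functor_cat (pi0 (Ho_fc U M)) X)"
proof -
  have P: "is_functor (functor_cat (pi0 (Ho_fc U M)) X) (functor_cat_inv M (Weq M) X)
      (precomp M (pi0 (Ho_fc U M)) (pi0_q U M) X)"
    by (rule is_functor_precomp_inv[OF is_functor_pi0_q W_arr pi0_q_Weq])
  show ?thesis
  proof (rule func_eqI[OF is_functor_comp[OF P is_functor_extension] is_functor_id[OF category_functor_cat]])
    fix K assume "K \<in> Obj (functor_cat (pi0 (Ho_fc U M)) X)"
    then show "FOb (comp_func (functor_cat (pi0 (Ho_fc U M)) X) (extension X)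
        (precomp M (pi0 (Ho_fc U M)) (pi0_q U M) X)) K = FOb (id_func (functor_cat (pi0 (Ho_fc U M)) X)) K"
      using is_functor.ob_obj[OF P, of K] extend_precomp[of X K] by simp
  next
    fix \<theta> assume "\<theta> \<in> Arr (functor_cat (pi0 (Ho_fc U M)) X)"
    then have \<theta>: "is_nat_trans (pi0 (Ho_fc U M)) X \<theta>"
      by simp
    note t = is_nat_transD[OF \<theta>]
    have "extend_nat (precomp_nat M (pi0_q U M) \<theta>) = \<theta>"
      using t(3) extend_precomp[OF t(1)] extend_precomp[OF t(2)] fc_obj_arr(1) r_func_fc(1)
      by (intro ntrans_eqI[of _ _ "Obj (fc_cat M)"]) (simp_all add: pi0_q_simps del: r_func_simps)
    then show "FAr (comp_func (functor_cat (pi0 (Ho_fc U M)) X) (extension X)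
        (precomp M (pi0 (Ho_fc U M)) (pi0_q U M) X)) \<theta> = FAr (id_func (functor_cat (pi0 (Ho_fc U M)) X)) \<theta>"
      using \<theta> is_functor.ar_arr[OF P, of \<theta>] by (simp add: Hom_iff)
  qed
qed

text \<open>Expressing this composite as a \<open>precomp_endo\<close> brings it within reach of
  \<open>precomp_endo_isomorphic\<close>, which compares such endofunctors along transformations
  with components in \<open>W\<close>.\<close>

lemma precomp_extension:
  "comp_func (functor_cat_inv M (Weq M) X) (precomp M (pi0 (Ho_fc U M)) (pi0_q U M) X) (extension X) =
    precomp_endo M (Weq M) X (r_func M)"
proof -
  have P: "is_functor (functor_cat (pi0 (Ho_fc U M)) X) (functor_cat_inv M (Weq M) X)
      (precomp M (pi0 (Ho_fc U M)) (pi0_q U M) X)"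
    by (rule is_functor_precomp_inv[OF is_functor_pi0_q W_arr pi0_q_Weq])
  have r: "is_functor M M (r_func M)" "FAr (r_func M) ` Weq M \<subseteq> Weq M"
    using is_functor_comp[OF is_functor_Q is_functor_R] R_Weq[OF Q_Weq] W_arr by (auto simp: r_func_eq[symmetric] subset_iff)
  show ?thesis
  proof (rule func_eqI[OF is_functor_comp[OF is_functor_extension P] is_functor_precomp_endo[OF r(1) W_arr r(2)]])
    fix H assume "H \<in> Obj (functor_cat_inv M (Weq M) X)"
    then show "FOb (comp_func (functor_cat_inv M (Weq M) X) (precomp M (pi0 (Ho_fc U M)) (pi0_q U M) X)
        (extension X)) H = FOb (precomp_endo M (Weq M) X (r_func M)) H"
      using extend_comp_pi0_q[of X H] extend(1)[of X H] by (simp add: precomp_endo_simps Obj_functor_cat_inv[of H])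
  next
    fix \<theta> assume \<theta>: "\<theta> \<in> Arr (functor_cat_inv M (Weq M) X)"
    then have nt: "is_nat_trans M X \<theta>" and inv: "\<forall>w\<in>Weq M. is_iso X (FAr (NDom \<theta>) w)"
        "\<forall>w\<in>Weq M. is_iso X (FAr (NCod \<theta>) w)"
      by (simp_all add: Arr_functor_cat_inv)
    have "precomp_nat M (pi0_q U M) (extend_nat \<theta>) = precomp_nat M (r_func M) \<theta>"
      using extend_comp_pi0_q[OF is_nat_transD(1)[OF nt] inv(1)] extend_comp_pi0_q[OF is_nat_transD(2)[OF nt] inv(2)]
        r_func_fc_obj
      by (intro ntrans_eqI[of _ _ "Obj M"]) (simp_all add: pi0_q_simps del: r_func_simps)
    then show "FAr (comp_func (functor_cat_inv M (Weq M) X) (precomp M (pi0 (Ho_fc U M)) (pi0_q U M) X)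
        (extension X)) \<theta> = FAr (precomp_endo M (Weq M) X (r_func M)) \<theta>"
      using \<theta> is_nat_trans_extend[OF \<theta>] by (simp add: precomp_endo_simps)
  qed
qed

lemma is_equivalence_precomp_pi0_q:
  "is_equivalence_of_categories (functor_cat (pi0 (Ho_fc U M)) X) (functor_cat_inv M (Weq M) X)
    (precomp M (pi0 (Ho_fc U M)) (pi0_q U M) X)"
proof -
  let ?A = "functor_cat (pi0 (Ho_fc U M)) X" and ?E = "functor_cat_inv M (Weq M) X"
  have Q: "FAr Q_func ` Weq M \<subseteq> Weq M" and r: "FAr (r_func M) ` Weq M \<subseteq> Weq M"
    and i: "FAr (id_func M) ` Weq M \<subseteq> Weq M"
    using R_Weq Q_Weq W_arr by (auto simp: subset_iff)
  have p: "isomorphic (functor_cat ?E ?E) (precomp_endo M (Weq M) X Q_func) (precomp_endo M (Weq M) X (id_func M))"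
    by (rule precomp_endo_isomorphic[OF is_nat_trans_p _ _ W_arr Q i]) (simp_all add: p_ar)
  have v: "isomorphic (functor_cat ?E ?E) (precomp_endo M (Weq M) X Q_func) (precomp_endo M (Weq M) X (r_func M))"
    by (rule precomp_endo_isomorphic[OF is_nat_trans_v _ _ W_arr Q r])
      (simp_all add: v_ar cofibrant_obj Q_ob_cofibrant)
  have "isomorphic (functor_cat ?E ?E)
      (comp_func ?E (precomp M (pi0 (Ho_fc U M)) (pi0_q U M) X) (extension X)) (id_func ?E)"
    \<comment> \<open>The leg \<open>v\<close> of the span is reversed and followed by the leg
      \<open>p\<close>, which leads from \<open>RQ\<close> through \<open>Q\<close> to the
      identity.\<close>
    using category.isomorphic_trans[OF category_functor_cat isomorphic_sym[OF v] p]
    by (simp add: precomp_extension precomp_endo_id[OF category_axioms W_arr])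
  moreover have "isomorphic (functor_cat ?A ?A) (id_func ?A)
      (comp_func ?A (extension X) (precomp M (pi0 (Ho_fc U M)) (pi0_q U M) X))"
    unfolding extension_precomp
    by (rule category.isomorphic_refl[OF category_functor_cat]) (simp add: is_functor_id category_functor_cat)
  ultimately show ?thesis
    unfolding is_equivalence_of_categories_def
    using is_functor_extension is_functor_precomp_inv[OF is_functor_pi0_q W_arr pi0_q_Weq] by blast
qed

text \<open>The content beyond objects and arrows lies in the 2-cells: \<open>q\<close> sends
  \<open>f\<close> to the identity 2-cell of \<open>RQ f\<close>, and \<open>pi0_func\<close>
  evaluates a cell by the class of its source, which gives the class of \<open>RQ f\<close>
  again.\<close>

lemma disc_pi0_q:
  assumes K: "is_functor (pi0 (Ho_fc U M)) X K"
  shows "disc_func (comp_func M K (pi0_q U M)) =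
    comp_func2 (disc M) (comp_func2 (Ho_fc U M) (disc_func K) (pi0_func (Ho_fc U M))) (q_func U M)"
proof (rule func2_eqI[OF is_functor2_disc[OF comp_pi0_q_Weq(1)[OF K]]
      is_functor2_comp[OF is_functor2_q is_functor2_comp[OF B.is_functor2_pi0_func is_functor2_disc[OF K]]]])
  fix f assume "f \<in> Cell (disc M)"
  then have f: "f \<in> Arr M"
    by simp
  have "VIde (Ho_fc U M) (FAr (r_func M) f) \<in> Cells (Ho_fc U M) (FAr (r_func M) f) (FAr (r_func M) f)"
    using r_func_fc_arr[OF f] by (intro B.vide_cells[OF B.arr_hom]) simp
  then show "FCell (disc_func (comp_func M K (pi0_q U M))) f = FCell (comp_func2 (disc M)
      (comp_func2 (Ho_fc U M) (disc_func K) (pi0_func (Ho_fc U M))) (q_func U M)) f"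
    using f by (simp add: pi0_q_simps Cells_def del: r_func_simps)
qed (use r_func_fc_obj r_func_fc_arr in \<open>simp_all add: pi0_q_simps del: r_func_simps\<close>)

text \<open>Pulling back along \<open>pi0_q\<close> acts on ordinary functors, whereas pulling back
  along \<open>q\<close> and along \<open>pi0_func\<close> acts on 2-functors. The identification
  \<open>disc_hom\<close> on both sides is what lets the factorization of the pullback be stated as
  an equation.\<close>

lemma disc_precomp_pi0_q:
  "comp_func (functor_cat (pi0 (Ho_fc U M)) X) (disc_hom M X) (precomp M (pi0 (Ho_fc U M)) (pi0_q U M) X) =
    comp_func (functor_cat (pi0 (Ho_fc U M)) X) (precomp2 (disc M) (Ho_fc U M) (q_func U M) (disc X))
      (comp_func (functor_cat (pi0 (Ho_fc U M)) X)
        (precomp2 (Ho_fc U M) (disc (pi0 (Ho_fc U M))) (pi0_func (Ho_fc U M)) (disc X))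
        (disc_hom (pi0 (Ho_fc U M)) X))"
proof (rule comp_func_cong)
  fix K assume "K \<in> Obj (functor_cat (pi0 (Ho_fc U M)) X)"
  then have K: "is_functor (pi0 (Ho_fc U M)) X K"
    by simp
  show "FOb (disc_hom M X) (FOb (precomp M (pi0 (Ho_fc U M)) (pi0_q U M) X) K) =
      FOb (precomp2 (disc M) (Ho_fc U M) (q_func U M) (disc X)) (FOb (comp_func (functor_cat (pi0 (Ho_fc U M)) X)
        (precomp2 (Ho_fc U M) (disc (pi0 (Ho_fc U M))) (pi0_func (Ho_fc U M)) (disc X))
        (disc_hom (pi0 (Ho_fc U M)) X)) K)"
    using K comp_pi0_q_Weq(1)[OF K] is_functor2_disc[OF K] disc_pi0_q[OF K]
      is_functor2_comp[OF B.is_functor2_pi0_func is_functor2_disc[OF K]] by simp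
next
  fix \<theta> assume "\<theta> \<in> Arr (functor_cat (pi0 (Ho_fc U M)) X)"
  then have \<theta>: "is_nat_trans (pi0 (Ho_fc U M)) X \<theta>"
    by simp
  have "disc_nat (precomp_nat M (pi0_q U M) \<theta>) =
      precomp2_nat (disc M) (q_func U M) (precomp2_nat (Ho_fc U M) (pi0_func (Ho_fc U M)) (disc_nat \<theta>))"
    using disc_pi0_q[OF is_nat_transD(1)[OF \<theta>]] disc_pi0_q[OF is_nat_transD(2)[OF \<theta>]] r_func_fc_obj
      precomp2_nat_simps(4)[where A = "disc M", unfolded disc_simps]
    by (intro ntrans_eqI[of _ _ "Obj M"]) (simp_all add: pi0_q_simps del: r_func_simps)
  then show "FAr (disc_hom M X) (FAr (precomp M (pi0 (Ho_fc U M)) (pi0_q U M) X) \<theta>) =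
      FAr (precomp2 (disc M) (Ho_fc U M) (q_func U M) (disc X)) (FAr (comp_func (functor_cat (pi0 (Ho_fc U M)) X)
        (precomp2 (Ho_fc U M) (disc (pi0 (Ho_fc U M))) (pi0_func (Ho_fc U M)) (disc X))
        (disc_hom (pi0 (Ho_fc U M)) X)) \<theta>)"
    using \<theta> is_nat_trans_precomp_nat[OF is_functor_pi0_q \<theta>] is_nat_trans2_disc_nat[OF \<theta>]
      is_nat_trans2_precomp2_nat[OF B.is_functor2_pi0_func is_nat_trans2_disc_nat[OF \<theta>]] by simp
qed

end

end

theorem theorem3p31:
  fixes M :: "('o, 'm) model"
    and U :: "('d0 \<times> 'd1 \<times> 'd2) itself"
    and X :: "('p, 'n) cat"
  assumes "normal_model_category M"
    and "category X"
  shows "is_functor M (pi0 (Ho_fc U M)) (pi0_q U M) \<and>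
    (\<forall>w \<in> Weq M. is_iso (pi0 (Ho_fc U M)) (FAr (pi0_q U M) w)) \<and>
    is_equivalence_of_categories
      (functor_cat (pi0 (Ho_fc U M)) X)
      (functor_cat_inv M (Weq M) X)
      (precomp M (pi0 (Ho_fc U M)) (pi0_q U M) X) \<and>
    comp_func (functor_cat (pi0 (Ho_fc U M)) X)
      (disc_hom M X)
      (precomp M (pi0 (Ho_fc U M)) (pi0_q U M) X) =
    comp_func (functor_cat (pi0 (Ho_fc U M)) X)
      (precomp2 (disc M) (Ho_fc U M) (q_func U M) (disc X))
      (comp_func (functor_cat (pi0 (Ho_fc U M)) X)
        (precomp2 (Ho_fc U M) (disc (pi0 (Ho_fc U M))) (pi0_func (Ho_fc U M)) (disc X))
        (disc_hom (pi0 (Ho_fc U M)) X))"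
proof -
  interpret normal_model_category M by fact
  show ?thesis
    using is_functor_pi0_q pi0_q_Weq is_equivalence_precomp_pi0_q disc_precomp_pi0_q by blast
qed

end
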